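(* Let $a\in H^\infty$, $\zeta_0\in\mathbb{T}$, and $N\in\mathbb{N}_0$. Then for every $f\in\mathscr{M}(\overline{a})$ the functions $f,f',f'',\ldots,f^{(N)}$ have finite non-tangential limits at $\zeta_0$ if and only if $$\int_0^{2\pi}\frac{|a(e^{it})|^2}{|e^{it}-\zeta_0|^{2N+2}}\,dt<\infty .$$ In this case, for $0\leqslant\ell\leqslant N$, $$k_{\zeta_0,\ell}^{\overline{a}}=T_{\overline{a}}(ak_{\zeta_0,\ell}),\qquad\text{where}\qquad ak_{\zeta_0,\ell}=\ell!\,\frac{z^\ell a}{(1-\overline{\zeta_0}z)^{\ell+1}}.$$ Moreover, for each $\alpha>1$ (and $0\leqslant\ell\leqslant N$), $$\lim_{\substack{\lambda\to\zeta_0\\ \lambda\in\Gamma_\alpha(\zeta_0)}}\|k_{\lambda,\ell}^{\overline{a}}-k_{\zeta_0,\ell}^{\overline{a}}\|_{\overline{a}}=0 .$$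
   Context: $\mathbb{D}$ is the open unit disk, $\mathbb{T}$ the unit circle, $\mathbb{N}_0=\mathbb{N}\cup\{0\}$, $H^2$ the Hardy space of $\mathbb{D}$ with inner product $\langle f,g\rangle_{H^2}=\int_{\mathbb{T}}f\overline{g}\,dm$ ($m$ normalized Lebesgue measure), $H^\infty$ the bounded analytic functions on $\mathbb{D}$. For $\varphi\in L^\infty(\mathbb{T})$, $T_\varphi f=P_+(\varphi f)$ on $H^2$, with $P_+:L^2\to H^2$ the orthogonal projection. $\mathscr{M}(\overline{a}):=T_{\overline{a}}H^2$ with the inner product $\langle T_{\overline{a}}f,T_{\overline{a}}g\rangle_{\overline{a}}:=\langle f,g\rangle_{H^2}$ for $f,g\in H^2\ominus\ker T_{\overline{a}}$, and norm $\|\cdot\|_{\overline{a}}$. It is a Hilbert space of analytic functions on $\mathbb{D}$, and for $\lambda\in\mathbb{D}$, $\ell\in\mathbb{N}_0$, $k_{\lambda,\ell}^{\overline{a}}\in\mathscr{M}(\overline{a})$ is the element with $f^{(\ell)}(\lambda)=\langle f,k_{\lambda,\ell}^{\overline{a}}\rangle_{\overline{a}}$ for all $f\in\mathscr{M}(\overline{a})$. When all $f\in\mathscr{M}(\overline a)$ and their derivatives up to order $N$ have finite non-tangential limits at $\zeta_0$, the functional $f\mapsto f^{(\ell)}(\zeta_0)$ (non-tangential limit), $0\leqslant\ell\leqslant N$, is continuous on $\mathscr{M}(\overline{a})$ and $k_{\zeta_0,\ell}^{\overline{a}}\in\mathscr{M}(\overline{a})$ is its representing element: $f^{(\ell)}(\zeta_0)=\langle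 f,k_{\zeta_0,\ell}^{\overline{a}}\rangle_{\overline{a}}$. For $\alpha>1$, $\Gamma_\alpha(\zeta_0):=\{z\in\mathbb{D}:|z-\zeta_0|<\alpha(1-|z|)\}$; $f$ has finite non-tangential limit $L$ at $\zeta_0$ if $f(z)\to L$ as $z\to\zeta_0$ within $\Gamma_\alpha(\zeta_0)$, for every $\alpha>1$. *)

theory Defs
  imports "HOL-Probability.Probability" "HOL-Complex_Analysis.Complex_Analysis"
begin

text \<open>
  An analytic function on the open unit disk is represented by a total function on the complex
  plane that vanishes off the disk. Hence two analytic functions on the disk are equal iff their
  representatives are, and the definite descriptions below determine unique objects.
\<close>

definition disk_analytic :: "(complex \<Rightarrow> complex) set" where
  "disk_analytic = {f. f holomorphic_on ball 0 1 \<and> (\<forall>z. z \<notin> ball 0 1 \<longrightarrow> f z = 0)}"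

text \<open>Normalized Lebesgue measure on the unit circle, as a Borel measure on the plane.\<close>

definition circle_measure :: "complex measure" where
  "circle_measure = distr (uniform_measure lborel {0..2*pi}) borel cis"

definition H2 :: "(complex \<Rightarrow> complex) set" where
  "H2 = {f \<in> disk_analytic. \<exists>C. \<forall>r\<in>{0..<1::real}.
           (\<integral>\<zeta>. (norm (f (of_real r * \<zeta>)))\<^sup>2 \<partial>circle_measure) \<le> C}"

definition Hinf :: "(complex \<Rightarrow> complex) set" where
  "Hinf = {f \<in> disk_analytic. bounded (f ` ball 0 1)}"

text \<open>
  The boundary function (radial limit, which exists almost everywhere on the circle for functions
  in H2 and Hinf). It realises the usual identification of H2 with a subspace of L2 of the circle.
\<close>

definition bdry :: "(complex \<Rightarrow> complex) \<Rightarrow> complex \<Rightarrow> complex" where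
  "bdry f \<zeta> = Lim (at_left 1) (\<lambda>r::real. f (of_real r * \<zeta>))"

definition H2_inner :: "(complex \<Rightarrow> complex) \<Rightarrow> (complex \<Rightarrow> complex) \<Rightarrow> complex" where
  "H2_inner f g = (\<integral>\<zeta>. bdry f \<zeta> * cnj (bdry g \<zeta>) \<partial>circle_measure)"

text \<open>The orthogonal projection from L2 of the circle onto H2.\<close>

definition P_plus :: "(complex \<Rightarrow> complex) \<Rightarrow> complex \<Rightarrow> complex" where
  "P_plus g = (THE h. h \<in> H2 \<and>
     (\<forall>k\<in>H2. (\<integral>\<zeta>. (g \<zeta> - bdry h \<zeta>) * cnj (bdry k \<zeta>) \<partial>circle_measure) = 0))"

text \<open>The symbol is a function on the circle, the argument a function on the disk.\<close>

definition toeplitz :: "(complex \<Rightarrow> complex) \<Rightarrow> (complex \<Rightarrow> complex) \<Rightarrow> complex \<Rightarrow> complex" where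
  "toeplitz \<phi> f = P_plus (\<lambda>\<zeta>. \<phi> \<zeta> * bdry f \<zeta>)"

definition co_toeplitz :: "(complex \<Rightarrow> complex) \<Rightarrow> (complex \<Rightarrow> complex) \<Rightarrow> complex \<Rightarrow> complex" where
  "co_toeplitz a = toeplitz (\<lambda>\<zeta>. cnj (bdry a \<zeta>))"

definition M_space :: "(complex \<Rightarrow> complex) \<Rightarrow> (complex \<Rightarrow> complex) set" where
  "M_space a = co_toeplitz a ` H2"

definition ker_compl :: "(complex \<Rightarrow> complex) \<Rightarrow> (complex \<Rightarrow> complex) set" where
  "ker_compl a = {f \<in> H2. \<forall>g\<in>H2. co_toeplitz a g = (\<lambda>_. 0) \<longrightarrow> H2_inner f g = 0}"

text \<open>
  The co-analytic Toeplitz operator maps the orthogonal complement of its kernel bijectively onto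
  its range; the range carries the inner product transported along this bijection.
\<close>

definition M_lift :: "(complex \<Rightarrow> complex) \<Rightarrow> (complex \<Rightarrow> complex) \<Rightarrow> complex \<Rightarrow> complex" where
  "M_lift a u = (THE f. f \<in> ker_compl a \<and> co_toeplitz a f = u)"

definition M_inner :: "(complex \<Rightarrow> complex) \<Rightarrow> (complex \<Rightarrow> complex) \<Rightarrow> (complex \<Rightarrow> complex) \<Rightarrow> complex"
  where "M_inner a u v = H2_inner (M_lift a u) (M_lift a v)"

definition M_norm :: "(complex \<Rightarrow> complex) \<Rightarrow> (complex \<Rightarrow> complex) \<Rightarrow> real" where
  "M_norm a u = sqrt (Re (M_inner a u u))"

definition Stolz :: "real \<Rightarrow> complex \<Rightarrow> complex set" where
  "Stolz \<alpha> \<zeta> = {z \<in> ball 0 1. norm (z - \<zeta>) < \<alpha> * (1 - norm z)}"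

definition has_nt_limit :: "(complex \<Rightarrow> complex) \<Rightarrow> complex \<Rightarrow> complex \<Rightarrow> bool" where
  "has_nt_limit f \<zeta> L \<longleftrightarrow> (\<forall>\<alpha>>1. (f \<longlongrightarrow> L) (at \<zeta> within Stolz \<alpha> \<zeta>))"

text \<open>
  The value at \<open>w\<close> of the derivative of order \<open>l\<close>: the ordinary one inside the disk, the
  non-tangential limit at points of the circle.
\<close>

definition deriv_value :: "nat \<Rightarrow> (complex \<Rightarrow> complex) \<Rightarrow> complex \<Rightarrow> complex" where
  "deriv_value l f w =
     (if w \<in> ball 0 1 then (deriv ^^ l) f w else (THE L. has_nt_limit ((deriv ^^ l) f) w L))"

definition represents_deriv ::
    "(complex \<Rightarrow> complex) \<Rightarrow> complex \<Rightarrow> nat \<Rightarrow> (complex \<Rightarrow> complex) \<Rightarrow> bool" where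
  "represents_deriv a w l k \<longleftrightarrow>
     k \<in> M_space a \<and> (\<forall>f\<in>M_space a. deriv_value l f w = M_inner a f k)"

definition M_kernel :: "(complex \<Rightarrow> complex) \<Rightarrow> complex \<Rightarrow> nat \<Rightarrow> complex \<Rightarrow> complex" where
  "M_kernel a w l = (THE k. represents_deriv a w l k)"

text \<open>
  The product of \<open>a\<close> with the function \<open>k\<^sub>w\<^sub>,\<^sub>l\<close>. It vanishes off the disk because \<open>a\<close> does.
\<close>

definition a_kernel :: "(complex \<Rightarrow> complex) \<Rightarrow> complex \<Rightarrow> nat \<Rightarrow> complex \<Rightarrow> complex" where
  "a_kernel a w l = (\<lambda>z. fact l * (z ^ l * a z / (1 - cnj w * z) ^ (l + 1)))"

end

theory Submission
  imports Defs
begin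

text \<open>
  Everything rests on the formula \<open>f\<^bsup>(l)\<^esup>(w) = \<langle>g, a k\<^bsub>w,l\<^esub>\<rangle>\<close> in \<open>H\<^sup>2\<close>, valid for
  \<open>w\<close> in the disk and \<open>f\<close> the image of \<open>g\<close> under the co-analytic Toeplitz operator, which is
  the adjoint of multiplication by \<open>a\<close>. If all the derivatives of order \<open>N\<close> have limits along the
  radius to \<open>\<zeta>\<^sub>0\<close>, the uniform boundedness principle bounds the norms of \<open>a k\<^bsub>w,N\<^esub>\<close>, that is,
  the integrals of \<open>|a|\<^sup>2 / |\<zeta> - w|\<^bsup>2N+2\<^esup>\<close>, and Fatou's lemma gives the integrability condition.
  Conversely, in a Stolz angle \<open>|\<zeta> - \<zeta>\<^sub>0| \<le> (1 + \<alpha>) |\<zeta> - w|\<close>, so the integrability condition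
  provides a dominating function and \<open>a k\<^bsub>w,l\<^esub>\<close> converges in \<open>H\<^sup>2\<close> to \<open>a k\<^bsub>\<zeta>\<^sub>0,l\<^esub>\<close>.

  The boundary functions behind these norms exist by Fatou's theorem on radial limits. It is
  derived from a weak-type estimate for the radial maximal function of \<open>f\<^sup>2\<close>, which is
  again analytic: the Poisson kernel is decreasing, hence Poisson integrals are dominated by
  centred averages, and these are controlled by Vitali's covering lemma.
\<close>

section \<open>Hilbert spaces and square-summable sequences\<close>

text \<open>Membership in \<open>H2\<close> is defined by means over circles inside the disk,
  whereas \<open>H2_inner\<close> integrates boundary functions. Nothing can be said about inner
  products until radial limits exist almost everywhere and Parseval's identity has been carried to
  the boundary; most of the work goes into this. Squaring is what makes a weak-type estimate for L1
  sufficient: the mean of |f^2| is a mean square of f, hence bounded by the squared norm, and as f^2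
  is analytic its Poisson formula comes straight from Cauchy's. On the range space the transported
  norm can be computed because a vector that represents a functional of the image is automatically
  orthogonal to the kernel of the Toeplitz operator. Distances between representing elements of the
  range are therefore H^2 distances between the functions \<open>a_kernel\<close>, and continuity of
  the boundary functionals needs no separate argument.\<close>

lemma orthogonal_decomposition:
  fixes K :: "'a::{real_inner,complete_space} set"
  assumes "closed K" "subspace K"
  obtains k where "k \<in> K" "\<And>y. y \<in> K \<Longrightarrow> inner (x - k) y = 0"
proof -
  define d where "d = infdist x K"
  have K0: "K \<noteq> {}" using subspace_0[OF assms(2)] by blast
  have dge: "d \<le> norm (x - y)" if "y \<in> K" for y
    unfolding d_def dist_norm[symmetric] by (rule infdist_le[OF that])
  have d0: "0 \<le> d" unfolding d_def by (rule infdist_nonneg)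
  have "\<exists>y\<in>K. norm (x - y) < d + 1 / Suc n" for n
  proof (rule ccontr)
    assume "\<not> ?thesis"
    then have "d + 1 / Suc n \<le> infdist x K"
      unfolding infdist_notempty[OF K0] using K0
      by (intro cINF_greatest) (auto simp: dist_norm not_less)
    then show False by (simp add: d_def)
  qed
  then obtain X where XK: "\<And>n. X n \<in> K" and Xd: "\<And>n. norm (x - X n) < d + 1 / Suc n"
    by metis
  \<comment> \<open>Midpoints of the minimising sequence stay in \<open>K\<close>, hence at distance
    at least \<open>d\<close> from \<open>x\<close>; the parallelogram law then makes the sequence
    Cauchy.\<close>
  have par: "(norm (X m - X n))\<^sup>2 \<le> 2 * (norm (x - X m))\<^sup>2 + 2 * (norm (x - X n))\<^sup>2 - 4 * d\<^sup>2" for m n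
  proof -
    let ?c = "(1/2) *\<^sub>R (X m + X n)"
    have "?c \<in> K" using XK assms(2) by (intro subspace_scale subspace_add)
    then have "d\<^sup>2 \<le> (norm (x - ?c))\<^sup>2" using dge d0 by (intro power_mono) auto
    moreover have "(norm (X m - X n))\<^sup>2 + 4 * (norm (x - ?c))\<^sup>2
        = 2 * (norm (x - X m))\<^sup>2 + 2 * (norm (x - X n))\<^sup>2"
      unfolding power2_norm_eq_inner
      by (simp add: inner_diff_left inner_diff_right inner_add_left inner_add_right inner_commute algebra_simps)
    ultimately show ?thesis by linarith
  qed
  have lim0: "(\<lambda>n. norm (x - X n)) \<longlonglongrightarrow> d"
  proof (rule tendsto_sandwich[OF _ _ tendsto_const])
    show "\<forall>\<^sub>F n in sequentially. d \<le> norm (x - X n)" using dge XK by auto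
    show "\<forall>\<^sub>F n in sequentially. norm (x - X n) \<le> d + 1 / Suc n"
      by (intro always_eventually allI less_imp_le Xd)
    show "(\<lambda>n. d + 1 / Suc n) \<longlonglongrightarrow> d" 
      using tendsto_add[OF tendsto_const[of d] LIMSEQ_inverse_real_of_nat] by (simp add: divide_inverse)
  qed
  have "Cauchy X"
  proof (rule metric_CauchyI)
    fix e :: real assume e: "0 < e"
    have "(\<lambda>n. (norm (x - X n))\<^sup>2) \<longlonglongrightarrow> d\<^sup>2" by (intro tendsto_intros lim0)
    then have "\<forall>\<^sub>F n in sequentially. (norm (x - X n))\<^sup>2 < d\<^sup>2 + e\<^sup>2 / 4"
      using e by (intro order_tendstoD) auto
    then obtain M where M: "\<And>n. n \<ge> M \<Longrightarrow> (norm (x - X n))\<^sup>2 < d\<^sup>2 + e\<^sup>2 / 4"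
      by (auto simp: eventually_sequentially)
    have "dist (X m) (X n) < e" if "m \<ge> M" "n \<ge> M" for m n
    proof -
      have "(norm (X m - X n))\<^sup>2 < e\<^sup>2" using par[of m n] M[OF that(1)] M[OF that(2)] by linarith
      then show ?thesis using e by (simp add: dist_norm power_less_imp_less_base)
    qed
    then show "\<exists>M. \<forall>m\<ge>M. \<forall>n\<ge>M. dist (X m) (X n) < e" by blast
  qed
  then obtain k where k: "X \<longlonglongrightarrow> k" using Cauchy_convergent_iff convergent_def by blast
  have kK: "k \<in> K" using closed_sequentially[OF assms(1) _ k] XK by blast
  have nk: "norm (x - k) = d"
    by (rule LIMSEQ_unique[OF _ lim0]) (intro tendsto_intros k)
  have "inner (x - k) y = 0" if y: "y \<in> K" for y
  proof (cases "y = 0")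
    case False
    \<comment> \<open>The step along \<open>y\<close> that minimises the distance. It would lower
      the squared distance by the square of the inner product over \<open>inner y y\<close>, which
      minimality of \<open>d\<close> excludes unless the inner product is 0.\<close>
    define t where "t = inner (x - k) y / inner y y"
    have "k + t *\<^sub>R y \<in> K" using kK y assms(2) by (intro subspace_add subspace_scale)
    then have "d\<^sup>2 \<le> (norm (x - (k + t *\<^sub>R y)))\<^sup>2" using dge d0 by (intro power_mono) auto
    also have "\<dots> = (norm (x - k))\<^sup>2 - 2 * t * inner (x - k) y + t\<^sup>2 * inner y y"
      unfolding power2_norm_eq_inner
      by (simp add: inner_diff_left inner_diff_right inner_add_left inner_add_right inner_commute algebra_simps power2_eq_square)
    also have "\<dots> = d\<^sup>2 - (inner (x - k) y)\<^sup>2 / inner y y"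
      using False by (simp add: nk t_def power2_eq_square field_simps)
    finally have "(inner (x - k) y)\<^sup>2 / inner y y \<le> 0" by simp
    moreover have "inner y y > 0" using False by simp
    ultimately have "(inner (x - k) y)\<^sup>2 \<le> 0" by (simp add: divide_le_0_iff)
    then show ?thesis by simp
  qed simp
  then show thesis using that kK by blast
qed

text \<open>Banach-Steinhaus through Baire: the closed sets on which all functionals are bounded by
  \<open>k\<close> cover the space, so one of them contains a ball.\<close>

lemma uniform_boundedness_inner:
  fixes y :: "nat \<Rightarrow> 'a::{real_inner,complete_space}"
  assumes "\<And>x. bounded (range (\<lambda>n. inner x (y n)))"
  shows "bounded (range y)"
proof -
  define F where "F k = {x. \<forall>n. \<bar>inner x (y n)\<bar> \<le> real k}" for k
  have clF: "closed (F k)" for k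
    unfolding F_def by (intro closed_Collect_all closed_Collect_le continuous_intros)
  have "(\<Union>k. F k) = UNIV"
  proof (intro set_eqI iffI UNIV_I)
    fix x :: 'a
    obtain B where B: "\<And>n. \<bar>inner x (y n)\<bar> \<le> B" using assms[of x] by (auto simp: bounded_iff)
    obtain k where "B \<le> real k" using real_arch_simple by blast
    then have "x \<in> F k" using B by (auto simp: F_def intro: order_trans)
    then show "x \<in> (\<Union>k. F k)" by blast
  qed
  then have "\<exists>k. interior (F k) \<noteq> {}"
    using Baire_category_alt[of "euclidean :: 'a topology" "range F"] clF
    by (force simp: completely_metrizable_space_euclidean)
  then obtain k z where "z \<in> interior (F k)" by blast
  then obtain e where e: "e > 0" "cball z e \<subseteq> F k"
    by (meson interior_subset mem_interior_cball order_trans)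
  have "norm (y n) \<le> 2 * real k / e" for n
  proof (cases "y n = 0")
    case False
    \<comment> \<open>A vector of length \<open>e\<close> in the direction of \<open>y n\<close>.
      Writing it as a difference of two points of the ball bounds its product with
      \<open>y n\<close> by \<open>2 * k\<close>, while that product equals
      \<open>e * norm (y n)\<close>.\<close>
    define v where "v = (e / norm (y n)) *\<^sub>R y n"
    have nv: "norm v = e" using False e by (simp add: v_def)
    have "z + v \<in> F k" "z \<in> F k" using e nv by (auto intro!: subsetD[OF e(2)] simp: dist_norm)
    then have "\<bar>inner (z + v) (y n)\<bar> \<le> real k" "\<bar>inner z (y n)\<bar> \<le> real k" by (auto simp: F_def)
    then have "inner v (y n) \<le> 2 * real k" by (simp add: inner_add_left)
    moreover have "inner v (y n) = e * norm (y n)"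
      using False by (simp add: v_def flip: power2_norm_eq_inner) (simp add: power2_eq_square)
    ultimately show ?thesis using e by (simp add: field_simps)
  qed (use e in simp)
  then show ?thesis by (auto simp: bounded_iff)
qed

text \<open>Coefficient space of \<open>H\<^sup>2\<close>: it provides completeness through the type classes.\<close>

typedef l2 = "{x :: nat \<Rightarrow> complex. summable (\<lambda>n. (cmod (x n))\<^sup>2)}"
  morphisms coord Abs_l2
  by (rule exI[of _ "\<lambda>_. 0"]) simp

setup_lifting type_definition_l2

lemma summable_coord: "summable (\<lambda>n. (cmod (coord x n))\<^sup>2)"
  using coord[of x] by simp

lemma summable_norm_mult:
  fixes x y :: "nat \<Rightarrow> complex"
  assumes "summable (\<lambda>n. (cmod (x n))\<^sup>2)" "summable (\<lambda>n. (cmod (y n))\<^sup>2)"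
  shows "summable (\<lambda>n. cmod (x n) * cmod (y n))"
proof (rule summable_comparison_test'[OF summable_add[OF assms]])
  fix n
  show "norm (cmod (x n) * cmod (y n)) \<le> (cmod (x n))\<^sup>2 + (cmod (y n))\<^sup>2"
    using sum_squares_bound[of "cmod (x n)" "cmod (y n)"] mult_nonneg_nonneg[OF norm_ge_zero[of "x n"] norm_ge_zero[of "y n"]]
    unfolding real_norm_def by linarith
qed

lemma summable_square_add:
  fixes x y :: "nat \<Rightarrow> complex"
  assumes "summable (\<lambda>n. (cmod (x n))\<^sup>2)" "summable (\<lambda>n. (cmod (y n))\<^sup>2)"
  shows "summable (\<lambda>n. (cmod (x n + y n))\<^sup>2)"
proof (rule summable_comparison_test'[OF summable_mult[OF summable_add[OF assms], of 2]])
  fix n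
  have "(cmod (x n + y n))\<^sup>2 \<le> (cmod (x n) + cmod (y n))\<^sup>2"
    by (intro power_mono norm_triangle_ineq) auto
  also have "\<dots> \<le> 2 * ((cmod (x n))\<^sup>2 + (cmod (y n))\<^sup>2)"
    using sum_squares_bound[of "cmod (x n)" "cmod (y n)"] by (simp add: power2_sum)
  finally show "norm ((cmod (x n + y n))\<^sup>2) \<le> 2 * ((cmod (x n))\<^sup>2 + (cmod (y n))\<^sup>2)" by simp
qed

text \<open>The class \<open>real_inner\<close> knows only real scalars. Complex scaling and the
  complex product \<open>cip\<close> are carried alongside, and arguments from real Hilbert space
  are upgraded by compatibility with multiplication by the imaginary unit.\<close>

lift_definition cscale :: "complex \<Rightarrow> l2 \<Rightarrow> l2" is "\<lambda>c x n. c * x n"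
  by (simp add: norm_mult power_mult_distrib summable_mult)

instantiation l2 :: real_vector
begin
lift_definition zero_l2 :: l2 is "\<lambda>_. 0" by simp
lift_definition plus_l2 :: "l2 \<Rightarrow> l2 \<Rightarrow> l2" is "\<lambda>x y n. x n + y n" by (rule summable_square_add)
lift_definition uminus_l2 :: "l2 \<Rightarrow> l2" is "\<lambda>x n. - x n" by simp
lift_definition minus_l2 :: "l2 \<Rightarrow> l2 \<Rightarrow> l2" is "\<lambda>x y n. x n - y n"
  subgoal for x y using summable_square_add[of x "\<lambda>n. - y n"] by simp done
lift_definition scaleR_l2 :: "real \<Rightarrow> l2 \<Rightarrow> l2" is "\<lambda>c x n. c *\<^sub>R x n"
  by (simp add: power_mult_distrib summable_mult)

instance by standard (transfer; simp add: fun_eq_iff algebra_simps)+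
end

lemma summable_inner_coord: "summable (\<lambda>n. inner (coord x n) (coord y n))"
  by (rule summable_comparison_test'[OF summable_norm_mult[OF summable_coord[of x] summable_coord[of y]]])
     (simp add: Cauchy_Schwarz_ineq2)

instantiation l2 :: real_inner
begin
definition inner_l2 :: "l2 \<Rightarrow> l2 \<Rightarrow> real" where
  "inner_l2 x y = (\<Sum>n. inner (coord x n) (coord y n))"
definition norm_l2 :: "l2 \<Rightarrow> real" where "norm_l2 x = sqrt (inner x x)"
definition sgn_l2 :: "l2 \<Rightarrow> l2" where "sgn_l2 x = x /\<^sub>R norm x"
definition dist_l2 :: "l2 \<Rightarrow> l2 \<Rightarrow> real" where "dist_l2 x y = norm (x - y)"
definition uniformity_l2 :: "(l2 \<times> l2) filter" where
  "uniformity_l2 = (INF e\<in>{0<..}. principal {(x, y). dist x y < e})"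
definition open_l2 :: "l2 set \<Rightarrow> bool" where
  "open_l2 U = (\<forall>x\<in>U. eventually (\<lambda>(x', y). x' = x \<longrightarrow> y \<in> U) uniformity)"
instance
proof
  fix x y z :: l2 and r :: real
  show "inner x y = inner y x" by (simp add: inner_l2_def inner_commute)
  show "inner (x + y) z = inner x z + inner y z"
    unfolding inner_l2_def
    by (subst suminf_add[OF summable_inner_coord summable_inner_coord])
       (simp add: plus_l2.rep_eq inner_add_left)
  show "inner (r *\<^sub>R x) y = r * inner x y"
    unfolding inner_l2_def
    by (subst suminf_mult[OF summable_inner_coord, symmetric]) (simp add: scaleR_l2.rep_eq)
  show "0 \<le> inner x x" unfolding inner_l2_def
    by (intro suminf_nonneg summable_inner_coord) auto
  show "inner x x = 0 \<longleftrightarrow> x = 0" unfolding inner_l2_def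
    by (subst suminf_eq_zero_iff[OF summable_inner_coord])
       (auto simp: coord_inject[symmetric] zero_l2.rep_eq fun_eq_iff)
qed (simp_all add: norm_l2_def sgn_l2_def dist_l2_def uniformity_l2_def open_l2_def)
end

lemma coord_simps [simp]:
  "coord 0 n = 0" "coord (x + y) n = coord x n + coord y n" "coord (- x) n = - coord x n"
  "coord (x - y) n = coord x n - coord y n" "coord (r *\<^sub>R x) n = r *\<^sub>R coord x n"
  "coord (cscale c x) n = c * coord x n"
  by (simp_all add: zero_l2.rep_eq plus_l2.rep_eq uminus_l2.rep_eq minus_l2.rep_eq
      scaleR_l2.rep_eq cscale.rep_eq)

lemma l2_eqI: "(\<And>n. coord x n = coord y n) \<Longrightarrow> x = y"
  by (simp add: coord_inject[symmetric] fun_eq_iff)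

lemma norm_l2_power2: "(norm x)\<^sup>2 = (\<Sum>n. (cmod (coord x n))\<^sup>2)"
  by (simp only: power2_norm_eq_inner inner_l2_def)

lemma sum_coord_le_norm: "finite I \<Longrightarrow> (\<Sum>n\<in>I. (cmod (coord x n))\<^sup>2) \<le> (norm x)\<^sup>2"
  unfolding norm_l2_power2 by (intro sum_le_suminf summable_coord) auto

lemma coord_le_norm: "cmod (coord x n) \<le> norm x"
  using sum_coord_le_norm[of "{n}" x] by (simp add: power_mono_iff)

text \<open>The limit is taken coordinatewise. Finite partial sums of squares pass to the limit, and
  their uniform bounds give both square summability of the limit and convergence in norm.\<close>

instance l2 :: banach
proof
  fix X :: "nat \<Rightarrow> l2" assume C: "Cauchy X"
  have "Cauchy (\<lambda>k. coord (X k) n)" for n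
  proof (rule metric_CauchyI)
    fix e :: real assume "e > 0"
    then obtain M where "\<And>i j. i \<ge> M \<Longrightarrow> j \<ge> M \<Longrightarrow> dist (X i) (X j) < e" using metric_CauchyD[OF C] by blast
    moreover have "dist (coord (X i) n) (coord (X j) n) \<le> dist (X i) (X j)" for i j
      using coord_le_norm[of "X i - X j" n] by (simp add: dist_norm)
    ultimately show "\<exists>M. \<forall>i\<ge>M. \<forall>j\<ge>M. dist (coord (X i) n) (coord (X j) n) < e"
      by (meson le_less_trans)
  qed
  then obtain L where L: "\<And>n. (\<lambda>k. coord (X k) n) \<longlonglongrightarrow> L n"
    unfolding Cauchy_convergent_iff convergent_def by metis
  have part: "(\<Sum>n<m. (cmod (coord (X i) n - L n))\<^sup>2) \<le> e\<^sup>2"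
    if e: "\<And>j. j \<ge> M \<Longrightarrow> dist (X i) (X j) \<le> e" for i m M e
  proof (rule LIMSEQ_le_const2)
    show "(\<lambda>j. \<Sum>n<m. (cmod (coord (X i) n - coord (X j) n))\<^sup>2) \<longlonglongrightarrow> (\<Sum>n<m. (cmod (coord (X i) n - L n))\<^sup>2)"
      by (intro tendsto_intros L)
    show "\<exists>N. \<forall>j\<ge>N. (\<Sum>n<m. (cmod (coord (X i) n - coord (X j) n))\<^sup>2) \<le> e\<^sup>2"
    proof (intro exI allI impI)
      fix j assume "j \<ge> M"
      then have "(norm (X i - X j))\<^sup>2 \<le> e\<^sup>2" using e[of j] by (intro power_mono) (auto simp: dist_norm)
      then show "(\<Sum>n<m. (cmod (coord (X i) n - coord (X j) n))\<^sup>2) \<le> e\<^sup>2"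
        using sum_coord_le_norm[of "{..<m}" "X i - X j"] by simp
    qed
  qed
  have sumd: "summable (\<lambda>n. (cmod (coord (X i) n - L n))\<^sup>2)" 
    and normd: "(\<Sum>n. (cmod (coord (X i) n - L n))\<^sup>2) \<le> e\<^sup>2"
    if e: "\<And>j. j \<ge> M \<Longrightarrow> dist (X i) (X j) \<le> e" for i M e
  proof -
    have P: "(\<Sum>n<m. (cmod (coord (X i) n - L n))\<^sup>2) \<le> e\<^sup>2" for m
      by (rule part[of M]) (rule e)
    show *: "summable (\<lambda>n. (cmod (coord (X i) n - L n))\<^sup>2)"
      using P by (intro bounded_imp_summable[where B="e\<^sup>2"]) (auto simp del: sum.lessThan_Suc simp: lessThan_Suc_atMost[symmetric])
    show "(\<Sum>n. (cmod (coord (X i) n - L n))\<^sup>2) \<le> e\<^sup>2"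
      by (rule suminf_le_const[OF *]) (use P in auto)
  qed
  obtain M1 where "\<And>i j. i \<ge> M1 \<Longrightarrow> j \<ge> M1 \<Longrightarrow> dist (X i) (X j) < 1"
    using metric_CauchyD[OF C, of 1] by auto
  then have "\<And>j. j \<ge> M1 \<Longrightarrow> dist (X M1) (X j) \<le> 1" by (meson less_imp_le order_refl)
  from sumd[OF this] have "summable (\<lambda>n. (cmod (L n - coord (X M1) n))\<^sup>2)" by (simp add: norm_minus_commute)
  from summable_square_add[OF summable_coord[of "X M1"] this]
  have "summable (\<lambda>n. (cmod (L n))\<^sup>2)" by simp
  then obtain x where x: "coord x = L" by (metis Abs_l2_inverse mem_Collect_eq)
  have "X \<longlonglongrightarrow> x"
  proof (rule metric_LIMSEQ_I)
    fix e :: real assume e: "e > 0"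
    obtain M where M: "\<And>i j. i \<ge> M \<Longrightarrow> j \<ge> M \<Longrightarrow> dist (X i) (X j) < e / 2"
      using metric_CauchyD[OF C, of "e/2"] e by auto
    have "dist (X i) x < e" if "i \<ge> M" for i
    proof -
      have "(norm (X i - x))\<^sup>2 \<le> (e/2)\<^sup>2"
        using normd[of M i "e/2"] M[OF that] by (auto simp: norm_l2_power2 x intro: less_imp_le)
      then have "norm (X i - x) \<le> e / 2" using e by (simp add: power_mono_iff)
      then show ?thesis using e by (simp add: dist_norm)
    qed
    then show "\<exists>M. \<forall>i\<ge>M. dist (X i) x < e" by blast
  qed
  then show "convergent X" by (auto simp: convergent_def)
qed

section \<open>The complex inner product on square-summable sequences\<close>

lemma summable_cip: "summable (\<lambda>n. coord x n * cnj (coord y n))"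
  by (rule summable_comparison_test'[OF summable_norm_mult[OF summable_coord[of x] summable_coord[of y]]])
     (simp add: norm_mult)

definition cip :: "l2 \<Rightarrow> l2 \<Rightarrow> complex" where
  "cip x y = (\<Sum>n. coord x n * cnj (coord y n))"

lemma cip_add_left: "cip (x + y) z = cip x z + cip y z"
  unfolding cip_def by (subst suminf_add[OF summable_cip summable_cip]) (simp add: algebra_simps)
lemma cip_cscale_left: "cip (cscale c x) y = c * cip x y"
  unfolding cip_def by (subst suminf_mult[OF summable_cip, symmetric]) (simp add: algebra_simps)
lemma cip_commute: "cip y x = cnj (cip x y)"
proof -
  have "(\<lambda>n. cnj (coord x n * cnj (coord y n))) sums cnj (cip x y)"
    unfolding sums_cnj cip_def by (rule summable_sums[OF summable_cip])
  then show ?thesis unfolding cip_def[of y x] by (simp add: sums_iff mult.commute)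
qed

lemma cip_add_right: "cip x (y + z) = cip x y + cip x z"
  by (metis cip_add_left cip_commute complex_cnj_add)

lemma cip_cscale_right: "cip x (cscale c y) = cnj c * cip x y"
  by (metis cip_cscale_left cip_commute complex_cnj_mult)

lemma cip_diff_left: "cip (x - y) z = cip x z - cip y z"
  using cip_add_left[of "x - y" y z] by simp
lemma cip_diff_right: "cip x (y - z) = cip x y - cip x z"
  using cip_add_right[of x "y - z" z] by simp
lemma cip_zero [simp]: "cip 0 x = 0" "cip x 0 = 0" by (simp_all add: cip_def)

lemma Re_cip: "Re (cip x y) = inner x y"
  unfolding cip_def inner_l2_def by (subst Re_suminf[OF summable_cip]) (simp add: inner_complex_def)
lemma cip_self: "cip x x = of_real ((norm x)\<^sup>2)"
proof -
  have "Im (cip x x) = 0" using cip_commute[of x x] by (metis Im_complex_of_real Reals_cnj_iff complex_is_Real_iff)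
  then show ?thesis by (simp add: complex_eq_iff Re_cip power2_norm_eq_inner)
qed

text \<open>Pairing with \<open>cscale \<i> y\<close> recovers the imaginary part, so real
  orthogonality and the real Riesz theorem can be turned into complex statements.\<close>

lemma cip_eq_inner: "cip x y = Complex (inner x y) (inner x (cscale \<i> y))"
  using Re_cip[of x y] Re_cip[of x "cscale \<i> y"] by (simp add: complex_eq_iff cip_cscale_right)

lemma norm_cscale: "norm (cscale c x) = cmod c * norm x"
proof -
  have "(norm (cscale c x))\<^sup>2 = (cmod c * norm x)\<^sup>2"
    by (simp add: norm_l2_power2 norm_mult power_mult_distrib suminf_mult summable_coord)
  then show ?thesis by (simp add: power2_eq_iff_nonneg)
qed

lemma norm_cip_le: "cmod (cip x y) \<le> norm x * norm y"
proof (cases "cip x y = 0")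
  case False
  \<comment> \<open>A unimodular factor that rotates the product onto its modulus, after which the
    real Cauchy-Schwarz inequality applies.\<close>
  define c where "c = cnj (cip x y) / cmod (cip x y)"
  have c: "cmod c = 1" using False by (simp add: c_def norm_divide)
  have "c * cip x y = of_real (cmod (cip x y))"
    using False by (simp add: c_def complex_norm_square[symmetric] mult.commute power2_eq_square)
  then have "cmod (cip x y) = inner (cscale c x) y" by (metis Re_cip Re_complex_of_real cip_cscale_left)
  also have "\<dots> \<le> norm x * norm y" using norm_cauchy_schwarz[of "cscale c x" y] by (simp add: norm_cscale c)
  finally show ?thesis .
qed simp

lemma bounded_linear_cip_left: "bounded_linear (\<lambda>x. cip x y)"
proof (rule bounded_linear_intro[where K="norm y"])
  show "cip (r *\<^sub>R x) y = r *\<^sub>R cip x y" for r x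
    using cip_cscale_left[of "of_real r" x y]
    by (metis coord_simps(5,6) l2_eqI scaleR_conv_of_real)
qed (simp_all add: cip_add_left norm_cip_le)

lemma tendsto_cip_left: "(f \<longlongrightarrow> l) F \<Longrightarrow> ((\<lambda>n. cip (f n) y) \<longlongrightarrow> cip l y) F"
  by (rule bounded_linear.tendsto[OF bounded_linear_cip_left])

lemma tendsto_cip_right: "(f \<longlongrightarrow> l) F \<Longrightarrow> ((\<lambda>n. cip y (f n)) \<longlongrightarrow> cip y l) F"
  by (subst (1 2) cip_commute) (intro tendsto_cnj tendsto_cip_left)

text \<open>Truncations correspond to Taylor polynomials. They form the dense class on which radial
  limits, boundary norms and Cauchy's formula are immediate.\<close>

lift_definition trunc :: "nat \<Rightarrow> l2 \<Rightarrow> l2" is "\<lambda>m x n. if n < m then x n else 0"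
  by (rule summable_finite[of "{..<m}" for m]) auto

lemma coord_trunc [simp]: "coord (trunc m x) n = (if n < m then coord x n else 0)"
  by (simp add: trunc.rep_eq)

lemma norm_trunc: "(norm (trunc m x))\<^sup>2 = (\<Sum>n<m. (cmod (coord x n))\<^sup>2)"
  unfolding norm_l2_power2 by (subst suminf_finite[of "{..<m}"]) auto

lemma trunc_tendsto: "(\<lambda>m. trunc m x) \<longlonglongrightarrow> x"
proof -
  have orth: "inner (trunc m x) (x - trunc m x) = 0" for m
    unfolding inner_l2_def by (subst suminf_finite[of "{}"]) auto
  have "(norm (x - trunc m x))\<^sup>2 = (norm x)\<^sup>2 - (norm (trunc m x))\<^sup>2" for m
    using orth[of m] unfolding power2_norm_eq_inner
    by (simp add: inner_diff_left inner_diff_right inner_commute)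
  then have "(norm (x - trunc m x))\<^sup>2 = (norm x)\<^sup>2 - (\<Sum>n<m. (cmod (coord x n))\<^sup>2)" for m
    by (simp only: norm_trunc)
  moreover have "(\<lambda>m. (norm x)\<^sup>2 - (\<Sum>n<m. (cmod (coord x n))\<^sup>2)) \<longlonglongrightarrow> (norm x)\<^sup>2 - (norm x)\<^sup>2"
    using summable_LIMSEQ[OF summable_coord[of x]] by (intro tendsto_intros) (simp add: norm_l2_power2)
  ultimately have "(\<lambda>m. (norm (x - trunc m x))\<^sup>2) \<longlonglongrightarrow> 0" by simp
  from tendsto_real_sqrt[OF this] have "(\<lambda>m. x - trunc m x) \<longlonglongrightarrow> 0"
    by (simp add: tendsto_norm_zero_iff)
  from tendsto_diff[OF tendsto_const[of x] this] show ?thesis by simp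
qed

section \<open>The Hardy space as a space of power series\<close>

lemma cis_measurable [measurable]: "cis \<in> borel_measurable borel"
  by (intro borel_measurable_continuous_onI continuous_intros)

lemma cnj_measurable [measurable]: "cnj \<in> borel_measurable borel"
  by (intro borel_measurable_continuous_onI continuous_intros)

lemma prob_space_circle: "prob_space circle_measure"
  unfolding circle_measure_def
  by (intro prob_space.prob_space_distr prob_space_uniform_measure) auto

interpretation circle: prob_space circle_measure by (rule prob_space_circle)

lemma sets_circle [simp, measurable_cong]: "sets circle_measure = sets borel"
  by (simp add: circle_measure_def)

lemma space_circle [simp]: "space circle_measure = UNIV"
  by (simp add: circle_measure_def)

lemma AE_circle_iff:
  assumes [measurable]: "{\<zeta>. P \<zeta>} \<in> sets borel"
  shows "(AE \<zeta> in circle_measure. P \<zeta>) \<longleftrightarrow> (AE t in lborel. t \<in> {0..2*pi} \<longrightarrow> P (cis t))"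
  unfolding circle_measure_def using assms by (subst AE_distr_iff) (auto simp: AE_uniform_measure)

lemma AE_circle_norm: "AE \<zeta> in circle_measure. norm \<zeta> = 1"
  by (subst AE_circle_iff) auto

lemma nn_integral_circle:
  assumes [measurable]: "f \<in> borel_measurable borel"
  shows "(\<integral>\<^sup>+\<zeta>. f \<zeta> \<partial>circle_measure) = (\<integral>\<^sup>+t\<in>{0..2*pi}. f (cis t) \<partial>lborel) / ennreal (2 * pi)"
  unfolding circle_measure_def by (subst nn_integral_distr) (auto simp: nn_integral_uniform_measure)

text \<open>The bridge between the circle as a measure space and the gauge integral over
  \<open>{0..2*pi}\<close>, in which contour integrals and changes of variable are
  available.\<close>

lemma circle_continuous:
  fixes f :: "complex \<Rightarrow> complex"
  assumes [measurable]: "f \<in> borel_measurable borel" and c: "continuous_on (sphere 0 1) f"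
  shows "integrable circle_measure f"
    and "((\<lambda>t. f (cis t)) has_integral (2 * pi * (\<integral>\<zeta>. f \<zeta> \<partial>circle_measure))) {0..2*pi}"
proof -
  have "bounded (f ` sphere 0 1)" using c compact_sphere compact_continuous_image compact_imp_bounded by blast
  then obtain B where "\<forall>y\<in>f ` sphere 0 1. norm y \<le> B" unfolding bounded_iff by blast
  then have "\<And>\<zeta>. norm \<zeta> = 1 \<Longrightarrow> norm (f \<zeta>) \<le> B" by simp
  then show "integrable circle_measure f"
    using AE_circle_norm by (intro circle.integrable_const_bound[where B=B]) auto
  have u: "uniform_measure lborel {0..2*pi} = density lborel (\<lambda>t. ennreal (indicator {0..2*pi} t / (2*pi)))"
    unfolding uniform_measure_def
    using divide_ennreal[of 1 "2 * pi"]
    by (intro density_cong) (auto simp: indicator_def split: if_splits)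
  have "2 * pi * (\<integral>\<zeta>. f \<zeta> \<partial>circle_measure) = 2 * pi * (\<integral>t. (indicator {0..2*pi} t / (2*pi)) *\<^sub>R f (cis t) \<partial>lborel)"
    unfolding circle_measure_def u by (subst integral_distr) (auto simp: integral_density)
  also have "\<dots> = (LINT t:{0..2*pi}|lborel. f (cis t))"
    unfolding set_lebesgue_integral_def
    by (subst integral_mult_right_zero[symmetric]) (intro Bochner_Integration.integral_cong; simp add: scaleR_conv_of_real)
  also have cc: "continuous_on {0..2*pi} (\<lambda>t. f (cis t))"
    by (intro continuous_on_compose2[OF c] continuous_intros) auto
  have "(LINT t:{0..2*pi}|lborel. f (cis t)) = integral {0..2*pi} (\<lambda>t. f (cis t))"
    by (intro set_borel_integral_eq_integral borel_integrable_atLeastAtMost' cc)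
  finally show "((\<lambda>t. f (cis t)) has_integral (2 * pi * (\<integral>\<zeta>. f \<zeta> \<partial>circle_measure))) {0..2*pi}"
    using integrable_integral[OF integrable_continuous_interval[OF cc]] by simp
qed

text \<open>On the unit circle the differential of \<open>cis t\<close> is
  \<open>\<i> * cis t\<close> times that of \<open>t\<close>; this is the origin of the extra factor
  \<open>\<zeta>\<close> in the numerator.\<close>

lemma circle_Cauchy:
  assumes [measurable]: "f \<in> borel_measurable borel" and c: "continuous_on (cball 0 1) f"
    and h: "f holomorphic_on ball 0 1" and w: "w \<in> ball 0 1"
  shows "(\<integral>\<zeta>. f \<zeta> * \<zeta> / (\<zeta> - w) ^ Suc k \<partial>circle_measure) = (deriv ^^ k) f w / fact k"
proof -
  have "((\<lambda>u. f u / (u - w) ^ Suc k) has_contour_integral (2 * pi * \<i> / fact k * (deriv ^^ k) f w)) (circlepath 0 1)"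
    using c h w by (rule Cauchy_has_contour_integral_higher_derivative_circlepath)
  then have 1: "((\<lambda>t. f (cis t) / (cis t - w) ^ Suc k * \<i> * cis t) has_integral
      (2 * pi * \<i> / fact k * (deriv ^^ k) f w)) {0..2*pi}"
    unfolding circlepath_def by (subst (asm) has_contour_integral_part_circlepath_iff) auto
  have "continuous_on (sphere 0 1) (\<lambda>\<zeta>. f \<zeta> * \<zeta> / (\<zeta> - w) ^ Suc k)"
    using w by (intro continuous_intros continuous_on_subset[OF c]) auto
  from circle_continuous(2)[OF _ this]
  have "((\<lambda>t. f (cis t) * cis t / (cis t - w) ^ Suc k) has_integral
     (2 * pi * (\<integral>\<zeta>. f \<zeta> * \<zeta> / (\<zeta> - w) ^ Suc k \<partial>circle_measure))) {0..2*pi}"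
    by simp
  from has_integral_mult_right[OF this, of \<i>]
  have "((\<lambda>t. f (cis t) / (cis t - w) ^ Suc k * \<i> * cis t) has_integral
     (\<i> * (2 * pi * (\<integral>\<zeta>. f \<zeta> * \<zeta> / (\<zeta> - w) ^ Suc k \<partial>circle_measure)))) {0..2*pi}"
    by (simp add: mult_ac)
  from has_integral_unique[OF this 1] show ?thesis by (simp add: field_simps)
qed

lemma circle_mean:
  assumes [measurable]: "f \<in> borel_measurable borel" and c: "continuous_on (cball 0 1) f"
    and h: "f holomorphic_on ball 0 1"
  shows "(\<integral>\<zeta>. f \<zeta> \<partial>circle_measure) = f 0"
proof -
  have "(\<integral>\<zeta>. f \<zeta> \<partial>circle_measure) = (\<integral>\<zeta>. f \<zeta> * \<zeta> / (\<zeta> - 0) ^ Suc 0 \<partial>circle_measure)"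
  proof (rule integral_cong_AE)
    show "AE \<zeta> in circle_measure. f \<zeta> = f \<zeta> * \<zeta> / (\<zeta> - 0) ^ Suc 0"
      using AE_circle_norm by eventually_elim auto
  qed measurable
  also have "\<dots> = f 0" by (subst circle_Cauchy[OF assms]) auto
  finally show ?thesis .
qed

lemma circle_orthonormal:
  "(\<integral>\<zeta>. \<zeta> ^ n * cnj (\<zeta> ^ m) \<partial>circle_measure) = (if n = m then 1 else 0)"
proof -
  have ge: "(\<integral>\<zeta>. \<zeta> ^ n * cnj (\<zeta> ^ m) \<partial>circle_measure) = (if n = m then 1 else 0)" if "m \<le> n" for m n :: nat
  proof -
    have "\<zeta> ^ n * cnj (\<zeta> ^ m) = \<zeta> ^ (n - m)" if "norm \<zeta> = 1" for \<zeta> :: complex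
    proof -
      have "\<zeta> ^ n = \<zeta> ^ (n - m) * \<zeta> ^ m" using \<open>m \<le> n\<close> by (simp flip: power_add)
      then show ?thesis using that
        by (simp add: mult.assoc complex_norm_square[symmetric] norm_power flip: complex_cnj_power)
    qed
    then have "(\<integral>\<zeta>. \<zeta> ^ n * cnj (\<zeta> ^ m) \<partial>circle_measure) = (\<integral>\<zeta>. \<zeta> ^ (n - m) \<partial>circle_measure)"
      using AE_circle_norm by (intro integral_cong_AE) (auto elim!: eventually_mono simp del: complex_cnj_power)
    also have "\<dots> = 0 ^ (n - m)" by (rule circle_mean) (auto intro!: continuous_intros holomorphic_intros)
    finally show ?thesis using that by (auto simp: power_0_left)
  qed
  show ?thesis
  proof (cases "m \<le> n")
    case False
    have "(\<integral>\<zeta>. \<zeta> ^ n * cnj (\<zeta> ^ m) \<partial>circle_measure) = cnj (\<integral>\<zeta>. \<zeta> ^ m * cnj (\<zeta> ^ n) \<partial>circle_measure)"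
      by (simp only: Bochner_Integration.integral_cnj[symmetric] complex_cnj_mult complex_cnj_cnj mult.commute)
    then show ?thesis using ge[of n m] False by auto
  qed (rule ge)
qed

lemma circle_sum_square:
  "(\<integral>\<zeta>. (cmod (\<Sum>n<m. b n * \<zeta> ^ n))\<^sup>2 \<partial>circle_measure) = (\<Sum>n<m. (cmod (b n))\<^sup>2)"
proof -
  have int: "integrable circle_measure (\<lambda>\<zeta>. b i * cnj (b j) * (\<zeta> ^ i * cnj (\<zeta> ^ j)))" for i j
    by (intro circle_continuous(1) continuous_intros) simp
  have "complex_of_real (\<integral>\<zeta>. (cmod (\<Sum>n<m. b n * \<zeta> ^ n))\<^sup>2 \<partial>circle_measure)
      = (\<integral>\<zeta>. (\<Sum>i<m. \<Sum>j<m. b i * cnj (b j) * (\<zeta> ^ i * cnj (\<zeta> ^ j))) \<partial>circle_measure)"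
    unfolding integral_complex_of_real[symmetric]
  proof (rule Bochner_Integration.integral_cong[OF refl])
    fix \<zeta>
    have "complex_of_real ((cmod (\<Sum>n<m. b n * \<zeta> ^ n))\<^sup>2)
        = (\<Sum>i<m. \<Sum>j<m. (b i * \<zeta> ^ i) * cnj (b j * \<zeta> ^ j))"
      unfolding complex_norm_square cnj_sum sum_product ..
    then show "complex_of_real ((cmod (\<Sum>n<m. b n * \<zeta> ^ n))\<^sup>2)
        = (\<Sum>i<m. \<Sum>j<m. b i * cnj (b j) * (\<zeta> ^ i * cnj (\<zeta> ^ j)))"
      by (simp add: mult_ac)
  qed
  also have "\<dots> = (\<Sum>i<m. \<Sum>j<m. b i * cnj (b j) * (if i = j then 1 else 0))"
  proof -
    have "(\<integral>\<zeta>. (\<Sum>i<m. \<Sum>j<m. b i * cnj (b j) * (\<zeta> ^ i * cnj (\<zeta> ^ j))) \<partial>circle_measure)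
        = (\<Sum>i<m. \<integral>\<zeta>. (\<Sum>j<m. b i * cnj (b j) * (\<zeta> ^ i * cnj (\<zeta> ^ j))) \<partial>circle_measure)"
      by (intro Bochner_Integration.integral_sum Bochner_Integration.integrable_sum int)
    also have "\<dots> = (\<Sum>i<m. \<Sum>j<m. \<integral>\<zeta>. b i * cnj (b j) * (\<zeta> ^ i * cnj (\<zeta> ^ j)) \<partial>circle_measure)"
      by (intro sum.cong refl Bochner_Integration.integral_sum int)
    finally show ?thesis by (simp only: integral_mult_right_zero circle_orthonormal)
  qed
  also have "\<dots> = (\<Sum>i<m. of_real ((cmod (b i))\<^sup>2))"
  proof (rule sum.cong[OF refl])
    fix i assume "i \<in> {..<m}"
    have "(\<Sum>j<m. b i * cnj (b j) * (if i = j then 1 else 0)) = (\<Sum>j<m. if i = j then b i * cnj (b i) else 0)"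
      by (rule sum.cong) auto
    also have "\<dots> = of_real ((cmod (b i))\<^sup>2)"
      unfolding complex_norm_square using \<open>i \<in> {..<m}\<close> by (subst sum.delta') auto
    finally show "(\<Sum>j<m. b i * cnj (b j) * (if i = j then 1 else 0)) = of_real ((cmod (b i))\<^sup>2)" .
  qed
  also have "\<dots> = of_real (\<Sum>i<m. (cmod (b i))\<^sup>2)" by (simp only: of_real_sum)
  finally show ?thesis by (simp only: of_real_eq_iff)
qed

text \<open>Absolute summability bounds the partial sums uniformly on the circle, so the identity
  for polynomials passes to the limit by dominated convergence.\<close>

lemma circle_Parseval_abs:
  assumes s: "summable (\<lambda>n. cmod (b n))"
  shows "(\<lambda>n. (cmod (b n))\<^sup>2) sums (\<integral>\<zeta>. (cmod (\<Sum>n. b n * \<zeta> ^ n))\<^sup>2 \<partial>circle_measure)"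
proof -
  have sm: "summable (\<lambda>n. b n * \<zeta> ^ n)" if "norm \<zeta> = 1" for \<zeta>
    by (rule summable_norm_cancel) (simp add: norm_mult norm_power that s)
  have b: "cmod (\<Sum>n<m. b n * \<zeta> ^ n) \<le> (\<Sum>n. cmod (b n))" if "norm \<zeta> = 1" for \<zeta> m
  proof -
    have "cmod (\<Sum>n<m. b n * \<zeta> ^ n) \<le> (\<Sum>n<m. cmod (b n))"
      by (rule sum_norm_le) (simp add: norm_mult norm_power that)
    also have "\<dots> \<le> (\<Sum>n. cmod (b n))" by (rule sum_le_suminf[OF s]) auto
    finally show ?thesis .
  qed
  have "(\<lambda>m. \<integral>\<zeta>. (cmod (\<Sum>n<m. b n * \<zeta> ^ n))\<^sup>2 \<partial>circle_measure) \<longlonglongrightarrow>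
      (\<integral>\<zeta>. (cmod (\<Sum>n. b n * \<zeta> ^ n))\<^sup>2 \<partial>circle_measure)"
  proof (rule integral_dominated_convergence[where w="\<lambda>_. (\<Sum>n. cmod (b n))\<^sup>2"])
    show "AE \<zeta> in circle_measure. (\<lambda>m. (cmod (\<Sum>n<m. b n * \<zeta> ^ n))\<^sup>2) \<longlonglongrightarrow> (cmod (\<Sum>n. b n * \<zeta> ^ n))\<^sup>2"
      using AE_circle_norm by eventually_elim (intro tendsto_intros summable_LIMSEQ sm)
    show "AE \<zeta> in circle_measure. norm ((cmod (\<Sum>n<m. b n * \<zeta> ^ n))\<^sup>2) \<le> (\<Sum>n. cmod (b n))\<^sup>2" for m
      using AE_circle_norm by eventually_elim (auto intro!: power_mono b)
  qed auto
  then show ?thesis unfolding sums_def circle_sum_square .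
qed

lemma circle_Parseval:
  assumes [measurable]: "f \<in> borel_measurable borel"
    and f: "\<And>z. norm z < 1 \<Longrightarrow> (\<lambda>n. c n * z ^ n) sums f z" and r: "0 \<le> r" "r < 1"
  shows "(\<lambda>n. (cmod (c n))\<^sup>2 * r ^ (2 * n)) sums (\<integral>\<zeta>. (cmod (f (of_real r * \<zeta>)))\<^sup>2 \<partial>circle_measure)"
proof -
  \<comment> \<open>The series converges at the larger radius \<open>s\<close>, which makes it
    absolutely summable at radius \<open>r\<close>.\<close>
  obtain s where s: "r < s" "s < 1" using dense r by blast
  have "summable (\<lambda>n. cmod (c n * of_real r ^ n))"
    by (rule powser_insidea[where x="of_real s"]) (use f[of "of_real s"] s r in \<open>auto simp: sums_iff\<close>)
  from circle_Parseval_abs[OF this]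
  have "(\<lambda>n. (cmod (c n * of_real r ^ n))\<^sup>2) sums (\<integral>\<zeta>. (cmod (\<Sum>n. c n * of_real r ^ n * \<zeta> ^ n))\<^sup>2 \<partial>circle_measure)" .
  moreover have "(\<integral>\<zeta>. (cmod (\<Sum>n. c n * of_real r ^ n * \<zeta> ^ n))\<^sup>2 \<partial>circle_measure)
      = (\<integral>\<zeta>. (cmod (f (of_real r * \<zeta>)))\<^sup>2 \<partial>circle_measure)"
  proof (rule integral_cong_AE)
    show "AE \<zeta> in circle_measure. (cmod (\<Sum>n. c n * of_real r ^ n * \<zeta> ^ n))\<^sup>2 = (cmod (f (of_real r * \<zeta>)))\<^sup>2"
      using AE_circle_norm
    proof eventually_elim
      case (elim \<zeta>)
      then show ?case
        using f[of "of_real r * \<zeta>"] r by (simp add: norm_mult sums_iff power_mult_distrib mult.assoc)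
    qed
  qed measurable
  ultimately show ?thesis
    using r by (simp add: norm_mult norm_power power_mult_distrib power_mult mult.commute flip: power_mult)
qed

text \<open>The isomorphism from coefficient sequences onto H^2; see \<open>H2_eq\<close> and
  \<open>inj_hfun\<close>. Statements about \<open>H2\<close> are proved as statements about
  \<open>l2\<close> through it.\<close>

definition hfun :: "l2 \<Rightarrow> complex \<Rightarrow> complex" where
  "hfun x z = (if z \<in> ball 0 1 then \<Sum>n. coord x n * z ^ n else 0)"

lemma hfun_sums: "norm z < 1 \<Longrightarrow> (\<lambda>n. coord x n * z ^ n) sums hfun x z"
  unfolding hfun_def 
  by (simp, intro summable_sums summable_norm_cancel[OF summable_comparison_test'[OF summable_mult[OF summable_geometric], of "cmod z" 0 _ "norm x"]])
     (auto simp: norm_mult norm_power intro!: mult_right_mono coord_le_norm)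

lemma hfun_outside [simp]: "norm z \<ge> 1 \<Longrightarrow> hfun x z = 0"
  by (simp add: hfun_def)

lemma hfun_add: "hfun (x + y) z = hfun x z + hfun y z"
proof (cases "norm z < 1")
  case True
  show ?thesis
    by (rule sums_unique2[OF hfun_sums[OF True]]) 
       (use sums_add[OF hfun_sums[OF True, of x] hfun_sums[OF True, of y]] in \<open>simp add: algebra_simps\<close>)
qed simp

lemma hfun_cscale: "hfun (cscale c x) z = c * hfun x z"
proof (cases "norm z < 1")
  case True
  show ?thesis
    by (rule sums_unique2[OF hfun_sums[OF True]]) 
       (use sums_mult[OF hfun_sums[OF True, of x], of c] in \<open>simp add: algebra_simps\<close>)
qed simp

lemma hfun_diff: "hfun (x - y) z = hfun x z - hfun y z"
  using hfun_add[of "x - y" y z] by simp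

lemma hfun_zero [simp]: "hfun 0 z = 0"
  using hfun_cscale[of 0 0 z] hfun_diff[of 0 0 z] by simp

lemma hfun_trunc: "norm z < 1 \<Longrightarrow> hfun (trunc m x) z = (\<Sum>n<m. coord x n * z ^ n)"
proof (rule sums_unique2[OF hfun_sums])
  have "(\<lambda>n. if n \<in> {..<m} then coord x n * z ^ n else 0) sums (\<Sum>n<m. coord x n * z ^ n)"
    by (rule sums_If_finite_set) simp
  then show "(\<lambda>n. coord (trunc m x) n * z ^ n) sums (\<Sum>n<m. coord x n * z ^ n)"
    by (rule back_subst[of "\<lambda>f. f sums _"]) (auto simp: fun_eq_iff)
qed

text \<open>Each coefficient is bounded by the norm and the geometric series is summed. The bound is
  cruder than Cauchy-Schwarz, but local uniform control inside the disk is its only purpose.\<close>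

lemma norm_hfun_le: assumes "norm z < 1" shows "cmod (hfun x z) \<le> norm x / (1 - norm z)"
proof -
  have g: "summable (\<lambda>n. norm x * norm z ^ n)" "(\<Sum>n. norm x * norm z ^ n) = norm x / (1 - norm z)"
    using assms by (auto simp: suminf_mult suminf_geometric intro!: summable_mult)
  show ?thesis unfolding g(2)[symmetric]
    unfolding sums_unique[OF hfun_sums[OF assms]]
    by (rule norm_suminf_le[OF _ g(1)]) (auto simp: norm_mult norm_power intro!: mult_right_mono coord_le_norm)
qed

lemma hfun_holomorphic: "hfun x holomorphic_on ball 0 1"
  by (rule power_series_holomorphic[where a="coord x"]) (use hfun_sums in auto)

lemma hfun_disk_analytic: "hfun x \<in> disk_analytic"
  by (auto simp: disk_analytic_def hfun_holomorphic)

lemma disk_analytic_measurable: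
  assumes "f \<in> disk_analytic" shows "f \<in> borel_measurable borel"
proof -
  have "f = (\<lambda>z. if z \<in> ball 0 1 then f z else 0)" using assms by (auto simp: disk_analytic_def)
  moreover have "\<dots> \<in> borel_measurable borel"
    using assms by (intro borel_measurable_continuous_on_if holomorphic_on_imp_continuous_on continuous_intros)
      (auto simp: disk_analytic_def)
  ultimately show ?thesis by simp
qed

lemma hfun_mean_square_sums:
  "0 \<le> r \<Longrightarrow> r < 1 \<Longrightarrow>
    (\<lambda>n. (cmod (coord x n))\<^sup>2 * r ^ (2 * n)) sums (\<integral>\<zeta>. (cmod (hfun x (of_real r * \<zeta>)))\<^sup>2 \<partial>circle_measure)"
  by (rule circle_Parseval[OF disk_analytic_measurable[OF hfun_disk_analytic] hfun_sums])

lemma hfun_mean_square_le: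
  assumes "0 \<le> r" "r < 1"
  shows "(\<integral>\<zeta>. (cmod (hfun x (of_real r * \<zeta>)))\<^sup>2 \<partial>circle_measure) \<le> (norm x)\<^sup>2"
  unfolding norm_l2_power2
  by (rule sums_le[OF _ hfun_mean_square_sums[OF assms] summable_sums[OF summable_coord]])
     (use assms in \<open>auto intro!: mult_left_le power_le_one\<close>)

lemma hfun_in_H2: "hfun x \<in> H2"
  unfolding H2_def
  by (intro CollectI conjI hfun_disk_analytic exI[of _ "(norm x)\<^sup>2"] ballI hfun_mean_square_le) auto

text \<open>Each finite partial sum in Parseval's identity is at most \<open>C\<close> at every
  radius below 1; letting the radius tend to 1 bounds the sum of the squared coefficients. Keeping
  the constant yields operator norms later.\<close>

lemma disk_analytic_eq_hfun:
  assumes f: "f \<in> disk_analytic"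
    and C: "\<And>r. 0 \<le> r \<Longrightarrow> r < 1 \<Longrightarrow> (\<integral>\<zeta>. (cmod (f (of_real r * \<zeta>)))\<^sup>2 \<partial>circle_measure) \<le> C"
  obtains x where "f = hfun x" "(norm x)\<^sup>2 \<le> C"
proof -
  define c where "c n = (deriv ^^ n) f 0 / fact n" for n
  have fs: "(\<lambda>n. c n * z ^ n) sums f z" if "norm z < 1" for z
    using holomorphic_power_series[of f 0 1 z] f that by (simp add: disk_analytic_def c_def)
  have part: "(\<Sum>n<m. (cmod (c n))\<^sup>2) \<le> C" for m
  proof (rule tendsto_upperbound)
    show "((\<lambda>r. \<Sum>n<m. (cmod (c n))\<^sup>2 * r ^ (2 * n)) \<longlongrightarrow> (\<Sum>n<m. (cmod (c n))\<^sup>2)) (at_left 1)"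
      by (rule tendsto_eq_intros refl | simp)+
    show "\<forall>\<^sub>F r in at_left 1. (\<Sum>n<m. (cmod (c n))\<^sup>2 * r ^ (2 * n)) \<le> C"
      using eventually_at_left_real[of 0 1]
    proof (rule eventually_mono)
      fix r :: real assume r: "r \<in> {0<..<1}"
      then have r': "0 \<le> r" "r < 1" by auto
      have "(\<Sum>n<m. (cmod (c n))\<^sup>2 * r ^ (2 * n)) \<le> (\<integral>\<zeta>. (cmod (f (of_real r * \<zeta>)))\<^sup>2 \<partial>circle_measure)"
        using circle_Parseval[OF disk_analytic_measurable[OF f] fs r'] sum_le_suminf[of "\<lambda>n. (cmod (c n))\<^sup>2 * r ^ (2 * n)" "{..<m}"] r'
        by (auto simp: sums_iff)
      then show "(\<Sum>n<m. (cmod (c n))\<^sup>2 * r ^ (2 * n)) \<le> C" using C[OF r'] by linarith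
    qed simp
  qed simp
  have sm: "summable (\<lambda>n. (cmod (c n))\<^sup>2)"
    by (intro bounded_imp_summable[where B=C]) (use part in \<open>auto simp del: sum.lessThan_Suc simp: lessThan_Suc_atMost[symmetric]\<close>)
  define x where "x = Abs_l2 c"
  have x: "coord x = c" unfolding x_def using sm by (simp add: Abs_l2_inverse)
  have "f z = hfun x z" for z
  proof (cases "norm z < 1")
    case True
    show ?thesis using sums_unique2[OF fs[OF True], of "hfun x z"] hfun_sums[OF True, of x] x by simp
  next
    case False
    then show ?thesis using f by (simp add: disk_analytic_def)
  qed
  moreover have "(norm x)\<^sup>2 \<le> C" unfolding norm_l2_power2 x by (rule suminf_le_const[OF sm part])
  ultimately show thesis using that by blast
qed

lemma H2_eq: "H2 = range hfun"
proof
  show "H2 \<subseteq> range hfun"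
  proof
    fix f assume f: "f \<in> H2"
    then obtain C where da: "f \<in> disk_analytic"
      and "\<forall>r\<in>{0..<1}. (\<integral>\<zeta>. (cmod (f (of_real r * \<zeta>)))\<^sup>2 \<partial>circle_measure) \<le> C"
      unfolding H2_def by blast
    then have "\<And>r. 0 \<le> r \<Longrightarrow> r < 1 \<Longrightarrow> (\<integral>\<zeta>. (cmod (f (of_real r * \<zeta>)))\<^sup>2 \<partial>circle_measure) \<le> C" by simp
    from disk_analytic_eq_hfun[OF da this] show "f \<in> range hfun" by blast
  qed
qed (use hfun_in_H2 in auto)

text \<open>Parseval's identity at a single positive radius already forces all coefficients of the
  difference to vanish.\<close>

lemma inj_hfun: "inj hfun"
proof (rule injI)
  fix x y assume "hfun x = hfun y"
  then have z: "hfun (x - y) z = 0" for z by (simp add: hfun_diff)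
  have "(\<lambda>n. (cmod (coord (x - y) n))\<^sup>2 * (1/2) ^ (2 * n)) sums 0"
    using hfun_mean_square_sums[of "1/2" "x - y"] by (simp add: z)
  then have "\<forall>n. (cmod (coord (x - y) n))\<^sup>2 * (1/2) ^ (2 * n) = 0"
    by (subst suminf_eq_zero_iff[symmetric]) (auto simp: sums_iff)
  then show "x = y" by (intro l2_eqI) simp
qed

lemma bounded_imp_mean_square_le:
  assumes f: "f \<in> disk_analytic" and B: "\<And>z. norm z < 1 \<Longrightarrow> cmod (f z) \<le> B" and r: "0 \<le> r" "r < 1"
  shows "(\<integral>\<zeta>. (cmod (f (of_real r * \<zeta>)))\<^sup>2 \<partial>circle_measure) \<le> B\<^sup>2"
proof -
  note [measurable] = disk_analytic_measurable[OF f]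
  have "AE \<zeta> in circle_measure. (cmod (f (of_real r * \<zeta>)))\<^sup>2 \<le> B\<^sup>2"
    using AE_circle_norm by eventually_elim (use r in \<open>auto intro!: power_mono B simp: norm_mult\<close>)
  moreover from this have "integrable circle_measure (\<lambda>\<zeta>. (cmod (f (of_real r * \<zeta>)))\<^sup>2)"
    by (intro circle.integrable_const_bound[where B="B\<^sup>2"]) (simp, measurable)
  ultimately show ?thesis by (intro circle.integral_le_const)
qed

lemma Hinf_imp_H2: "f \<in> Hinf \<Longrightarrow> f \<in> H2"
proof -
  assume f: "f \<in> Hinf"
  then obtain B where "\<forall>y\<in>f ` ball 0 1. norm y \<le> B" unfolding Hinf_def bounded_iff by blast
  then have "\<And>z. norm z < 1 \<Longrightarrow> cmod (f z) \<le> B" by simp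
  then show "f \<in> H2" using f unfolding Hinf_def H2_def
    by (intro CollectI conjI exI[of _ "B\<^sup>2"] ballI bounded_imp_mean_square_le) auto
qed

section \<open>Poisson averages and the maximal inequality\<close>

text \<open>Not normalised: the integral over a full period is \<open>2 * pi\<close>.\<close>

definition poisson_kernel :: "real \<Rightarrow> real \<Rightarrow> real" where
  "poisson_kernel r \<theta> = (1 - r\<^sup>2) / (1 - 2 * r * cos \<theta> + r\<^sup>2)"

lemma poisson_denom_pos:
  assumes "0 \<le> r" "r < 1"
  shows "0 < 1 - 2 * r * cos \<theta> + (r::real)\<^sup>2"
proof -
  have "0 < (1 - r)\<^sup>2" using assms by simp
  moreover have "0 \<le> 2 * r * (1 - cos \<theta>)" using assms by simp
  ultimately show ?thesis by (simp add: power2_diff algebra_simps)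
qed

lemma poisson_kernel_nonneg: "0 \<le> r \<Longrightarrow> r < 1 \<Longrightarrow> 0 \<le> poisson_kernel r \<theta>"
  using poisson_denom_pos[of r \<theta>] by (auto simp: poisson_kernel_def power_le_one intro!: divide_nonneg_pos)

lemma continuous_on_poisson_kernel: "0 \<le> r \<Longrightarrow> r < 1 \<Longrightarrow> continuous_on A (poisson_kernel r)"
  unfolding poisson_kernel_def using poisson_denom_pos[of r]
  by (intro continuous_intros) (auto simp: less_imp_neq[symmetric] dest: less_imp_neq)

text \<open>Cauchy's formula at the point \<open>r\<close> for the rotated function divided by
  \<open>1 - r * u\<close>. On the circle the product
  \<open>(1 - r * \<zeta>) * (\<zeta> - r)\<close> equals \<open>\<zeta>\<close> times the Poisson
  denominator, and the factor \<open>1 - r\<^sup>2\<close> cancels at \<open>u = r\<close>. Applying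
  it to the analytic function itself avoids any harmonic function theory.\<close>

lemma poisson_integral:
  fixes f :: "complex \<Rightarrow> complex"
  assumes [measurable]: "f \<in> borel_measurable borel" and c: "continuous_on (cball 0 1) f"
    and h: "f holomorphic_on ball 0 1" and r: "0 \<le> r" "r < 1"
  shows "((\<lambda>\<theta>. f (cis (t + \<theta>)) * of_real (poisson_kernel r \<theta>)) has_integral
            (2 * pi * f (of_real r * cis t))) {0..2*pi}"
proof -
  define g where "g u = f (u * cis t) * (1 - of_real (r\<^sup>2)) / (1 - of_real r * u)" for u
  have nz: "1 - complex_of_real r * u \<noteq> 0" if "norm u \<le> 1" for u
  proof
    assume "1 - complex_of_real r * u = 0"
    then have "cmod (complex_of_real r * u) = 1" by simp
    then have "r * cmod u = 1" using r by (simp add: norm_mult)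
    moreover have "r * cmod u \<le> r" using r that by (simp add: mult_left_le)
    ultimately show False using r by linarith
  qed
  have nz1: "complex_of_real r * u \<noteq> 1" if "norm u \<le> 1" for u using nz[OF that] by auto
  have gm [measurable]: "g \<in> borel_measurable borel" unfolding g_def by measurable
  have gc: "continuous_on (cball 0 1) g" unfolding g_def
    by (intro continuous_intros continuous_on_compose2[OF c]) (auto simp: norm_mult nz1)
  have gh: "g holomorphic_on ball 0 1" unfolding g_def
    by (intro holomorphic_intros holomorphic_on_compose_gen[OF _ h, unfolded o_def]) (auto simp: norm_mult nz1)
  have rb: "of_real r \<in> ball (0::complex) 1" using r by simp
  have eq: "g (cis \<theta>) * cis \<theta> / (cis \<theta> - of_real r) ^ Suc 0 = f (cis (t + \<theta>)) * of_real (poisson_kernel r \<theta>)" for \<theta>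
  proof -
    have 1: "1 - of_real r * cis \<theta> \<noteq> 0" by (rule nz) simp
    have 2: "cis \<theta> - of_real r \<noteq> 0" using r by (metis eq_iff_diff_eq_0 norm_cis norm_of_real abs_of_nonneg less_irrefl)
    have "(1 - of_real r * cis \<theta>) * (cis \<theta> - of_real r) = of_real (1 - 2 * r * cos \<theta> + r\<^sup>2) * cis \<theta>"
    proof -
      have cc: "cis \<theta> * cis (- \<theta>) = 1" by (simp add: cis_mult)
      have c2: "complex_of_real (2 * cos \<theta>) = cis \<theta> + cis (- \<theta>)" by (simp add: complex_eq_iff)
      have "complex_of_real (1 - 2 * r * cos \<theta> + r\<^sup>2)
          = 1 - of_real r * complex_of_real (2 * cos \<theta>) + (of_real r)\<^sup>2 * (cis \<theta> * cis (- \<theta>))"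
        unfolding cc by simp
      also have "\<dots> = (1 - of_real r * cis \<theta>) * (1 - of_real r * cis (- \<theta>))"
        unfolding c2 by (simp add: algebra_simps power2_eq_square)
      finally have "complex_of_real (1 - 2 * r * cos \<theta> + r\<^sup>2) * cis \<theta>
          = (1 - of_real r * cis \<theta>) * (cis \<theta> - of_real r * (cis \<theta> * cis (- \<theta>)))"
        by (simp only: mult.assoc left_diff_distrib mult_1 mult.commute[of "cis (- \<theta>)" "cis \<theta>"])
      then show ?thesis unfolding cc by simp
    qed
    then have "cis \<theta> / ((1 - of_real r * cis \<theta>) * (cis \<theta> - of_real r)) = 1 / of_real (1 - 2 * r * cos \<theta> + r\<^sup>2)"
      by (simp only:) (simp add: field_simps del: of_real_add of_real_diff of_real_mult of_real_power)
    moreover have "g (cis \<theta>) * cis \<theta> / (cis \<theta> - of_real r) ^ Suc 0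
        = f (cis (t + \<theta>)) * (1 - of_real (r\<^sup>2)) * (cis \<theta> / ((1 - of_real r * cis \<theta>) * (cis \<theta> - of_real r)))"
      by (simp add: g_def cis_mult add.commute)
    ultimately show ?thesis by (simp add: poisson_kernel_def)
  qed
  have "continuous_on (sphere 0 1) (\<lambda>\<zeta>. g \<zeta> * \<zeta> / (\<zeta> - of_real r) ^ Suc 0)"
    using r by (intro continuous_intros continuous_on_subset[OF gc]) auto
  from circle_continuous(2)[OF _ this]
  have "((\<lambda>\<theta>. g (cis \<theta>) * cis \<theta> / (cis \<theta> - of_real r) ^ Suc 0) has_integral
     (2 * pi * (\<integral>\<zeta>. g \<zeta> * \<zeta> / (\<zeta> - of_real r) ^ Suc 0 \<partial>circle_measure))) {0..2*pi}"
    by simp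
  moreover have "(\<integral>\<zeta>. g \<zeta> * \<zeta> / (\<zeta> - of_real r) ^ Suc 0 \<partial>circle_measure) = g (of_real r)"
    using circle_Cauchy[OF gm gc gh rb, of 0] by simp
  moreover have "g (of_real r) = f (of_real r * cis t)"
    using nz[of "of_real r"] r by (simp add: g_def power2_eq_square)
  ultimately show ?thesis unfolding eq by simp
qed

text \<open>Folds a period onto \<open>{0..pi}\<close>, where the Poisson kernel is monotone and
  where \<open>F (t + \<theta>) + F (t - \<theta>)\<close> is the derivative of an integral over a
  centred interval.\<close>

lemma integral_fold_period:
  fixes g :: "real \<Rightarrow> 'a::banach"
  assumes g: "continuous_on UNIV g" and per: "\<And>x. g (x + 2 * pi) = g x"
  shows "integral {0..2*pi} g = integral {0..pi} (\<lambda>\<theta>. g \<theta> + g (- \<theta>))"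
proof -
  have int: "g integrable_on {a..b}" for a b by (intro integrable_continuous_interval continuous_on_subset[OF g]) auto
  have "integral {0..2*pi} g = integral {0..pi} g + integral {pi..2*pi} g"
    using Henstock_Kurzweil_Integration.integral_combine[where a=0 and c=pi and b="2*pi" and f=g] int by simp
  also have "integral {pi..2*pi} g = integral {-pi..0} g"
    using integral_shift_real_ivl[where a=pi and b="2*pi" and c="2*pi" and f=g] by (simp add: per)
  also have "\<dots> = integral {0..pi} (\<lambda>\<theta>. g (- \<theta>))"
    using Henstock_Kurzweil_Integration.integral_reflect_real[where a=0 and b=pi and f="\<lambda>\<theta>. g (-\<theta>)"] by simp
  also have "integral {0..pi} g + \<dots> = integral {0..pi} (\<lambda>\<theta>. g \<theta> + g (- \<theta>))"
    by (intro integral_add[symmetric] int integrable_continuous_interval continuous_on_compose2[OF g] continuous_intros) auto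
  finally show ?thesis .
qed

lemma poisson_kernel_mass:
  assumes r: "0 \<le> r" "r < 1"
  shows "integral {0..pi} (poisson_kernel r) = pi"
proof -
  have "((\<lambda>\<theta>. of_real (poisson_kernel r \<theta>)) has_integral (2 * pi * (1::complex))) {0..2*pi}"
    using poisson_integral[of "\<lambda>_. 1" r 0] r by simp
  from has_integral_Re[OF this]
  have "integral {0..2*pi} (poisson_kernel r) = 2 * pi" by (simp add: integral_unique)
  moreover have "integral {0..2*pi} (poisson_kernel r) = integral {0..pi} (\<lambda>\<theta>. 2 * poisson_kernel r \<theta>)"
    by (subst integral_fold_period[OF continuous_on_poisson_kernel[OF r]]) (simp_all add: poisson_kernel_def)
  ultimately show ?thesis by simp
qed

text \<open>
  The kernel decreases on \<open>[0, \<pi>]\<close>, so an integration by parts against the primitive of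
  the symmetrised function bounds the Poisson integral by its centred averages.
\<close>

lemma poisson_le_averages:
  fixes F :: "real \<Rightarrow> real"
  assumes F: "continuous_on UNIV F" and per: "\<And>x. F (x + 2 * pi) = F x"
    and r: "0 \<le> r" "r < 1"
    and M: "\<And>h. 0 < h \<Longrightarrow> h \<le> pi \<Longrightarrow> integral {t-h..t+h} F \<le> 2 * h * M"
  shows "integral {0..2*pi} (\<lambda>\<theta>. F (t + \<theta>) * poisson_kernel r \<theta>) \<le> 2 * pi * M"
proof -
  let ?k = "poisson_kernel r"
  have Fi: "F integrable_on {a..b}" for a b by (intro integrable_continuous_interval continuous_on_subset[OF F]) auto
  have kc: "continuous_on A ?k" for A by (rule continuous_on_poisson_kernel[OF r])
  define k' where "k' \<theta> = - ((1 - r\<^sup>2) * (2 * r * sin \<theta>)) / (1 - 2 * r * cos \<theta> + r\<^sup>2)\<^sup>2" for \<theta>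
  have k': "(?k has_real_derivative k' \<theta>) (at \<theta>)" for \<theta>
    unfolding poisson_kernel_def[abs_def] k'_def
    using poisson_denom_pos[OF r, of \<theta>]
    by (auto intro!: derivative_eq_intros simp: power2_eq_square)
  have k'0: "k' \<theta> \<le> 0" if "0 \<le> \<theta>" "\<theta> \<le> pi" for \<theta>
  proof -
    have "0 \<le> (1 - r\<^sup>2) * (2 * r * sin \<theta>)"
      using r that by (intro mult_nonneg_nonneg sin_ge_zero) (auto simp: power_le_one)
    then show ?thesis unfolding k'_def by (intro divide_nonpos_nonneg) auto
  qed
  \<comment> \<open>Any offset above \<open>pi\<close> would do in place of 4: the points
    \<open>t + h\<close> and \<open>t - h\<close> with \<open>h \<le> pi\<close> must be interior to
    the interval on which \<open>\<Phi>\<close> is differentiable.\<close>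
  define \<Phi> where "\<Phi> x = integral {t-4..x} F" for x
  have \<Phi>': "(\<Phi> has_real_derivative F x) (at x)" if "\<bar>x - t\<bar> < 4" for x
  proof -
    have "(\<Phi> has_real_derivative F x) (at x within {t-4..t+4})"
      unfolding \<Phi>_def using that by (intro integral_has_real_derivative continuous_on_subset[OF F]) auto
    then show ?thesis using that at_within_Icc_at[of "t-4" x "t+4"] by (simp add: abs_less_iff)
  qed
  define G where "G h = \<Phi> (t + h) - \<Phi> (t - h)" for h
  have GM: "G h \<le> 2 * h * M" if "0 \<le> h" "h \<le> pi" for h
  proof -
    have "integral {t-4..t-h} F + integral {t-h..t+h} F = integral {t-4..t+h} F"
      using that pi_less_4 by (intro Henstock_Kurzweil_Integration.integral_combine Fi) auto
    then have "G h = integral {t-h..t+h} F" by (simp add: G_def \<Phi>_def)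
    then show ?thesis using M[of h] that by (cases "h = 0") auto
  qed
  have G': "(G has_real_derivative F (t + h) + F (t - h)) (at h)" if "0 \<le> h" "h \<le> pi" for h
  proof -
    have "\<bar>t + h - t\<bar> < 4" "\<bar>t - h - t\<bar> < 4" using that pi_less_4 by auto
    then show ?thesis unfolding G_def
      by (auto intro!: derivative_eq_intros DERIV_chain2[OF \<Phi>'])
  qed
  \<comment> \<open>With \<open>2 * h * M\<close> subtracted, the averaged factor is nonpositive.
    Its product with \<open>k'\<close> is then nonnegative and may be dropped from the integral of
    \<open>?H'\<close>, and the boundary term at \<open>pi\<close> has the right sign.\<close>
  let ?H = "\<lambda>h. ?k h * (G h - 2 * h * M)"
  let ?H' = "\<lambda>h. k' h * (G h - 2 * h * M) + ?k h * (F (t + h) + F (t - h) - 2 * M)"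
  have "(?H' has_integral (?H pi - ?H 0)) {0..pi}"
  proof (rule fundamental_theorem_of_calculus)
    fix h assume h: "h \<in> {0..pi}"
    have "(?H has_real_derivative ?H' h) (at h)"
      using h by (auto intro!: derivative_eq_intros k' G')
    then show "(?H has_vector_derivative ?H' h) (at h within {0..pi})"
      by (simp add: has_real_derivative_iff_has_vector_derivative has_vector_derivative_at_within)
  qed simp
  moreover have "?H pi \<le> 0" using GM[of pi] poisson_kernel_nonneg[OF r, of pi] by (simp add: mult_nonneg_nonpos)
  moreover have "?H 0 = 0" by (simp add: G_def)
  ultimately have H: "?H' integrable_on {0..pi}" "integral {0..pi} ?H' \<le> 0" by (auto simp: integral_unique)
  have i2: "(\<lambda>h. ?k h * (F (t + h) + F (t - h) - 2 * M)) integrable_on {0..pi}"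
    by (intro integrable_continuous_interval continuous_intros kc continuous_on_compose2[OF F]) auto
  have i3: "(\<lambda>h. ?k h * (F (t + h) + F (t - h))) integrable_on {0..pi}"
    by (intro integrable_continuous_interval continuous_intros kc continuous_on_compose2[OF F]) auto
  have i4: "(\<lambda>h. ?k h * (2 * M)) integrable_on {0..pi}"
    by (intro integrable_continuous_interval continuous_intros kc)
  have "integral {0..pi} (\<lambda>h. ?k h * (F (t + h) + F (t - h) - 2 * M)) \<le> integral {0..pi} ?H'"
    using GM k'0 by (intro integral_le i2 H) (auto intro!: mult_nonpos_nonpos)
  with H have "integral {0..pi} (\<lambda>h. ?k h * (F (t + h) + F (t - h) - 2 * M)) \<le> 0" by linarith
  also have "integral {0..pi} (\<lambda>h. ?k h * (F (t + h) + F (t - h) - 2 * M))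
      = integral {0..pi} (\<lambda>h. ?k h * (F (t + h) + F (t - h))) - integral {0..pi} (\<lambda>h. ?k h * (2 * M))"
    by (subst integral_diff[OF i3 i4, symmetric]) (simp add: algebra_simps)
  also have "integral {0..pi} (\<lambda>h. ?k h * (2 * M)) = 2 * pi * M"
    by (simp add: poisson_kernel_mass[OF r])
  also have "integral {0..pi} (\<lambda>h. ?k h * (F (t + h) + F (t - h))) = integral {0..2*pi} (\<lambda>\<theta>. F (t + \<theta>) * ?k \<theta>)"
  proof (subst integral_fold_period)
    show "continuous_on UNIV (\<lambda>\<theta>. F (t + \<theta>) * ?k \<theta>)"
      by (intro continuous_intros kc continuous_on_compose2[OF F]) auto
    show "F (t + (x + 2 * pi)) * ?k (x + 2 * pi) = F (t + x) * ?k x" for x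
      using per[of "t + x"] by (simp add: poisson_kernel_def add.assoc)
    show "integral {0..pi} (\<lambda>h. ?k h * (F (t + h) + F (t - h))) =
        integral {0..pi} (\<lambda>\<theta>. F (t + \<theta>) * ?k \<theta> + F (t + - \<theta>) * ?k (- \<theta>))"
    proof -
      have "?k (- \<theta>) = ?k \<theta>" for \<theta> by (simp add: poisson_kernel_def)
      then show ?thesis by (simp add: algebra_simps)
    qed
  qed
  finally show ?thesis by simp
qed

lemma radial_le_averages:
  fixes f :: "complex \<Rightarrow> complex"
  assumes fm: "f \<in> borel_measurable borel" and c: "continuous_on (cball 0 1) f"
    and h: "f holomorphic_on ball 0 1" and r: "0 \<le> r" "r < 1"
    and M: "\<And>h. 0 < h \<Longrightarrow> h \<le> pi \<Longrightarrow> integral {t-h..t+h} (\<lambda>s. cmod (f (cis s))) \<le> 2 * h * M"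
  shows "cmod (f (of_real r * cis t)) \<le> M"
proof -
  have fc: "continuous_on UNIV (\<lambda>s. f (cis s))"
    by (intro continuous_on_compose2[OF c] continuous_intros) auto
  have Fc: "continuous_on UNIV (\<lambda>s. cmod (f (cis s)))" by (intro continuous_intros fc)
  have "2 * pi * cmod (f (of_real r * cis t)) = norm (integral {0..2*pi} (\<lambda>\<theta>. f (cis (t + \<theta>)) * of_real (poisson_kernel r \<theta>)))"
    using poisson_integral[OF fm c h r, of t] by (simp add: integral_unique norm_mult)
  also have "\<dots> \<le> integral {0..2*pi} (\<lambda>\<theta>. cmod (f (cis (t + \<theta>))) * poisson_kernel r \<theta>)"
  proof (rule Henstock_Kurzweil_Integration.integral_norm_bound_integral)
    show "(\<lambda>\<theta>. f (cis (t + \<theta>)) * of_real (poisson_kernel r \<theta>)) integrable_on {0..2*pi}"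
      using poisson_integral[OF fm c h r, of t] by blast
    show "(\<lambda>\<theta>. cmod (f (cis (t + \<theta>))) * poisson_kernel r \<theta>) integrable_on {0..2*pi}"
      by (intro integrable_continuous_interval continuous_intros continuous_on_poisson_kernel r continuous_on_compose2[OF Fc]) auto
    show "norm (f (cis (t + \<theta>)) * of_real (poisson_kernel r \<theta>)) \<le> cmod (f (cis (t + \<theta>))) * poisson_kernel r \<theta>" for \<theta>
      using poisson_kernel_nonneg[OF r, of \<theta>] by (simp add: norm_mult)
  qed
  also have "\<dots> \<le> 2 * pi * M"
    by (rule poisson_le_averages[OF Fc _ r M]) (auto simp flip: cis_mult)
  finally show ?thesis by simp
qed

section \<open>The weak-type estimate for centred averages\<close>

lemma nn_integral_interval:
  fixes F :: "real \<Rightarrow> real"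
  assumes F: "continuous_on UNIV F" and nn: "\<And>x. 0 \<le> F x"
  shows "(\<integral>\<^sup>+x\<in>{a..b}. ennreal (F x) \<partial>lborel) = ennreal (integral {a..b} F)"
proof -
  have s: "set_integrable lborel {a..b} F"
    by (intro borel_integrable_atLeastAtMost' continuous_on_subset[OF F]) auto
  have "(\<integral>\<^sup>+x\<in>{a..b}. ennreal (F x) \<partial>lborel) = (\<integral>\<^sup>+x. ennreal (indicator {a..b} x *\<^sub>R F x) \<partial>lborel)"
    by (intro nn_integral_cong) (auto simp: indicator_def)
  also have "\<dots> = ennreal (\<integral>x. indicator {a..b} x *\<^sub>R F x \<partial>lborel)"
    using s nn by (intro nn_integral_eq_integral) (auto simp: set_integrable_def)
  also have "(\<integral>x. indicator {a..b} x *\<^sub>R F x \<partial>lborel) = integral {a..b} F"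
    using set_borel_integral_eq_integral(2)[OF s] by (simp add: set_lebesgue_integral_def)
  finally show ?thesis .
qed

text \<open>Every point of \<open>E\<close> is the centre of an interval of length
  \<open>2 * h\<close> carrying mass above \<open>2 * h * l\<close>. Vitali's lemma selects disjoint
  ones whose fivefold enlargements cover \<open>E\<close>; this is the source of the factor 5. Since
  \<open>h \<le> d\<close>, the selected intervals stay in \<open>{a-d..b+d}\<close>.\<close>

lemma weak_type_maximal:
  fixes F :: "real \<Rightarrow> real"
  assumes F: "continuous_on UNIV F" and nn: "\<And>x. 0 \<le> F x" and E: "E \<subseteq> {a..b}" "E \<in> sets borel"
    and l: "0 < l" and d: "0 < d"
    and big: "\<And>t. t \<in> E \<Longrightarrow> \<exists>h. 0 < h \<and> h \<le> d \<and> 2 * h * l < integral {t-h..t+h} F"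
  shows "l * measure lborel E \<le> 5 * integral {a-d..b+d} F"
proof -
  have Fm [measurable]: "F \<in> borel_measurable borel" by (rule borel_measurable_continuous_onI[OF F])
  obtain h where h: "\<And>t. t \<in> E \<Longrightarrow> 0 < h t \<and> h t \<le> d \<and> 2 * h t * l < integral {t-h t..t+h t} F"
    using big by metis
  have "E \<subseteq> (\<Union>t\<in>E. cball t (h t))"
  proof
    fix t assume "t \<in> E"
    then have "t \<in> cball t (h t)" using h[of t] by simp
    with \<open>t \<in> E\<close> show "t \<in> (\<Union>t\<in>E. cball t (h t))" by blast
  qed
  then obtain C where C: "countable C" "C \<subseteq> E" 
      "pairwise (\<lambda>i j. disjnt (cball i (h i)) (cball j (h j))) C" "E \<subseteq> (\<Union>i\<in>C. cball i (5 * h i))"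
    by (rule Vitali_covering_lemma_cballs[where a="\<lambda>t. t" and r=h and B=d]) (use h in simp)
  \<comment> \<open>As a measure, the mass of \<open>F\<close> can be added over the countably many
    disjoint intervals.\<close>
  define \<nu> where "\<nu> = density lborel (\<lambda>x. ennreal (F x))"
  have s\<nu>[simp]: "sets \<nu> = sets borel" by (simp add: \<nu>_def)
  have \<nu>: "emeasure \<nu> {u..v} = ennreal (integral {u..v} F)" for u v
    unfolding \<nu>_def by (subst emeasure_density) (auto simp: nn_integral_interval[OF F nn])
  show ?thesis
  proof (cases "C = {}")
    case True
    then have "E = {}" using C(4) by auto
    moreover have "0 \<le> integral {a-d..b+d} F"
      by (intro integral_nonneg integrable_continuous_interval continuous_on_subset[OF F]) (auto simp: nn)
    ultimately show ?thesis by simp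
  next
    case False
    define e where "e = to_nat_on C"
    have inj: "inj_on e C" unfolding e_def using C(1) by (rule inj_on_to_nat_on)
    define P where "P n = (if n \<in> e ` C then cball (inv_into C e n) (h (inv_into C e n)) else {})" for n
    define Q where "Q n = (if n \<in> e ` C then cball (inv_into C e n) (5 * h (inv_into C e n)) else {})" for n
    have UQ: "E \<subseteq> (\<Union>n. Q n)"
    proof
      fix x assume "x \<in> E"
      then obtain i where "i \<in> C" "x \<in> cball i (5 * h i)" using C(4) by blast
      then have "x \<in> Q (e i)" by (simp add: Q_def inj)
      then show "x \<in> (\<Union>n. Q n)" by blast
    qed
    have disj: "disjoint_family P"
      unfolding disjoint_family_on_def
    proof (intro ballI impI)
      fix m n :: nat assume "m \<noteq> n"
      show "P m \<inter> P n = {}"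
      proof (cases "m \<in> e ` C \<and> n \<in> e ` C")
        case True
        then obtain i j where "i \<in> C" "j \<in> C" "m = e i" "n = e j" by blast
        moreover from this have "disjnt (cball i (h i)) (cball j (h j))" 
          using \<open>m \<noteq> n\<close> by (intro pairwiseD[OF C(3)]) auto
        ultimately show ?thesis by (simp add: P_def inj disjnt_def)
      qed (auto simp: P_def)
    qed
    have PQ: "ennreal l * emeasure lborel (Q n) \<le> 5 * emeasure \<nu> (P n)" for n
    proof (cases "n \<in> e ` C")
      case True
      then obtain i where i: "i \<in> C" "n = e i" by blast
      then have hi: "0 < h i" "2 * h i * l \<le> integral {i - h i..i + h i} F" using h C(2) by (auto intro: less_imp_le)
      have "ennreal l * emeasure lborel (Q n) = ennreal (5 * (2 * h i * l))"
        using i hi l by (simp add: Q_def inj cball_eq_atLeastAtMost ennreal_mult[symmetric] algebra_simps)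
      also have "\<dots> \<le> ennreal (5 * integral {i - h i..i + h i} F)" using hi(2) by (intro ennreal_leI) linarith
      also have "\<dots> = 5 * emeasure \<nu> (P n)"
        using i hi l by (simp add: P_def inj cball_eq_atLeastAtMost \<nu> ennreal_mult')
      finally show ?thesis .
    qed (simp add: Q_def P_def)
    have PU: "(\<Union>n. P n) \<subseteq> {a-d..b+d}"
    proof
      fix x assume "x \<in> (\<Union>n. P n)"
      then obtain i where "i \<in> C" "x \<in> cball i (h i)" by (auto simp: P_def inj split: if_splits)
      moreover have "i \<in> {a..b}" "h i \<le> d" using \<open>i \<in> C\<close> C(2) E h by auto
      ultimately show "x \<in> {a-d..b+d}" by (auto simp: dist_real_def)
    qed
    have "ennreal l * emeasure lborel E \<le> ennreal l * emeasure lborel (\<Union>n. Q n)"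
    proof (intro mult_left_mono emeasure_mono UQ)
      show "(\<Union>n. Q n) \<in> sets lborel" by (rule sets.countable_UN) (auto simp: Q_def)
    qed simp
    also have "\<dots> \<le> ennreal l * (\<Sum>n. emeasure lborel (Q n))"
      by (intro mult_left_mono emeasure_subadditive_countably) (auto simp: Q_def)
    also have "\<dots> = (\<Sum>n. ennreal l * emeasure lborel (Q n))" by simp
    also have "\<dots> \<le> (\<Sum>n. 5 * emeasure \<nu> (P n))" by (intro suminf_le PQ) auto
    also have "\<dots> = 5 * emeasure \<nu> (\<Union>n. P n)"
      by (subst suminf_emeasure[symmetric]) (auto simp: disj P_def)
    also have "\<dots> \<le> 5 * emeasure \<nu> {a-d..b+d}" 
      using PU by (intro mult_left_mono emeasure_mono) auto
    also have "\<dots> = ennreal (5 * integral {a-d..b+d} F)" by (simp add: \<nu> ennreal_mult')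
    finally have *: "ennreal l * emeasure lborel E \<le> ennreal (5 * integral {a-d..b+d} F)" .
    have "emeasure lborel E \<le> emeasure lborel {a..b}" using E by (intro emeasure_mono) auto
    then have "emeasure lborel E \<noteq> \<infinity>"
      unfolding emeasure_lborel_Icc_eq using le_less_trans[OF _ ennreal_less_top] by force
    then have "emeasure lborel E = ennreal (measure lborel E)" by (intro emeasure_eq_ennreal_measure) auto
    with * have "ennreal (l * measure lborel E) \<le> ennreal (5 * integral {a-d..b+d} F)"
      using l by (simp add: ennreal_mult)
    moreover have "0 \<le> integral {a-d..b+d} F"
      by (intro integral_nonneg integrable_continuous_interval continuous_on_subset[OF F]) (auto simp: nn)
    ultimately show ?thesis by (subst (asm) ennreal_le_iff) auto
  qed
qed

section \<open>Radial limits\<close>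

text \<open>If all centred averages at \<open>t\<close> were at most \<open>l\<close>, the whole
  radius would be as well. The constant \<open>30 * pi\<close> is the product of 5 from the covering
  lemma, 3 periods, and \<open>2 * pi\<close> from normalising the measure.\<close>

lemma maximal_closed_disk:
  fixes f :: "complex \<Rightarrow> complex"
  assumes fm: "f \<in> borel_measurable borel" and c: "continuous_on (cball 0 1) f"
    and h: "f holomorphic_on ball 0 1" and l: "0 < l"
  defines "E \<equiv> {t \<in> {0..2*pi}. \<exists>r\<in>{0..<1}. l < cmod (f (of_real r * cis t))}"
  shows "E \<in> sets borel"
    and "l * measure lborel E \<le> 30 * pi * (\<integral>\<zeta>. cmod (f \<zeta>) \<partial>circle_measure)"
proof -
  let ?F = "\<lambda>s. cmod (f (cis s))"
  have fc: "continuous_on UNIV ?F"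
    by (intro continuous_intros continuous_on_compose2[OF c]) auto
  \<comment> \<open>\<open>E\<close> involves an uncountable union over \<open>r\<close>; its
    measurability rests on openness of the single sets.\<close>
  have "open {t. l < cmod (f (of_real r * cis t))}" if "r \<in> {0..<1}" for r
  proof -
    have "continuous_on UNIV (\<lambda>t. cmod (f (of_real r * cis t)))"
      using that by (intro continuous_intros continuous_on_compose2[OF c]) (auto simp: norm_mult)
    then show ?thesis by (rule open_Collect_less[OF continuous_on_const])
  qed
  then have "open (\<Union>r\<in>{0..<1}. {t. l < cmod (f (of_real r * cis t))})" by blast
  moreover have E: "E = {0..2*pi} \<inter> (\<Union>r\<in>{0..<1}. {t. l < cmod (f (of_real r * cis t))})"
    unfolding E_def by blast
  ultimately show Em: "E \<in> sets borel" by auto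
  have "\<exists>h. 0 < h \<and> h \<le> pi \<and> 2 * h * l < integral {t-h..t+h} ?F" if "t \<in> E" for t
  proof (rule ccontr)
    assume "\<not> ?thesis"
    then have "\<And>h. 0 < h \<Longrightarrow> h \<le> pi \<Longrightarrow> integral {t-h..t+h} ?F \<le> 2 * h * l" by force
    then have "cmod (f (of_real r * cis t)) \<le> l" if "0 \<le> r" "r < 1" for r
      using radial_le_averages[OF fm c h that] by blast
    with \<open>t \<in> E\<close> show False by (force simp: E_def)
  qed
  then have "l * measure lborel E \<le> 5 * integral {0 - pi..2*pi + pi} ?F"
    using Em l E by (intro weak_type_maximal[OF fc]) auto
  \<comment> \<open>Enlarging to three full periods makes each piece an exact translate of
    \<open>{0..2*pi}\<close>.\<close>
  also have "integral {0 - pi..2*pi + pi} ?F \<le> integral {-2*pi..4*pi} ?F"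
    by (intro integral_subset_le integrable_continuous_interval continuous_on_subset[OF fc]) auto
  also have "integral {-2*pi..4*pi} ?F = 3 * integral {0..2*pi} ?F"
  proof -
    have int: "?F integrable_on {a..b}" for a b
      by (intro integrable_continuous_interval continuous_on_subset[OF fc]) auto
    have "integral {-2*pi..4*pi} ?F = integral {-2*pi..0} ?F + integral {0..2*pi} ?F + integral {2*pi..4*pi} ?F"
      using Henstock_Kurzweil_Integration.integral_combine[where a="-2*pi" and c=0 and b="4*pi", OF _ _ int]
        Henstock_Kurzweil_Integration.integral_combine[where a=0 and c="2*pi" and b="4*pi", OF _ _ int] by simp
    also have "integral {-2*pi..0} ?F = integral {0..2*pi} ?F"
      using integral_shift_real_ivl[where a=0 and b="2*pi" and c="2*pi" and f="?F"] by (simp flip: cis_mult)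
    also have "integral {2*pi..4*pi} ?F = integral {0..2*pi} ?F"
      using integral_shift_real_ivl[where a="2*pi" and b="4*pi" and c="2*pi" and f="?F"] by (simp flip: cis_mult)
    finally show ?thesis by simp
  qed
  also have "integral {0..2*pi} ?F = 2 * pi * (\<integral>\<zeta>. cmod (f \<zeta>) \<partial>circle_measure)"
  proof -
    have "((\<lambda>t. complex_of_real (cmod (f (cis t)))) has_integral
        (2 * pi * (\<integral>\<zeta>. complex_of_real (cmod (f \<zeta>)) \<partial>circle_measure))) {0..2*pi}"
      using fm by (intro circle_continuous(2) continuous_intros continuous_on_subset[OF c]) auto
    from has_integral_Re[OF this] show ?thesis by (simp add: integral_unique)
  qed
  finally show "l * measure lborel E \<le> 30 * pi * (\<integral>\<zeta>. cmod (f \<zeta>) \<partial>circle_measure)" by simp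
qed

text \<open>Dilation by \<open>R < 1\<close> gives continuity up to the circle, and squaring makes
  the integral of the modulus a mean square, bounded by the norm independently of \<open>R\<close>.
  The level \<open>c\<close> becomes \<open>c\<^sup>2\<close>.\<close>

lemma maximal_hfun_scaled:
  fixes x :: l2
  assumes R: "0 \<le> R" "R < 1" and c: "0 < c"
  defines "E \<equiv> {t \<in> {0..2*pi}. \<exists>r\<in>{0..<1}. c < cmod (hfun x (of_real (R * r) * cis t))}"
  shows "E \<in> sets borel" and "emeasure lborel E \<le> ennreal (30 * pi * (norm x)\<^sup>2 / c\<^sup>2)"
proof -
  define f where "f z = (hfun x (of_real R * z))\<^sup>2" for z
  note [measurable] = disk_analytic_measurable[OF hfun_disk_analytic[of x]]
  have fm: "f \<in> borel_measurable borel" unfolding f_def by measurable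
  have in_ball: "of_real R * z \<in> ball 0 1" if "norm z \<le> 1" for z :: complex
  proof -
    have "R * norm z \<le> R" using R that by (simp add: mult_left_le)
    then show ?thesis using R by (simp add: norm_mult)
  qed
  have fc: "continuous_on (cball 0 1) f" unfolding f_def
    by (intro continuous_intros continuous_on_compose2[OF holomorphic_on_imp_continuous_on[OF hfun_holomorphic]])
       (use in_ball in auto)
  have fh: "f holomorphic_on ball 0 1" unfolding f_def
    by (intro holomorphic_intros holomorphic_on_compose_gen[OF _ hfun_holomorphic, unfolded o_def])
       (use in_ball in \<open>force simp: less_imp_le\<close>)
  have E: "E = {t \<in> {0..2*pi}. \<exists>r\<in>{0..<1}. c\<^sup>2 < cmod (f (of_real r * cis t))}"
  proof -
    have "c\<^sup>2 < y\<^sup>2 \<longleftrightarrow> c < y" if "0 \<le> y" for y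
      using c that by (meson less_imp_le pos2 power_less_imp_less_base power_strict_mono)
    then show ?thesis unfolding E_def f_def by (simp add: norm_power mult.assoc)
  qed
  have c2: "0 < c\<^sup>2" using c by simp
  show Em: "E \<in> sets borel" unfolding E by (rule maximal_closed_disk(1)[OF fm fc fh c2])
  have "c\<^sup>2 * measure lborel E \<le> 30 * pi * (\<integral>\<zeta>. cmod (f \<zeta>) \<partial>circle_measure)"
    unfolding E by (rule maximal_closed_disk(2)[OF fm fc fh c2])
  also have "(\<integral>\<zeta>. cmod (f \<zeta>) \<partial>circle_measure) \<le> (norm x)\<^sup>2"
    using hfun_mean_square_le[OF R, of x] by (simp add: f_def norm_power)
  finally have "measure lborel E \<le> 30 * pi * (norm x)\<^sup>2 / c\<^sup>2" using c2 by (simp add: field_simps)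
  moreover have "emeasure lborel E = ennreal (measure lborel E)"
  proof (rule emeasure_eq_ennreal_measure)
    have "emeasure lborel E \<le> emeasure lborel {0..2*pi}" by (intro emeasure_mono) (auto simp: E_def)
    then show "emeasure lborel E \<noteq> \<top>"
      unfolding emeasure_lborel_Icc_eq using le_less_trans[OF _ ennreal_less_top] by force
  qed
  ultimately show "emeasure lborel E \<le> ennreal (30 * pi * (norm x)\<^sup>2 / c\<^sup>2)" by (simp add: ennreal_leI)
qed

text \<open>The estimate does not depend on the dilation, and the level sets increase to
  \<open>E\<close> as the dilation tends to 1.\<close>

lemma maximal_hfun:
  fixes x :: l2
  assumes c: "0 < c"
  defines "E \<equiv> {t \<in> {0..2*pi}. \<exists>r\<in>{0..<1}. c < cmod (hfun x (of_real r * cis t))}"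
  shows "E \<in> sets borel" and "emeasure lborel E \<le> ennreal (30 * pi * (norm x)\<^sup>2 / c\<^sup>2)"
proof -
  define R where "R n = 1 - 1 / (real n + 1)" for n
  have R: "0 \<le> R n" "R n < 1" for n by (auto simp: R_def)
  have Rm: "R m \<le> R n" if "m \<le> n" for m n using that by (auto simp: R_def frac_le)
  define A where "A n = {t \<in> {0..2*pi}. \<exists>r\<in>{0..<1}. c < cmod (hfun x (of_real (R n * r) * cis t))}" for n
  have A: "A n \<in> sets borel" "emeasure lborel (A n) \<le> ennreal (30 * pi * (norm x)\<^sup>2 / c\<^sup>2)" for n
    unfolding A_def using maximal_hfun_scaled[OF R c] by auto
  have Aeq: "A n = {t \<in> {0..2*pi}. \<exists>r\<in>{0..<R n}. c < cmod (hfun x (of_real r * cis t))}" if "R n > 0" for n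
  proof -
    have eq: "(\<exists>r\<in>{0..<1}. P (R n * r)) \<longleftrightarrow> (\<exists>r\<in>{0..<R n}. P r)" for P :: "real \<Rightarrow> bool"
    proof
      assume "\<exists>r\<in>{0..<R n}. P r"
      then obtain r where "r \<in> {0..<R n}" "P r" by blast
      then show "\<exists>r\<in>{0..<1}. P (R n * r)" using that by (intro bexI[of _ "r / R n"]) auto
    next
      assume "\<exists>r\<in>{0..<1}. P (R n * r)"
      then show "\<exists>r\<in>{0..<R n}. P r" using that by auto
    qed
    show ?thesis unfolding A_def by (rule Collect_cong, rule conj_cong[OF refl], rule eq)
  qed
  \<comment> \<open>The shift skips \<open>R 0 = 0\<close>, where rescaling the radius by division
    through \<open>R n\<close> fails.\<close>
  define B where "B n = A (Suc n)" for n
  have Beq: "B n = {t \<in> {0..2*pi}. \<exists>r\<in>{0..<R (Suc n)}. c < cmod (hfun x (of_real r * cis t))}" for n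
    unfolding B_def by (rule Aeq) (simp add: R_def)
  have inc: "incseq B"
  proof (rule incseq_SucI)
    fix n
    have "{0..<R (Suc n)} \<subseteq> {0..<R (Suc (Suc n))}" using Rm[of "Suc n" "Suc (Suc n)"] by auto
    then show "B n \<subseteq> B (Suc n)" unfolding Beq by blast
  qed
  have "E = (\<Union>n. B n)"
  proof (intro set_eqI iffI)
    fix t assume "t \<in> E"
    then obtain r where r: "t \<in> {0..2*pi}" "0 \<le> r" "r < 1" "c < cmod (hfun x (of_real r * cis t))"
      by (auto simp: E_def)
    obtain n where "inverse (real (Suc n)) < 1 - r" using reals_Archimedean[of "1 - r"] r by auto
    moreover have "1 / (real (Suc n) + 1) \<le> inverse (real (Suc n))" by (simp add: divide_inverse)
    ultimately have "r < R (Suc n)" by (simp add: R_def)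
    then have "t \<in> B n" using r unfolding Beq by auto
    then show "t \<in> (\<Union>n. B n)" by blast
  next
    fix t assume "t \<in> (\<Union>n. B n)"
    then obtain n r where "t \<in> {0..2*pi}" "r \<in> {0..<R (Suc n)}" "c < cmod (hfun x (of_real r * cis t))" unfolding Beq by auto
    then show "t \<in> E" unfolding E_def using R[of "Suc n"] by (auto intro!: bexI[of _ r])
  qed
  moreover have "range B \<subseteq> sets lborel" using A by (auto simp: B_def)
  ultimately show "E \<in> sets borel" "emeasure lborel E \<le> ennreal (30 * pi * (norm x)\<^sup>2 / c\<^sup>2)"
  proof -
    assume E: "E = (\<Union>n. B n)" and B: "range B \<subseteq> sets lborel"
    show "E \<in> sets borel" using sets.countable_UN[OF B] by (simp add: E)
    have "emeasure lborel E = (SUP n. emeasure lborel (B n))"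
      unfolding E by (rule SUP_emeasure_incseq[OF B inc, symmetric])
    also have "\<dots> \<le> ennreal (30 * pi * (norm x)\<^sup>2 / c\<^sup>2)"
      unfolding B_def by (intro SUP_least A(2))
    finally show "emeasure lborel E \<le> ennreal (30 * pi * (norm x)\<^sup>2 / c\<^sup>2)" .
  qed
qed

section \<open>Radial convergence and measurability of boundary functions\<close>

definition rad_conv :: "(complex \<Rightarrow> complex) \<Rightarrow> complex \<Rightarrow> bool" where
  "rad_conv f \<zeta> \<longleftrightarrow> (\<exists>L. ((\<lambda>r::real. f (of_real r * \<zeta>)) \<longlongrightarrow> L) (at_left 1))"

lemma bdry_eqI: "((\<lambda>r::real. f (of_real r * \<zeta>)) \<longlongrightarrow> L) (at_left 1) \<Longrightarrow> bdry f \<zeta> = L"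
  unfolding bdry_def by (rule tendsto_Lim) auto

lemma bdry_tendsto: "rad_conv f \<zeta> \<Longrightarrow> ((\<lambda>r::real. f (of_real r * \<zeta>)) \<longlongrightarrow> bdry f \<zeta>) (at_left 1)"
  using bdry_eqI unfolding rad_conv_def by metis

text \<open>A fixed sequence starting at 0 and increasing to 1. Fatou's lemma and dominated
  convergence require sequences in place of the one-sided limit.\<close>

abbreviation radii :: "nat \<Rightarrow> real" where "radii k \<equiv> 1 - inverse (real (Suc k))"

lemma radii_at_left: "filterlim radii (at_left 1) sequentially"
proof (rule tendsto_imp_filterlim_at_left)
  show "radii \<longlonglongrightarrow> 1" using tendsto_diff[OF tendsto_const[of 1] LIMSEQ_inverse_real_of_nat] by simp
qed simp

lemma tendsto_at_left_Cauchy: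
  fixes h :: "real \<Rightarrow> 'a::complete_space"
  assumes "\<And>e. 0 < e \<Longrightarrow> \<exists>b<1. \<forall>p\<in>{b<..<1}. \<forall>q\<in>{b<..<1}. dist (h p) (h q) \<le> e"
  shows "\<exists>L. (h \<longlongrightarrow> L) (at_left 1)"
proof -
  have ev: "\<forall>\<^sub>F k in sequentially. radii k \<in> {b<..<1}" if "b < 1" for b
    using radii_at_left eventually_at_left_real[OF that] by (rule filterlim_iff[THEN iffD1, rule_format])
  have "Cauchy (\<lambda>k. h (radii k))"
  proof (rule metric_CauchyI)
    fix e :: real assume "e > 0"
    then obtain b where b: "b < 1" "\<forall>p\<in>{b<..<1}. \<forall>q\<in>{b<..<1}. dist (h p) (h q) \<le> e / 2" using assms[of "e/2"] by auto
    obtain M where "\<And>k. k \<ge> M \<Longrightarrow> radii k \<in> {b<..<1}" using ev[OF b(1)] unfolding eventually_sequentially by blast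
    then have "dist (h (radii m)) (h (radii n)) < e" if "m \<ge> M" "n \<ge> M" for m n
      using b(2) that \<open>e > 0\<close> by (smt (verit) field_sum_of_halves)
    then show "\<exists>M. \<forall>m\<ge>M. \<forall>n\<ge>M. dist (h (radii m)) (h (radii n)) < e" by blast
  qed
  then obtain L where L: "(\<lambda>k. h (radii k)) \<longlonglongrightarrow> L" unfolding Cauchy_convergent_iff convergent_def by blast
  have "(h \<longlongrightarrow> L) (at_left 1)"
  proof (rule tendstoI)
    fix e :: real assume "e > 0"
    then obtain b where b: "b < 1" "\<forall>p\<in>{b<..<1}. \<forall>q\<in>{b<..<1}. dist (h p) (h q) \<le> e / 2" using assms[of "e/2"] by auto
    have "dist (h p) L < e" if p: "p \<in> {b<..<1}" for p
    proof -
      have "dist (h p) L \<le> e / 2"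
      proof (rule tendsto_upperbound)
        show "(\<lambda>k. dist (h p) (h (radii k))) \<longlonglongrightarrow> dist (h p) L" by (intro tendsto_intros L)
        show "\<forall>\<^sub>F k in sequentially. dist (h p) (h (radii k)) \<le> e / 2"
          using ev[OF b(1)] by eventually_elim (use b(2) p in blast)
      qed simp
      then show ?thesis using \<open>e > 0\<close> by simp
    qed
    then show "\<forall>\<^sub>F p in at_left 1. dist (h p) L < e"
      using eventually_at_left_real[OF b(1)] by (auto elim: eventually_mono)
  qed
  then show ?thesis by blast
qed

text \<open>A Cauchy criterion with tolerances and thresholds from countable sets, so that the set
  of convergence can be built by countable set operations.\<close>

lemma rad_conv_iff_Cauchy:
  "rad_conv f \<zeta> \<longleftrightarrow> (\<forall>n::nat. \<exists>m::nat. \<forall>p\<in>{radii m<..<1}. \<forall>q\<in>{radii m<..<1}.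
      dist (f (of_real p * \<zeta>)) (f (of_real q * \<zeta>)) \<le> inverse (real (Suc n)))" (is "?L \<longleftrightarrow> ?R")
proof
  assume ?L
  then obtain L where L: "((\<lambda>r::real. f (of_real r * \<zeta>)) \<longlongrightarrow> L) (at_left 1)" by (auto simp: rad_conv_def)
  show ?R
  proof
    fix n :: nat
    let ?e = "inverse (real (Suc n)) / 2"
    have "\<forall>\<^sub>F r in at_left 1. dist (f (of_real r * \<zeta>)) L < ?e" by (intro tendstoD[OF L]) simp
    then obtain b :: real where b: "b < 1" "\<And>r. b < r \<Longrightarrow> r < 1 \<Longrightarrow> dist (f (of_real r * \<zeta>)) L < ?e"
      by (auto simp: eventually_at_left_field)
    obtain m where m: "inverse (real (Suc m)) < 1 - b" using reals_Archimedean[of "1 - b"] b by auto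
    have "dist (f (of_real p * \<zeta>)) (f (of_real q * \<zeta>)) \<le> inverse (real (Suc n))"
      if "p \<in> {radii m<..<1}" "q \<in> {radii m<..<1}" for p q
    proof -
      have "b < p" "p < 1" "b < q" "q < 1" using that m by auto
      then have "dist (f (of_real p * \<zeta>)) L < ?e" "dist (f (of_real q * \<zeta>)) L < ?e" by (blast intro: b(2))+
      then show ?thesis using dist_triangle2[of "f (of_real p * \<zeta>)" "f (of_real q * \<zeta>)" L] by linarith
    qed
    then show "\<exists>m. \<forall>p\<in>{radii m<..<1}. \<forall>q\<in>{radii m<..<1}.
      dist (f (of_real p * \<zeta>)) (f (of_real q * \<zeta>)) \<le> inverse (real (Suc n))" by blast
  qed
next
  assume R: ?R
  show ?L unfolding rad_conv_def
  proof (rule tendsto_at_left_Cauchy)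
    fix e :: real assume "0 < e"
    then obtain n where n: "inverse (real (Suc n)) < e" using reals_Archimedean by blast
    obtain m where "\<forall>p\<in>{radii m<..<1}. \<forall>q\<in>{radii m<..<1}.
      dist (f (of_real p * \<zeta>)) (f (of_real q * \<zeta>)) \<le> inverse (real (Suc n))" using R by blast
    then show "\<exists>b<1. \<forall>p\<in>{b<..<1}. \<forall>q\<in>{b<..<1}. dist (f (of_real p * \<zeta>)) (f (of_real q * \<zeta>)) \<le> e"
      using n by (intro exI[of _ "radii m"]) force
  qed
qed

text \<open>For fixed tolerance and threshold the points violating the Cauchy bound form an
  uncountable union over \<open>p\<close> and \<open>q\<close>, but of sets that are open relative
  to the closed disk, since \<open>f\<close> is continuous inside.\<close>

lemma rad_conv_measurable:
  assumes f: "f \<in> disk_analytic"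
  shows "{\<zeta>. rad_conv f \<zeta>} \<in> sets borel"
proof -
  have fc: "continuous_on (ball 0 1) f" using f by (auto simp: disk_analytic_def intro: holomorphic_on_imp_continuous_on)
  define O' where "O' n m = (\<Union>p\<in>{radii m<..<1}. \<Union>q\<in>{radii m<..<1}. {\<zeta>\<in>cball 0 1.
      inverse (real (Suc n)) < dist (f (of_real p * \<zeta>)) (f (of_real q * \<zeta>))})" for n m :: nat
  have O': "O' n m \<in> sets borel" for n m
  proof -
    have sub: "openin (top_of_set (cball 0 1))
        {\<zeta> \<in> cball 0 1. inverse (real (Suc n)) < dist (f (of_real p * \<zeta>)) (f (of_real q * \<zeta>))}"
      if pq: "p \<in> {radii m<..<1}" "q \<in> {radii m<..<1}" for p q
    proof -
      have 0: "0 \<le> radii m" by (simp add: inverse_le_1_iff)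
      have inb: "of_real s * \<zeta> \<in> ball 0 1" if "s \<in> {radii m<..<1}" "\<zeta> \<in> cball 0 1" for s and \<zeta> :: complex
      proof -
        have s: "0 \<le> s" "s < 1" using that 0 by auto
        have "s * norm \<zeta> \<le> s" using that s by (intro mult_left_le) auto
        then have "s * norm \<zeta> < 1" using s by linarith
        then show ?thesis using s by (simp add: norm_mult)
      qed
      have "continuous_on (cball 0 1) (\<lambda>\<zeta>. dist (f (of_real p * \<zeta>)) (f (of_real q * \<zeta>)))"
        by (intro continuous_intros continuous_on_compose2[OF fc]) (use inb pq in auto)
      from continuous_openin_preimage_gen[OF this, of "{inverse (real (Suc n))<..}"]
      show ?thesis
        by (simp add: vimage_def Int_def)
    qed
    have "openin (top_of_set (cball 0 1)) (O' n m)"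
      unfolding O'_def by (intro openin_Union; erule imageE; simp only:; intro openin_Union; erule imageE; simp only: sub)
    then obtain T where "open T" "O' n m = cball 0 1 \<inter> T" by (auto simp: openin_open)
    then show ?thesis by auto
  qed
  \<comment> \<open>Beyond the closed disk the point \<open>r * \<zeta>\<close> lies outside the
    unit disk for \<open>r\<close> near 1, where \<open>f\<close> is 0.\<close>
  have out: "rad_conv f \<zeta>" if "1 < norm \<zeta>" for \<zeta>
    unfolding rad_conv_def
  proof (intro exI tendsto_eventually)
    have "\<forall>\<^sub>F r in at_left 1. r \<in> {inverse (norm \<zeta>)<..<1}"
      using that by (intro eventually_at_left_real) (simp add: inverse_less_1_iff)
    then show "\<forall>\<^sub>F r in at_left 1. f (of_real r * \<zeta>) = 0"
    proof eventually_elim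
      case (elim r)
      then have "inverse (norm \<zeta>) * norm \<zeta> < r * norm \<zeta>" using that by (intro mult_strict_right_mono) auto
      moreover have "inverse (norm \<zeta>) * norm \<zeta> = 1" using that by (intro left_inverse) auto
      ultimately have "1 < r * norm \<zeta>" by simp
      moreover have "0 < inverse (norm \<zeta>)" using that by auto
      then have "0 < r" by (rule less_trans) (use elim in simp)
      ultimately show ?case using f by (simp add: disk_analytic_def norm_mult)
    qed
  qed
  have "{\<zeta>. rad_conv f \<zeta>} = (- cball 0 1) \<union> (cball 0 1 - (\<Union>n. \<Inter>m. O' n m))"
  proof -
    have "rad_conv f \<zeta> \<longleftrightarrow> \<zeta> \<notin> (\<Union>n. \<Inter>m. O' n m)" if "\<zeta> \<in> cball 0 1" for \<zeta>
      using that unfolding rad_conv_iff_Cauchy O'_def by (simp add: not_le) (meson linorder_not_less)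
    then show ?thesis using out by force
  qed
  also have "\<dots> \<in> sets borel" using O' by (intro sets.Un sets.Diff sets.countable_UN sets.countable_INT) auto
  finally show ?thesis .
qed

lemma bdry_measurable:
  assumes f: "f \<in> disk_analytic"
  shows "bdry f \<in> borel_measurable borel"
proof -
  note [measurable] = rad_conv_measurable[OF f] disk_analytic_measurable[OF f]
  \<comment> \<open>Where no limit exists, \<open>Lim\<close> is a description of an unsatisfiable
    property, hence the same constant at all such points. This makes \<open>bdry f\<close>
    measurable everywhere, not only almost everywhere.\<close>
  have "bdry f \<zeta> = (if rad_conv f \<zeta> then lim (\<lambda>k. f (of_real (radii k) * \<zeta>)) else (THE L. False))" for \<zeta>
  proof (cases "rad_conv f \<zeta>")
    case True
    have "(\<lambda>k. f (of_real (radii k) * \<zeta>)) \<longlonglongrightarrow> bdry f \<zeta>"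
      by (rule filterlim_compose[OF bdry_tendsto[OF True] radii_at_left])
    from limI[OF this] show ?thesis using True by simp
  next
    case False
    then have "(\<lambda>L. ((\<lambda>r::real. f (of_real r * \<zeta>)) \<longlongrightarrow> L) (at_left 1)) = (\<lambda>L. False)" by (auto simp: rad_conv_def)
    then show ?thesis using False by (simp add: bdry_def Lim_def t2_space_class.Lim_def)
  qed
  then have "bdry f = (\<lambda>\<zeta>. if rad_conv f \<zeta> then lim (\<lambda>k. f (of_real (radii k) * \<zeta>)) else (THE L. False))" by blast
  moreover have "\<dots> \<in> borel_measurable borel"
    by (intro measurable_If borel_measurable_lim_metric) auto
  ultimately show ?thesis by simp
qed

text \<open>Density plus the maximal estimate: polynomials converge radially, and off a null set the
  tail after a suitable truncation is as small as desired along the entire radius.\<close>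

theorem AE_rad_conv_hfun: "AE \<zeta> in circle_measure. rad_conv (hfun x) \<zeta>"
proof (subst AE_circle_iff)
  show "{\<zeta>. rad_conv (hfun x) \<zeta>} \<in> sets borel" by (rule rad_conv_measurable[OF hfun_disk_analytic])
  \<comment> \<open>The angles at which the tail after \<open>m\<close> terms exceeds
    \<open>1 / (j + 1)\<close> somewhere on the radius. For fixed \<open>j\<close> the measure tends
    to 0 with the norm of the tail, so the intersection over \<open>m\<close> is null.\<close>
  define A where "A m j = {t \<in> {0..2*pi}. \<exists>r\<in>{0..<1}. inverse (real (Suc j)) < cmod (hfun (x - trunc m x) (of_real r * cis t))}" for m j :: nat
  have Am: "A m j \<in> sets borel" for m j unfolding A_def by (rule maximal_hfun(1)) simp
  have "emeasure lborel (\<Inter>m. A m j) = 0" for j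
  proof -
    have le: "emeasure lborel (\<Inter>m. A m j) \<le> ennreal (30 * pi * (norm (x - trunc m x))\<^sup>2 / (inverse (real (Suc j)))\<^sup>2)" for m
    proof -
      have "emeasure lborel (\<Inter>m. A m j) \<le> emeasure lborel (A m j)" using Am by (intro emeasure_mono) auto
      also have "\<dots> \<le> ennreal (30 * pi * (norm (x - trunc m x))\<^sup>2 / (inverse (real (Suc j)))\<^sup>2)"
        unfolding A_def by (rule maximal_hfun(2)) simp
      finally show ?thesis .
    qed
    have "(\<lambda>m. 30 * pi * (norm (x - trunc m x))\<^sup>2 / (inverse (real (Suc j)))\<^sup>2) \<longlonglongrightarrow> 30 * pi * (norm (x - x))\<^sup>2 / (inverse (real (Suc j)))\<^sup>2"
      by (intro tendsto_intros trunc_tendsto) auto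
    then have "(\<lambda>m. ennreal (30 * pi * (norm (x - trunc m x))\<^sup>2 / (inverse (real (Suc j)))\<^sup>2)) \<longlonglongrightarrow> ennreal 0"
      by (intro tendsto_ennrealI) simp
    then have "emeasure lborel (\<Inter>m. A m j) \<le> ennreal 0"
      by (rule tendsto_lowerbound) (use le in auto)
    then show ?thesis by simp
  qed
  then have "(\<Inter>m. A m j) \<in> null_sets lborel" for j using Am by (intro null_setsI) auto
  then have "(\<Union>j. \<Inter>m. A m j) \<in> null_sets lborel" by (intro null_sets_UN) auto
  then show "AE t in lborel. t \<in> {0..2*pi} \<longrightarrow> rad_conv (hfun x) (cis t)"
  proof (rule AE_I')
    show "{t \<in> space lborel. \<not> (t \<in> {0..2*pi} \<longrightarrow> rad_conv (hfun x) (cis t))} \<subseteq> (\<Union>j. \<Inter>m. A m j)"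
    proof (rule subsetI, rule ccontr)
      fix t assume t: "t \<in> {t \<in> space lborel. \<not> (t \<in> {0..2*pi} \<longrightarrow> rad_conv (hfun x) (cis t))}"
        and n: "t \<notin> (\<Union>j. \<Inter>m. A m j)"
      have "rad_conv (hfun x) (cis t)" unfolding rad_conv_def
      proof (rule tendsto_at_left_Cauchy)
        fix e :: real assume e: "0 < e"
        obtain j where j: "inverse (real (Suc j)) < e / 3" using reals_Archimedean[of "e/3"] e by auto
        obtain m where m: "t \<notin> A m j" using n by blast
        define S where "S z = (\<Sum>n<m. coord x n * z ^ n)" for z
        have small: "cmod (hfun x (of_real r * cis t) - S (of_real r * cis t)) \<le> e / 3" if "0 \<le> r" "r < 1" for r
        proof -
          have "\<not> inverse (real (Suc j)) < cmod (hfun (x - trunc m x) (of_real r * cis t))"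
            using m t that unfolding A_def by auto
          moreover have "hfun (x - trunc m x) (of_real r * cis t) = hfun x (of_real r * cis t) - S (of_real r * cis t)"
            using that by (simp add: hfun_diff hfun_trunc norm_mult S_def)
          ultimately show ?thesis using j by simp
        qed
        have "isCont (\<lambda>r. S (of_real r * cis t)) 1" unfolding S_def by (intro continuous_intros)
        \<comment> \<open>Two errors \<open>e / 6\<close> for the polynomial and two errors
          \<open>e / 3\<close> for the tails add up to \<open>e\<close>.\<close>
        moreover have "0 < e / 6" using e by simp
        ultimately obtain d where d: "d > 0" "\<And>r. dist r 1 < d \<Longrightarrow> dist (S (of_real r * cis t)) (S (of_real 1 * cis t)) < e / 6"
          unfolding continuous_at_eps_delta by blast
        have "dist (hfun x (of_real p * cis t)) (hfun x (of_real q * cis t)) \<le> e"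
          if "p \<in> {max 0 (1 - d)<..<1}" "q \<in> {max 0 (1 - d)<..<1}" for p q
        proof -
          have "dist p 1 < d" "dist q 1 < d" using that by (auto simp: dist_real_def)
          then have "dist (S (of_real p * cis t)) (S (of_real 1 * cis t)) < e / 6"
               "dist (S (of_real q * cis t)) (S (of_real 1 * cis t)) < e / 6"
            by (blast intro: d(2))+
          then have "dist (S (of_real p * cis t)) (S (of_real q * cis t)) \<le> e / 3"
            using dist_triangle2[of "S (of_real p * cis t)" "S (of_real q * cis t)" "S (of_real 1 * cis t)"] by linarith
          moreover have "dist (hfun x (of_real p * cis t)) (S (of_real p * cis t)) \<le> e / 3"
              "dist (S (of_real q * cis t)) (hfun x (of_real q * cis t)) \<le> e / 3"
            using small[of p] small[of q] that by (auto simp: dist_norm norm_minus_commute)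
          ultimately show ?thesis
            using dist_triangle[of "hfun x (of_real p * cis t)" "hfun x (of_real q * cis t)" "S (of_real p * cis t)"]
              dist_triangle[of "S (of_real p * cis t)" "hfun x (of_real q * cis t)" "S (of_real q * cis t)"] by linarith
        qed
        then show "\<exists>b<1. \<forall>p\<in>{b<..<1}. \<forall>q\<in>{b<..<1}. dist (hfun x (of_real p * cis t)) (hfun x (of_real q * cis t)) \<le> e"
          using d(1) by (intro exI[of _ "max 0 (1 - d)"]) auto
      qed
      with t show False by blast
    qed
  qed
qed

section \<open>Boundary values and co-analytic Toeplitz operators\<close>

lemma AE_bdry:
  "AE \<zeta> in circle_measure. ((\<lambda>r::real. hfun x (of_real r * \<zeta>)) \<longlongrightarrow> bdry (hfun x) \<zeta>) (at_left 1)"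
  using AE_rad_conv_hfun[of x] by eventually_elim (rule bdry_tendsto)

lemma AE_bdry_add:
  "AE \<zeta> in circle_measure. bdry (hfun (x + y)) \<zeta> = bdry (hfun x) \<zeta> + bdry (hfun y) \<zeta>"
  using AE_bdry[of x] AE_bdry[of y]
  by eventually_elim (rule bdry_eqI, simp only: hfun_add, rule tendsto_add)

lemma AE_bdry_diff:
  "AE \<zeta> in circle_measure. bdry (hfun (x - y)) \<zeta> = bdry (hfun x) \<zeta> - bdry (hfun y) \<zeta>"
  using AE_bdry[of x] AE_bdry[of y]
  by eventually_elim (rule bdry_eqI, simp only: hfun_diff, rule tendsto_diff)

lemma AE_bdry_cscale:
  "AE \<zeta> in circle_measure. bdry (hfun (cscale c x)) \<zeta> = c * bdry (hfun x) \<zeta>"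
  using AE_bdry[of x]
  by eventually_elim (rule bdry_eqI, simp only: hfun_cscale, rule tendsto_mult_left)

lemma eventually_at_left_1_unit: "\<forall>\<^sub>F r in at_left 1. r \<in> {0<..<1::real}"
  by (rule eventually_at_left_real) simp

lemma bdry_trunc:
  assumes "norm \<zeta> = 1"
  shows "bdry (hfun (trunc m x)) \<zeta> = (\<Sum>n<m. coord x n * \<zeta> ^ n)"
proof (rule bdry_eqI)
  have "((\<lambda>r::real. \<Sum>n<m. coord x n * (of_real r * \<zeta>) ^ n) \<longlongrightarrow> (\<Sum>n<m. coord x n * (of_real 1 * \<zeta>) ^ n)) (at_left 1)"
    by (intro tendsto_intros)
  moreover have "\<forall>\<^sub>F r in at_left 1. (\<Sum>n<m. coord x n * (of_real r * \<zeta>) ^ n) = hfun (trunc m x) (of_real r * \<zeta>)"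
    using eventually_at_left_1_unit
    by eventually_elim (use assms in \<open>auto simp: hfun_trunc norm_mult\<close>)
  ultimately show "((\<lambda>r::real. hfun (trunc m x) (of_real r * \<zeta>)) \<longlongrightarrow> (\<Sum>n<m. coord x n * \<zeta> ^ n)) (at_left 1)"
    by (auto intro: Lim_transform_eventually)
qed

lemma bdry_hfun_measurable [measurable]: "bdry (hfun x) \<in> borel_measurable borel"
  by (rule bdry_measurable[OF hfun_disk_analytic])

text \<open>Fatou's lemma along \<open>radii\<close>. It is stated with the nonnegative integral
  because integrability of the boundary function is itself one of its consequences.\<close>

lemma nn_integral_bdry_le:
  "(\<integral>\<^sup>+\<zeta>. ennreal ((cmod (bdry (hfun x) \<zeta>))\<^sup>2) \<partial>circle_measure) \<le> ennreal ((norm x)\<^sup>2)"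
proof -
  note [measurable] = disk_analytic_measurable[OF hfun_disk_analytic[of x]]
  let ?f = "\<lambda>k \<zeta>. (cmod (hfun x (of_real (radii k) * \<zeta>)))\<^sup>2"
  have r: "0 \<le> radii k" "radii k < 1" for k by (auto simp: inverse_le_1_iff)
  have le: "(\<integral>\<^sup>+\<zeta>. ennreal (?f k \<zeta>) \<partial>circle_measure) \<le> ennreal ((norm x)\<^sup>2)" for k
  proof -
    have "AE \<zeta> in circle_measure. norm (?f k \<zeta>) \<le> (norm x / (1 - radii k))\<^sup>2"
      using AE_circle_norm
    proof eventually_elim
      case (elim \<zeta>)
      have "norm (of_real (radii k) * \<zeta>) = \<bar>radii k\<bar> * norm \<zeta>" by (simp only: norm_mult norm_of_real)
      then have "norm (of_real (radii k) * \<zeta>) = radii k" using elim r[of k] by simp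
      then have "cmod (hfun x (of_real (radii k) * \<zeta>)) \<le> norm x / (1 - radii k)"
        using norm_hfun_le[of "of_real (radii k) * \<zeta>" x] r[of k] by simp
      then show ?case by (simp add: power_mono del: of_real_diff)
    qed
    then have "integrable circle_measure (?f k)" by (rule circle.integrable_const_bound) measurable
    then have "(\<integral>\<^sup>+\<zeta>. ennreal (?f k \<zeta>) \<partial>circle_measure) = ennreal (\<integral>\<zeta>. ?f k \<zeta> \<partial>circle_measure)"
      by (rule nn_integral_eq_integral) simp
    also have "\<dots> \<le> ennreal ((norm x)\<^sup>2)" by (intro ennreal_leI hfun_mean_square_le r)
    finally show ?thesis .
  qed
  have "(\<integral>\<^sup>+\<zeta>. ennreal ((cmod (bdry (hfun x) \<zeta>))\<^sup>2) \<partial>circle_measure) = (\<integral>\<^sup>+\<zeta>. liminf (\<lambda>k. ennreal (?f k \<zeta>)) \<partial>circle_measure)"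
  proof (rule nn_integral_cong_AE)
    show "AE \<zeta> in circle_measure. ennreal ((cmod (bdry (hfun x) \<zeta>))\<^sup>2) = liminf (\<lambda>k. ennreal (?f k \<zeta>))"
      using AE_bdry[of x]
    proof eventually_elim
      case (elim \<zeta>)
      have "(\<lambda>k. ennreal (?f k \<zeta>)) \<longlonglongrightarrow> ennreal ((cmod (bdry (hfun x) \<zeta>))\<^sup>2)"
        by (intro tendsto_ennrealI tendsto_intros filterlim_compose[OF elim radii_at_left])
      from lim_imp_Liminf[OF _ this] show ?case by simp
    qed
  qed
  also have "\<dots> \<le> liminf (\<lambda>k. \<integral>\<^sup>+\<zeta>. ennreal (?f k \<zeta>) \<partial>circle_measure)"
    by (rule nn_integral_liminf) measurable
  also have "\<dots> \<le> liminf (\<lambda>k. ennreal ((norm x)\<^sup>2))" by (intro Liminf_mono always_eventually allI le)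
  also have "\<dots> = ennreal ((norm x)\<^sup>2)" by (simp add: Liminf_const)
  finally show ?thesis .
qed

lemma integrable_bdry_square: "integrable circle_measure (\<lambda>\<zeta>. (cmod (bdry (hfun x) \<zeta>))\<^sup>2)"
  using le_less_trans[OF nn_integral_bdry_le[of x] ennreal_less_top]
  by (intro integrableI_bounded) auto

lemma integral_bdry_square_le: "(\<integral>\<zeta>. (cmod (bdry (hfun x) \<zeta>))\<^sup>2 \<partial>circle_measure) \<le> (norm x)\<^sup>2"
  using nn_integral_bdry_le[of x] by (subst (asm) nn_integral_eq_integral[OF integrable_bdry_square]) auto

lemma bdry_parallelogram:
  "(\<integral>\<zeta>. (cmod (bdry (hfun (x + y)) \<zeta>))\<^sup>2 \<partial>circle_measure) + (\<integral>\<zeta>. (cmod (bdry (hfun (x - y)) \<zeta>))\<^sup>2 \<partial>circle_measure)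
   = 2 * (\<integral>\<zeta>. (cmod (bdry (hfun x) \<zeta>))\<^sup>2 \<partial>circle_measure) + 2 * (\<integral>\<zeta>. (cmod (bdry (hfun y) \<zeta>))\<^sup>2 \<partial>circle_measure)"
proof -
  have "(\<integral>\<zeta>. (cmod (bdry (hfun (x + y)) \<zeta>))\<^sup>2 + (cmod (bdry (hfun (x - y)) \<zeta>))\<^sup>2 \<partial>circle_measure)
    = (\<integral>\<zeta>. 2 * (cmod (bdry (hfun x) \<zeta>))\<^sup>2 + 2 * (cmod (bdry (hfun y) \<zeta>))\<^sup>2 \<partial>circle_measure)"
  proof (rule integral_cong_AE)
    show "AE \<zeta> in circle_measure. (cmod (bdry (hfun (x + y)) \<zeta>))\<^sup>2 + (cmod (bdry (hfun (x - y)) \<zeta>))\<^sup>2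
       = 2 * (cmod (bdry (hfun x) \<zeta>))\<^sup>2 + 2 * (cmod (bdry (hfun y) \<zeta>))\<^sup>2"
      using AE_bdry_add[of x y] AE_bdry_diff[of x y]
      by eventually_elim (simp only: cmod_power2 plus_complex.simps minus_complex.simps, simp add: power2_eq_square algebra_simps)
  qed measurable
  then show ?thesis by (simp add: integrable_bdry_square)
qed

text \<open>
  Fatou's lemma gives \<open>\<le>\<close>; the parallelogram law applied to \<open>x = S + (x - S)\<close> for truncations
  \<open>S\<close>, where equality holds, forces \<open>\<ge>\<close>.
\<close>

lemma integral_bdry_square: "(\<integral>\<zeta>. (cmod (bdry (hfun x) \<zeta>))\<^sup>2 \<partial>circle_measure) = (norm x)\<^sup>2"
proof (rule antisym[OF integral_bdry_square_le])
  let ?q = "\<lambda>x. \<integral>\<zeta>. (cmod (bdry (hfun x) \<zeta>))\<^sup>2 \<partial>circle_measure"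
  have "2 * (norm (trunc m x))\<^sup>2 - (norm x)\<^sup>2 \<le> ?q x" for m
  proof -
    let ?S = "trunc m x"
    have qS: "?q ?S = (norm ?S)\<^sup>2"
    proof -
      have "?q ?S = (\<integral>\<zeta>. (cmod (\<Sum>n<m. coord x n * \<zeta> ^ n))\<^sup>2 \<partial>circle_measure)"
      proof (rule integral_cong_AE)
        show "AE \<zeta> in circle_measure. (cmod (bdry (hfun ?S) \<zeta>))\<^sup>2 = (cmod (\<Sum>n<m. coord x n * \<zeta> ^ n))\<^sup>2"
          using AE_circle_norm by eventually_elim (simp add: bdry_trunc)
      qed measurable
      then show ?thesis by (simp only: circle_sum_square norm_trunc)
    qed
    have "?q x + ?q (?S - (x - ?S)) = 2 * ?q ?S + 2 * ?q (x - ?S)" using bdry_parallelogram[of ?S "x - ?S"] by simp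
    moreover have "?q (?S - (x - ?S)) \<le> (norm (?S - (x - ?S)))\<^sup>2" by (rule integral_bdry_square_le)
    \<comment> \<open>This vector keeps the first \<open>m\<close> coefficients of \<open>x\<close>
      and reverses the sign of the others.\<close>
    moreover have "(norm (?S - (x - ?S)))\<^sup>2 = (norm x)\<^sup>2"
      unfolding norm_l2_power2 by (intro suminf_cong) simp
    moreover have "0 \<le> ?q (x - ?S)" by simp
    ultimately show ?thesis using qS by linarith
  qed
  moreover have "(\<lambda>m. 2 * (norm (trunc m x))\<^sup>2 - (norm x)\<^sup>2) \<longlonglongrightarrow> 2 * (norm x)\<^sup>2 - (norm x)\<^sup>2"
    by (intro tendsto_intros trunc_tendsto)
  ultimately have "2 * (norm x)\<^sup>2 - (norm x)\<^sup>2 \<le> ?q x" by (intro LIMSEQ_le_const2) auto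
  then show "(norm x)\<^sup>2 \<le> ?q x" by simp
qed

lemma integrable_mult_cnj:
  fixes u v :: "'a \<Rightarrow> complex"
  assumes [measurable]: "u \<in> borel_measurable M" "v \<in> borel_measurable M"
    and "integrable M (\<lambda>x. (cmod (u x))\<^sup>2)" "integrable M (\<lambda>x. (cmod (v x))\<^sup>2)"
  shows "integrable M (\<lambda>x. u x * cnj (v x))"
proof (rule Bochner_Integration.integrable_bound[OF Bochner_Integration.integrable_add[OF assms(3,4)]])
  show "AE x in M. norm (u x * cnj (v x)) \<le> norm ((cmod (u x))\<^sup>2 + (cmod (v x))\<^sup>2)"
  proof (rule AE_I2)
    fix x
    have "0 \<le> cmod (u x) * cmod (v x)" by simp
    then have "cmod (u x) * cmod (v x) \<le> (cmod (u x))\<^sup>2 + (cmod (v x))\<^sup>2"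
      using sum_squares_bound[of "cmod (u x)" "cmod (v x)"] by linarith
    then show "norm (u x * cnj (v x)) \<le> norm ((cmod (u x))\<^sup>2 + (cmod (v x))\<^sup>2)" by (simp add: norm_mult)
  qed
qed measurable

lemma integrable_bdry_mult: "integrable circle_measure (\<lambda>\<zeta>. bdry (hfun x) \<zeta> * cnj (bdry (hfun y) \<zeta>))"
  by (intro integrable_mult_cnj integrable_bdry_square) auto

text \<open>Polarisation of the norm identity gives the real part; replacing \<open>y\<close> by its
  multiple with the imaginary unit gives the imaginary part.\<close>

lemma H2_inner_hfun: "H2_inner (hfun x) (hfun y) = cip x y"
proof -
  have R: "Re (H2_inner (hfun x) (hfun y)) = inner x y" for x y
  proof -
    have "4 * Re (H2_inner (hfun x) (hfun y)) = (\<integral>\<zeta>. 4 * Re (bdry (hfun x) \<zeta> * cnj (bdry (hfun y) \<zeta>)) \<partial>circle_measure)"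
      unfolding H2_inner_def by (simp add: integral_Re[OF integrable_bdry_mult, symmetric] del: Re_complex_of_real times_complex.simps)
    also have "\<dots> = (\<integral>\<zeta>. (cmod (bdry (hfun (x + y)) \<zeta>))\<^sup>2 - (cmod (bdry (hfun (x - y)) \<zeta>))\<^sup>2 \<partial>circle_measure)"
    proof (rule integral_cong_AE)
      show "AE \<zeta> in circle_measure. 4 * Re (bdry (hfun x) \<zeta> * cnj (bdry (hfun y) \<zeta>))
         = (cmod (bdry (hfun (x + y)) \<zeta>))\<^sup>2 - (cmod (bdry (hfun (x - y)) \<zeta>))\<^sup>2"
        using AE_bdry_add[of x y] AE_bdry_diff[of x y]
        by eventually_elim (simp only: cmod_power2 plus_complex.simps minus_complex.simps times_complex.simps cnj.simps, simp add: power2_eq_square algebra_simps)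
    qed measurable
    also have "\<dots> = (norm (x + y))\<^sup>2 - (norm (x - y))\<^sup>2"
      by (simp add: integrable_bdry_square integral_bdry_square)
    also have "\<dots> = 4 * inner x y"
      unfolding power2_norm_eq_inner by (simp add: inner_add_left inner_add_right inner_diff_left inner_diff_right inner_commute)
    finally show ?thesis by simp
  qed
  have "Im (H2_inner (hfun x) (hfun y)) = Re (H2_inner (hfun x) (hfun (cscale \<i> y)))"
  proof -
    have "H2_inner (hfun x) (hfun (cscale \<i> y)) = (\<integral>\<zeta>. - \<i> * (bdry (hfun x) \<zeta> * cnj (bdry (hfun y) \<zeta>)) \<partial>circle_measure)"
      unfolding H2_inner_def
    proof (rule integral_cong_AE)
      show "AE \<zeta> in circle_measure. bdry (hfun x) \<zeta> * cnj (bdry (hfun (cscale \<i> y)) \<zeta>) = - \<i> * (bdry (hfun x) \<zeta> * cnj (bdry (hfun y) \<zeta>))"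
        using AE_bdry_cscale[of \<i> y] by eventually_elim simp
    qed measurable
    also have "\<dots> = - \<i> * H2_inner (hfun x) (hfun y)" unfolding H2_inner_def by (rule integral_mult_right_zero)
    finally show ?thesis by simp
  qed
  with R show ?thesis by (simp add: cip_eq_inner complex_eq_iff)
qed

section \<open>Riesz representation, multiplication by the symbol, and its adjoint\<close>

lemma riesz_representation:
  fixes \<phi> :: "'a::{real_inner,complete_space} \<Rightarrow> real"
  assumes "bounded_linear \<phi>"
  obtains z where "\<And>y. \<phi> y = inner z y"
proof (cases "\<forall>y. \<phi> y = 0")
  case True
  then show thesis using that[of 0] by simp
next
  case False
  interpret bounded_linear \<phi> by fact
  obtain w where w: "\<phi> w \<noteq> 0" using False by blast
  have "closed {y. \<phi> y = 0}" by (intro closed_Collect_eq continuous_intros continuous_on linear_continuous_on[OF assms])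
  moreover have "subspace {y. \<phi> y = 0}" by (auto simp: subspace_def add scaleR zero)
  ultimately obtain k where k: "\<phi> k = 0" and orth: "\<And>y. \<phi> y = 0 \<Longrightarrow> inner (w - k) y = 0"
    using orthogonal_decomposition[of "{y. \<phi> y = 0}" w] by auto
  \<comment> \<open>The null space of a nonzero functional has codimension one, so its orthogonal
    complement is spanned by this component of \<open>w\<close>.\<close>
  define v where "v = w - k"
  have \<phi>v: "\<phi> v \<noteq> 0" using w k by (simp add: v_def diff)
  then have vv: "inner v v \<noteq> 0" using zero by auto
  have "\<phi> y = inner ((\<phi> v / inner v v) *\<^sub>R v) y" for y
  proof -
    have "\<phi> (y - (\<phi> y / \<phi> v) *\<^sub>R v) = 0" using \<phi>v by (simp add: diff scaleR)
    from orth[OF this] have "inner v y = \<phi> y / \<phi> v * inner v v" by (simp add: v_def inner_diff_right)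
    then show ?thesis using \<phi>v vv by simp
  qed
  then show thesis by (rule that)
qed

lemma cip_left_unique: "(\<And>y. cip z y = cip w y) \<Longrightarrow> z = w"
  using cip_self[of "z - w"] by (simp add: cip_diff_left)

lemma hfun_mult_Hinf:
  assumes a: "a \<in> disk_analytic" and B: "\<And>z. norm z < 1 \<Longrightarrow> cmod (a z) \<le> B"
  obtains y where "\<And>z. hfun y z = a z * hfun x z" "norm y \<le> B * norm x"
proof -
  have "cmod (a 0) \<le> B" by (rule B) simp
  then have B0: "0 \<le> B" using norm_ge_zero order_trans by blast
  note [measurable] = disk_analytic_measurable[OF a] disk_analytic_measurable[OF hfun_disk_analytic[of x]]
  define f where "f z = a z * hfun x z" for z
  have f: "f \<in> disk_analytic" using a hfun_disk_analytic[of x] unfolding disk_analytic_def f_def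
    by (auto intro!: holomorphic_intros)
  have "(\<integral>\<zeta>. (cmod (f (of_real r * \<zeta>)))\<^sup>2 \<partial>circle_measure) \<le> (B * norm x)\<^sup>2" if r: "0 \<le> r" "r < 1" for r
  proof -
    have ae: "AE \<zeta> in circle_measure. (cmod (hfun x (of_real r * \<zeta>)))\<^sup>2 \<le> (norm x / (1 - r))\<^sup>2"
      using AE_circle_norm
    proof eventually_elim
      case (elim \<zeta>)
      then have "norm (of_real r * \<zeta>) = r" using r by (simp add: norm_mult)
      then show ?case using norm_hfun_le[of "of_real r * \<zeta>" x] r by (simp add: power_mono)
    qed
    have i: "integrable circle_measure (\<lambda>\<zeta>. (cmod (hfun x (of_real r * \<zeta>)))\<^sup>2)"
      by (rule circle.integrable_const_bound[where B="(norm x / (1 - r))\<^sup>2"]) (use ae in simp, measurable)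
    have "(\<integral>\<zeta>. (cmod (f (of_real r * \<zeta>)))\<^sup>2 \<partial>circle_measure) \<le> (\<integral>\<zeta>. B\<^sup>2 * (cmod (hfun x (of_real r * \<zeta>)))\<^sup>2 \<partial>circle_measure)"
    proof (rule integral_mono_AE')
      show "AE \<zeta> in circle_measure. (cmod (f (of_real r * \<zeta>)))\<^sup>2 \<le> B\<^sup>2 * (cmod (hfun x (of_real r * \<zeta>)))\<^sup>2"
        using AE_circle_norm
      proof eventually_elim
        case (elim \<zeta>)
        then have "cmod (a (of_real r * \<zeta>)) \<le> B" using r by (intro B) (simp add: norm_mult)
        then show ?case unfolding f_def norm_mult power_mult_distrib by (intro mult_right_mono power_mono) auto
      qed
    qed (use i in auto)
    also have "\<dots> = B\<^sup>2 * (\<integral>\<zeta>. (cmod (hfun x (of_real r * \<zeta>)))\<^sup>2 \<partial>circle_measure)" by simp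
    also have "\<dots> \<le> B\<^sup>2 * (norm x)\<^sup>2" by (intro mult_left_mono hfun_mean_square_le r) auto
    finally show ?thesis by (simp add: power_mult_distrib)
  qed
  from disk_analytic_eq_hfun[OF f this] obtain y where y: "f = hfun y" "(norm y)\<^sup>2 \<le> (B * norm x)\<^sup>2" by blast
  have "norm y \<le> B * norm x" by (rule power2_le_imp_le[OF y(2)]) (intro mult_nonneg_nonneg B0 norm_ge_zero)
  moreover have "hfun y z = a z * hfun x z" for z unfolding y(1)[symmetric] f_def ..
  ultimately show thesis using that by blast
qed

text \<open>This description and that of \<open>adjop\<close> are meaningful for symbols in
  \<open>Hinf\<close>; existence and uniqueness are settled in \<open>hfun_mulop\<close> and
  \<open>cip_adjop\<close>.\<close>

definition mulop :: "(complex \<Rightarrow> complex) \<Rightarrow> l2 \<Rightarrow> l2" where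
  "mulop a x = (THE y. \<forall>z. hfun y z = a z * hfun x z)"

definition adjop :: "(complex \<Rightarrow> complex) \<Rightarrow> l2 \<Rightarrow> l2" where
  "adjop a x = (THE w. \<forall>y. cip w y = cip x (mulop a y))"

lemma Hinf_D:
  assumes "a \<in> Hinf"
  obtains B where "a \<in> disk_analytic" "\<And>z. norm z < 1 \<Longrightarrow> cmod (a z) \<le> B"
proof -
  obtain B where "\<forall>y\<in>a ` ball 0 1. norm y \<le> B" using assms unfolding Hinf_def bounded_iff by blast
  then show thesis using that[of B] assms by (simp add: Hinf_def)
qed

context
  fixes a :: "complex \<Rightarrow> complex"
  assumes a: "a \<in> Hinf"
begin

lemma hfun_mulop: "hfun (mulop a x) z = a z * hfun x z"
proof -
  obtain B where "a \<in> disk_analytic" "\<And>z. norm z < 1 \<Longrightarrow> cmod (a z) \<le> B" using Hinf_D[OF a] by blast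
  then obtain y where y: "\<And>z. hfun y z = a z * hfun x z" using hfun_mult_Hinf[of a B x] by blast
  have "mulop a x = y" unfolding mulop_def
    by (rule the_equality) (use y injD[OF inj_hfun] in \<open>auto simp: fun_eq_iff\<close>)
  then show ?thesis using y by simp
qed

lemma mulop_eqI: "(\<And>z. hfun y z = a z * hfun x z) \<Longrightarrow> mulop a x = y"
  by (rule injD[OF inj_hfun]) (simp add: fun_eq_iff hfun_mulop)

lemma mulop_add: "mulop a (x + y) = mulop a x + mulop a y"
  by (rule mulop_eqI) (simp add: hfun_add hfun_mulop algebra_simps)

lemma mulop_cscale: "mulop a (cscale c x) = cscale c (mulop a x)"
  by (rule mulop_eqI) (simp add: hfun_cscale hfun_mulop algebra_simps)

lemma bounded_linear_mulop: "bounded_linear (mulop a)"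
proof -
  obtain B where B: "a \<in> disk_analytic" "\<And>z. norm z < 1 \<Longrightarrow> cmod (a z) \<le> B" using Hinf_D[OF a] by blast
  show ?thesis
  proof (rule bounded_linear_intro[where K=B])
    show "mulop a (r *\<^sub>R x) = r *\<^sub>R mulop a x" for r x
    proof -
      have "r *\<^sub>R x = cscale (of_real r) x" for x by (rule l2_eqI) (simp add: scaleR_conv_of_real)
      then show ?thesis by (simp add: mulop_cscale)
    qed
    show "norm (mulop a x) \<le> norm x * B" for x
    proof -
      obtain y where y: "\<And>z. hfun y z = a z * hfun x z" "norm y \<le> B * norm x" using hfun_mult_Hinf[OF B] by blast
      then show ?thesis using mulop_eqI[of y x] by (simp add: mult.commute)
    qed
  qed (rule mulop_add)
qed

lemma cip_adjop: "cip (adjop a x) y = cip x (mulop a y)"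
proof -
  have "bounded_linear (\<lambda>y. inner x (mulop a y))"
    by (rule bounded_linear_compose[OF bounded_linear_inner_right bounded_linear_mulop])
  then obtain w where w: "\<And>y. inner x (mulop a y) = inner w y" using riesz_representation by blast
  \<comment> \<open>The vector represents only the real part at first. As \<open>mulop a\<close>
    commutes with multiplication by the imaginary unit, it represents the complex functional
    too.\<close>
  have cw: "cip w y = cip x (mulop a y)" for y
    by (simp add: cip_eq_inner w mulop_cscale[symmetric])
  have "adjop a x = w" unfolding adjop_def
    by (rule the_equality) (use cw in \<open>auto intro: cip_left_unique\<close>)
  then show ?thesis using cw by simp
qed

lemma adjop_eqI: "(\<And>y. cip w y = cip x (mulop a y)) \<Longrightarrow> adjop a x = w"
  by (rule cip_left_unique) (simp add: cip_adjop)

lemma adjop_add: "adjop a (x + y) = adjop a x + adjop a y"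
  by (rule adjop_eqI) (simp add: cip_add_left cip_adjop)

lemma adjop_diff: "adjop a (x - y) = adjop a x - adjop a y"
  by (rule adjop_eqI) (simp add: cip_diff_left cip_adjop)

lemma adjop_cscale: "adjop a (cscale c x) = cscale c (adjop a x)"
  by (rule adjop_eqI) (simp add: cip_cscale_left cip_adjop)

lemma AE_bdry_mulop: "AE \<zeta> in circle_measure. bdry (hfun (mulop a x)) \<zeta> = bdry a \<zeta> * bdry (hfun x) \<zeta>"
proof -
  obtain \<alpha> where \<alpha>: "a = hfun \<alpha>" using Hinf_imp_H2[OF a] by (auto simp: H2_eq)
  show ?thesis using AE_bdry[of \<alpha>] AE_bdry[of x]
  proof eventually_elim
    case (elim \<zeta>)
    from tendsto_mult[OF elim[folded \<alpha>]] show ?case by (intro bdry_eqI) (simp only: hfun_mulop)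
  qed
qed

lemma bdry_symbol_measurable: "bdry a \<in> borel_measurable borel"
  using a by (intro bdry_measurable) (simp add: Hinf_def)

text \<open>Moving the conjugate symbol to the other factor turns the orthogonality condition of
  \<open>P_plus\<close> into the adjoint equation, whose only solution is \<open>adjop a x\<close>.
  The projection is thus evaluated directly, without its theory on all of L2.\<close>

lemma co_toeplitz_hfun: "co_toeplitz a (hfun x) = hfun (adjop a x)"
proof -
  note [measurable] = bdry_symbol_measurable
  let ?g = "\<lambda>\<zeta>. cnj (bdry a \<zeta>) * bdry (hfun x) \<zeta>"
  have key: "(\<integral>\<zeta>. (?g \<zeta> - bdry (hfun w) \<zeta>) * cnj (bdry (hfun y) \<zeta>) \<partial>circle_measure) = cip x (mulop a y) - cip w y" for w y
  proof -
    have "(\<integral>\<zeta>. (?g \<zeta> - bdry (hfun w) \<zeta>) * cnj (bdry (hfun y) \<zeta>) \<partial>circle_measure)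
       = (\<integral>\<zeta>. bdry (hfun x) \<zeta> * cnj (bdry (hfun (mulop a y)) \<zeta>) - bdry (hfun w) \<zeta> * cnj (bdry (hfun y) \<zeta>) \<partial>circle_measure)"
    proof (rule integral_cong_AE)
      show "AE \<zeta> in circle_measure. (?g \<zeta> - bdry (hfun w) \<zeta>) * cnj (bdry (hfun y) \<zeta>)
         = bdry (hfun x) \<zeta> * cnj (bdry (hfun (mulop a y)) \<zeta>) - bdry (hfun w) \<zeta> * cnj (bdry (hfun y) \<zeta>)"
        using AE_bdry_mulop[of y] by eventually_elim (simp add: algebra_simps)
    qed measurable
    also have "\<dots> = cip x (mulop a y) - cip w y"
      by (simp add: integrable_bdry_mult H2_inner_hfun[unfolded H2_inner_def])
    finally show ?thesis .
  qed
  show ?thesis unfolding co_toeplitz_def toeplitz_def P_plus_def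
  proof (rule the_equality)
    show "hfun (adjop a x) \<in> H2 \<and> (\<forall>k\<in>H2. (\<integral>\<zeta>. (?g \<zeta> - bdry (hfun (adjop a x)) \<zeta>) * cnj (bdry k \<zeta>) \<partial>circle_measure) = 0)"
      by (auto simp: H2_eq key cip_adjop)
  next
    fix h assume h: "h \<in> H2 \<and> (\<forall>k\<in>H2. (\<integral>\<zeta>. (?g \<zeta> - bdry h \<zeta>) * cnj (bdry k \<zeta>) \<partial>circle_measure) = 0)"
    then obtain w where w: "h = hfun w" by (auto simp: H2_eq)
    have "cip x (mulop a y) - cip w y = 0" for y using h hfun_in_H2[of y] unfolding w by (metis key)
    then have "adjop a x = w" by (intro adjop_eqI) simp
    then show "h = hfun (adjop a x)" using w by simp
  qed
qed

end

section \<open>Representing elements\<close>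

definition ker_perp :: "(complex \<Rightarrow> complex) \<Rightarrow> l2 set" where
  "ker_perp a = {x. \<forall>y. adjop a y = 0 \<longrightarrow> cip x y = 0}"

lemma hfun_eq_iff: "hfun x = hfun y \<longleftrightarrow> x = y"
  using inj_hfun by (auto dest: injD)

lemma hfun_eq_zero_iff: "hfun x = (\<lambda>_. 0) \<longleftrightarrow> x = 0"
  using hfun_eq_iff[of x 0] by (simp add: fun_eq_iff)

section \<open>Radial approach inside Stolz angles\<close>

lemma radii_bounds: "0 \<le> radii k" "radii k < 1"
  by (auto simp: inverse_le_1_iff)

lemma norm_radial:
  fixes \<zeta> :: complex
  assumes "norm \<zeta> = 1"
  shows "norm (of_real (radii k) * \<zeta>) = radii k" "norm (of_real (radii k) * \<zeta> - \<zeta>) = 1 - radii k"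
proof -
  have "norm (of_real (radii k) * \<zeta>) = \<bar>radii k\<bar> * norm \<zeta>" by (simp only: norm_mult norm_of_real)
  then show "norm (of_real (radii k) * \<zeta>) = radii k" using assms radii_bounds[of k] by simp
  have "of_real (radii k) * \<zeta> - \<zeta> = of_real (radii k - 1) * \<zeta>" by (simp add: algebra_simps)
  then have "norm (of_real (radii k) * \<zeta> - \<zeta>) = \<bar>radii k - 1\<bar> * norm \<zeta>" by (simp only: norm_mult norm_of_real)
  then show "norm (of_real (radii k) * \<zeta> - \<zeta>) = 1 - radii k" using assms by simp
qed

text \<open>On the radius the distance to \<open>\<zeta>\<close> equals \<open>1 - norm z\<close>,
  so it lies in every Stolz angle. Hence non-tangential limits are unique and can be tested along a
  sequence.\<close>

lemma radial_filterlim: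
  assumes \<zeta>: "norm \<zeta> = 1" and \<alpha>: "\<alpha> > 1"
  shows "filterlim (\<lambda>k. of_real (radii k) * \<zeta>) (at \<zeta> within Stolz \<alpha> \<zeta>) sequentially"
  unfolding filterlim_at
proof (intro conjI always_eventually allI)
  fix k
  show "of_real (radii k) * \<zeta> \<in> Stolz \<alpha> \<zeta>"
    using norm_radial[OF \<zeta>, of k] radii_bounds[of k] \<alpha> by (simp add: Stolz_def del: of_real_diff)
  show "of_real (radii k) * \<zeta> \<noteq> \<zeta>"
    using norm_radial(1)[OF \<zeta>, of k] radii_bounds[of k] \<zeta> by auto
next
  have "radii \<longlonglongrightarrow> 1" using radii_at_left by (simp add: filterlim_at)
  then have "(\<lambda>k. of_real (radii k) * \<zeta>) \<longlonglongrightarrow> of_real 1 * \<zeta>" by (intro tendsto_mult tendsto_of_real tendsto_const)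
  then show "(\<lambda>k. of_real (radii k) * \<zeta>) \<longlonglongrightarrow> \<zeta>" by simp
qed

lemma has_nt_limit_unique:
  assumes \<zeta>: "norm \<zeta> = 1" and L: "has_nt_limit f \<zeta> L" "has_nt_limit f \<zeta> L'"
  shows "L = L'"
proof -
  have "(f \<longlongrightarrow> L) (at \<zeta> within Stolz 2 \<zeta>)" "(f \<longlongrightarrow> L') (at \<zeta> within Stolz 2 \<zeta>)"
    using L by (auto simp: has_nt_limit_def)
  from this[THEN filterlim_compose, OF radial_filterlim[OF \<zeta>]]
  show ?thesis by (intro LIMSEQ_unique) auto
qed

text \<open>Used to discard the singularity of the kernels on the circle, where division by zero
  would return 0.\<close>

lemma AE_circle_neq: "AE \<zeta> in circle_measure. \<zeta> \<noteq> w"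
proof (subst AE_circle_iff)
  have "countable {t. cis t = w}"
  proof (cases "\<exists>s. cis s = w")
    case True
    then obtain s where s: "cis s = w" by blast
    have "{t. cis t = w} \<subseteq> range (\<lambda>n::int. s + 2 * pi * n)"
      using sin_cos_eq_iff[of _ s] by (auto simp: s[symmetric] complex_eq_iff)
    then show ?thesis by (rule countable_subset) simp
  qed simp
  then have "{t. cis t = w} \<in> null_sets lborel" by (rule countable_imp_null_set_lborel)
  then show "AE t in lborel. t \<in> {0..2*pi} \<longrightarrow> cis t \<noteq> w" by (rule AE_I') auto
qed auto

section \<open>Kernels for derivatives at points of the disk\<close>

lemma one_minus_cnj_mult_neq:
  assumes "norm w < 1" "norm z \<le> 1" shows "1 - cnj w * z \<noteq> 0"
proof
  assume "1 - cnj w * z = 0"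
  then have "cmod (cnj w * z) = 1" by simp
  moreover have "cmod w * cmod z \<le> cmod w" using assms by (intro mult_left_le) auto
  ultimately show False using assms by (simp add: norm_mult)
qed

lemma norm_one_minus_cnj_mult:
  assumes "norm \<zeta> = 1" shows "cmod (1 - cnj w * \<zeta>) = cmod (\<zeta> - w)"
proof -
  have "cnj \<zeta> * \<zeta> = 1" using assms by (simp add: complex_norm_square[symmetric] mult.commute)
  then have "1 - cnj w * \<zeta> = cnj (\<zeta> - w) * \<zeta>" by (simp add: algebra_simps)
  then show ?thesis using assms by (simp add: norm_mult del: complex_cnj_diff)
qed

text \<open>The derivative of order \<open>l\<close> of the Szego kernel
  \<open>1 / (1 - cnj w * z)\<close> with respect to \<open>cnj w\<close>.\<close>

definition szego :: "complex \<Rightarrow> nat \<Rightarrow> complex \<Rightarrow> complex" where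
  "szego w l z = (if z \<in> ball 0 1 then fact l * z ^ l / (1 - cnj w * z) ^ (l + 1) else 0)"

lemma szego_Hinf:
  assumes w: "norm w < 1" shows "szego w l \<in> Hinf"
proof -
  have h: "(\<lambda>z. fact l * z ^ l / (1 - cnj w * z) ^ (l + 1)) holomorphic_on ball 0 1"
    using one_minus_cnj_mult_neq[OF w] by (intro holomorphic_intros) (auto simp: less_imp_le)
  have c: "continuous_on (cball 0 1) (\<lambda>z. fact l * z ^ l / (1 - cnj w * z) ^ (l + 1))"
    using one_minus_cnj_mult_neq[OF w] by (intro continuous_intros) auto
  have "szego w l holomorphic_on ball 0 1"
    using h by (rule holomorphic_transform) (simp add: szego_def)
  moreover have "bounded (szego w l ` ball 0 1)"
  proof (rule bounded_subset)
    show "bounded ((\<lambda>z. fact l * z ^ l / (1 - cnj w * z) ^ (l + 1)) ` cball 0 1)"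
      by (intro compact_imp_bounded compact_continuous_image c compact_cball)
  qed (auto simp: szego_def)
  ultimately show ?thesis by (simp add: Hinf_def disk_analytic_def szego_def)
qed

definition szego_vec :: "complex \<Rightarrow> nat \<Rightarrow> l2" where
  "szego_vec w l = inv hfun (szego w l)"

lemma hfun_szego_vec: "norm w < 1 \<Longrightarrow> hfun (szego_vec w l) = szego w l"
  unfolding szego_vec_def using Hinf_imp_H2[OF szego_Hinf[of w l]] by (intro f_inv_into_f) (simp add: H2_eq)

text \<open>Stated for a general factor \<open>a\<close>, since it is applied with the constant 1
  for the Szego kernels and with the symbol for \<open>a_kernel\<close>, where \<open>w\<close> may
  lie on the circle.\<close>

lemma bdry_mult_kernel:
  assumes \<zeta>: "norm \<zeta> = 1" and w: "1 - cnj w * \<zeta> \<noteq> 0"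
    and a: "((\<lambda>r::real. a (of_real r * \<zeta>)) \<longlongrightarrow> L) (at_left 1)"
    and f: "\<And>z. norm z < 1 \<Longrightarrow> f z = fact l * (z ^ l * a z / (1 - cnj w * z) ^ (l + 1))"
  shows "bdry f \<zeta> = fact l * (\<zeta> ^ l * L / (1 - cnj w * \<zeta>) ^ (l + 1))"
proof (rule bdry_eqI)
  have id: "((\<lambda>r::real. of_real r * \<zeta>) \<longlongrightarrow> of_real 1 * \<zeta>) (at_left 1)" by (intro tendsto_intros)
  have "((\<lambda>r::real. fact l * ((of_real r * \<zeta>) ^ l * a (of_real r * \<zeta>) / (1 - cnj w * (of_real r * \<zeta>)) ^ (l + 1)))
     \<longlongrightarrow> fact l * ((of_real 1 * \<zeta>) ^ l * L / (1 - cnj w * (of_real 1 * \<zeta>)) ^ (l + 1))) (at_left 1)"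
    using w by (intro tendsto_mult tendsto_divide tendsto_power tendsto_diff tendsto_const id a) simp
  moreover have "\<forall>\<^sub>F r in at_left 1. fact l * ((of_real r * \<zeta>) ^ l * a (of_real r * \<zeta>) / (1 - cnj w * (of_real r * \<zeta>)) ^ (l + 1)) = f (of_real r * \<zeta>)"
    using eventually_at_left_1_unit by eventually_elim (use \<zeta> in \<open>simp add: f norm_mult\<close>)
  ultimately show "((\<lambda>r::real. f (of_real r * \<zeta>)) \<longlongrightarrow> fact l * (\<zeta> ^ l * L / (1 - cnj w * \<zeta>) ^ (l + 1))) (at_left 1)"
    by (auto intro: Lim_transform_eventually)
qed

text \<open>On the circle \<open>cnj \<zeta> = 1 / \<zeta>\<close>, so the conjugated Szego kernel
  is \<open>fact l * \<zeta> / (\<zeta> - w) ^ (l + 1)\<close> and the pairing is Cauchy's formula.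
  That formula needs continuity up to the circle, which truncations have; the general case follows
  by locally uniform convergence.\<close>

lemma deriv_hfun:
  assumes w: "norm w < 1"
  shows "(deriv ^^ l) (hfun y) w = cip y (szego_vec w l)"
proof -
  let ?S = "\<lambda>m z. \<Sum>n<m. coord y n * z ^ n"
  have trunc: "cip (trunc m y) (szego_vec w l) = (deriv ^^ l) (?S m) w" for m
  proof -
    have "cip (trunc m y) (szego_vec w l) = (\<integral>\<zeta>. bdry (hfun (trunc m y)) \<zeta> * cnj (bdry (hfun (szego_vec w l)) \<zeta>) \<partial>circle_measure)"
      by (simp add: H2_inner_hfun[symmetric] H2_inner_def)
    also have "\<dots> = (\<integral>\<zeta>. fact l * (?S m \<zeta> * \<zeta> / (\<zeta> - w) ^ Suc l) \<partial>circle_measure)"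
    proof (rule integral_cong_AE)
      show "AE \<zeta> in circle_measure. bdry (hfun (trunc m y)) \<zeta> * cnj (bdry (hfun (szego_vec w l)) \<zeta>) = fact l * (?S m \<zeta> * \<zeta> / (\<zeta> - w) ^ Suc l)"
        using AE_circle_norm
      proof eventually_elim
        case (elim \<zeta>)
        have nz: "1 - cnj w * \<zeta> \<noteq> 0" using one_minus_cnj_mult_neq[OF w] elim by simp
        have \<zeta>0: "\<zeta> \<noteq> 0" "\<zeta> - w \<noteq> 0" using elim w by auto
        have cz: "cnj \<zeta> = 1 / \<zeta>" using elim \<zeta>0 by (simp add: field_simps complex_norm_square[symmetric])
        have "bdry (hfun (szego_vec w l)) \<zeta> = fact l * (\<zeta> ^ l * 1 / (1 - cnj w * \<zeta>) ^ (l + 1))"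
          using elim nz by (intro bdry_mult_kernel[where a="\<lambda>_. 1"]) (auto simp: hfun_szego_vec[OF w] szego_def)
        then have "cnj (bdry (hfun (szego_vec w l)) \<zeta>) = fact l * ((1 / \<zeta>) ^ l / (1 - w / \<zeta>) ^ (l + 1))"
          by (simp add: cz)
        also have "1 - w / \<zeta> = (\<zeta> - w) / \<zeta>" using \<zeta>0 by (simp add: field_simps)
        also have "(1 / \<zeta>) ^ l / ((\<zeta> - w) / \<zeta>) ^ (l + 1) = \<zeta> / (\<zeta> - w) ^ Suc l"
          using \<zeta>0 by (simp add: power_divide field_simps)
        finally show ?case using elim by (simp add: bdry_trunc)
      qed
    qed measurable
    also have "\<dots> = fact l * ((deriv ^^ l) (?S m) w / fact l)"
      using w by (subst integral_mult_right_zero, subst circle_Cauchy)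
        (auto intro!: continuous_intros holomorphic_intros borel_measurable_continuous_onI)
    finally show ?thesis by simp
  qed
  define \<rho> where "\<rho> = (1 + norm w) / 2"
  have \<rho>: "norm w < \<rho>" "\<rho> < 1" using w by (auto simp: \<rho>_def)
  have "(\<lambda>m. (deriv ^^ l) (?S m) w) \<longlonglongrightarrow> (deriv ^^ l) (hfun y) w"
  proof (rule higher_deriv_complex_uniform_limit)
    show "uniform_limit (ball 0 \<rho>) ?S (hfun y) sequentially"
    proof (rule uniform_limitI)
      fix e :: real assume e: "e > 0"
      have "(\<lambda>m. norm (y - trunc m y) / (1 - \<rho>)) \<longlonglongrightarrow> norm (y - y) / (1 - \<rho>)"
        using \<rho> by (intro tendsto_intros trunc_tendsto) auto
      then have "\<forall>\<^sub>F m in sequentially. norm (y - trunc m y) / (1 - \<rho>) < e"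
        using e by (intro order_tendstoD(2)) auto
      then show "\<forall>\<^sub>F m in sequentially. \<forall>z\<in>ball 0 \<rho>. dist (?S m z) (hfun y z) < e"
      proof eventually_elim
        case (elim m)
        show ?case
        proof
          fix z :: complex assume "z \<in> ball 0 \<rho>"
          then have z: "norm z < \<rho>" "norm z < 1" using \<rho> by auto
          have "dist (?S m z) (hfun y z) = norm (hfun (y - trunc m y) z)"
            using z by (simp add: dist_norm hfun_diff hfun_trunc norm_minus_commute)
          also have "\<dots> \<le> norm (y - trunc m y) / (1 - norm z)" using z by (intro norm_hfun_le)
          also have "\<dots> \<le> norm (y - trunc m y) / (1 - \<rho>)" using z \<rho> by (intro divide_left_mono) auto
          finally show "dist (?S m z) (hfun y z) < e" using elim by linarith
        qed
      qed
    qed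
  qed (use \<rho> in \<open>auto intro!: holomorphic_intros always_eventually\<close>)
  moreover have "(\<lambda>m. (deriv ^^ l) (?S m) w) \<longlonglongrightarrow> cip y (szego_vec w l)"
    unfolding trunc[symmetric] by (intro tendsto_cip_left trunc_tendsto)
  ultimately show ?thesis by (rule LIMSEQ_unique)
qed

text \<open>Meaningful only if \<open>a_kernel a w l\<close> lies in \<open>H\<^sup>2\<close>; otherwise the inverse is an arbitrary vector.\<close>

definition a_kernel_vec :: "(complex \<Rightarrow> complex) \<Rightarrow> complex \<Rightarrow> nat \<Rightarrow> l2" where
  "a_kernel_vec a w l = inv hfun (a_kernel a w l)"

lemma hfun_a_kernel_vec: "a_kernel a w l \<in> H2 \<Longrightarrow> hfun (a_kernel_vec a w l) = a_kernel a w l"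
  unfolding a_kernel_vec_def by (intro f_inv_into_f) (simp add: H2_eq)

section \<open>The range space: its inner product and representing elements\<close>

context
  fixes a :: "complex \<Rightarrow> complex"
  assumes a: "a \<in> Hinf"
begin

lemma adjop_zero: "adjop a 0 = 0"
  using adjop_diff[OF a, of 0 0] by simp

lemma ker_perp_diff: "x \<in> ker_perp a \<Longrightarrow> y \<in> ker_perp a \<Longrightarrow> x - y \<in> ker_perp a"
  by (auto simp: ker_perp_def cip_diff_left)

text \<open>Subtracting the projection onto the closed kernel leaves the image unchanged. Real
  orthogonality becomes complex because the kernel is stable under \<open>cscale\<close>.\<close>

lemma ker_perp_decomposition:
  obtains p where "p \<in> ker_perp a" "adjop a p = adjop a x"
proof -
  let ?K = "{y. adjop a y = 0}"
  have "?K = (\<Inter>z. {y. cip y (mulop a z) = 0})"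
    by (auto simp flip: cip_adjop[OF a] intro: cip_left_unique)
  also have "closed \<dots>"
    by (intro closed_INT ballI closed_Collect_eq continuous_on_const
        linear_continuous_on[OF bounded_linear_cip_left])
  finally have cl: "closed ?K" .
  have sc: "r *\<^sub>R y = cscale (of_real r) y" for r y by (rule l2_eqI) (simp add: scaleR_conv_of_real)
  have cz: "cscale c 0 = 0" for c by (rule l2_eqI) simp
  have K: "subspace ?K"
    by (auto simp: subspace_def adjop_zero adjop_add[OF a] sc adjop_cscale[OF a] cz)
  obtain k where k: "adjop a k = 0" "\<And>y. adjop a y = 0 \<Longrightarrow> inner (x - k) y = 0"
    using orthogonal_decomposition[OF cl K, of x] by auto
  have "x - k \<in> ker_perp a"
    using k(2) by (auto simp: ker_perp_def cip_eq_inner adjop_cscale[OF a] cz complex_eq_iff)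
  moreover have "adjop a (x - k) = adjop a x" by (simp add: adjop_diff[OF a] k(1))
  ultimately show thesis by (rule that)
qed

lemma ker_perp_inj: 
  assumes "p \<in> ker_perp a" "q \<in> ker_perp a" "adjop a p = adjop a q" shows "p = q"
proof -
  have "adjop a (p - q) = 0" using assms by (simp add: adjop_diff[OF a])
  then have "cip (p - q) (p - q) = 0" using ker_perp_diff[OF assms(1,2)] by (simp add: ker_perp_def)
  then show ?thesis by (simp add: cip_self)
qed

lemma ker_compl_eq: "ker_compl a = hfun ` ker_perp a"
  by (auto simp: ker_compl_def ker_perp_def H2_eq co_toeplitz_hfun[OF a] hfun_eq_zero_iff H2_inner_hfun)

lemma M_space_eq: "M_space a = range (\<lambda>x. hfun (adjop a x))"
  unfolding M_space_def H2_eq image_image co_toeplitz_hfun[OF a] ..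

lemma M_lift_adjop:
  assumes "p \<in> ker_perp a" shows "M_lift a (hfun (adjop a p)) = hfun p"
  unfolding M_lift_def
proof (rule the_equality)
  show "hfun p \<in> ker_compl a \<and> co_toeplitz a (hfun p) = hfun (adjop a p)"
    using assms by (simp add: ker_compl_eq co_toeplitz_hfun[OF a])
  show "f = hfun p" if "f \<in> ker_compl a \<and> co_toeplitz a f = hfun (adjop a p)" for f
    using that assms by (auto simp: ker_compl_eq co_toeplitz_hfun[OF a] hfun_eq_iff intro: ker_perp_inj)
qed

lemma M_inner_adjop:
  "p \<in> ker_perp a \<Longrightarrow> q \<in> ker_perp a \<Longrightarrow> M_inner a (hfun (adjop a p)) (hfun (adjop a q)) = cip p q"
  by (simp add: M_inner_def M_lift_adjop H2_inner_hfun)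

lemma M_norm_adjop: "p \<in> ker_perp a \<Longrightarrow> M_norm a (hfun (adjop a p)) = norm p"
  by (simp add: M_norm_def M_inner_adjop cip_self)

text \<open>A vector \<open>y\<close> with zero image has derivative value 0, hence
  \<open>cip y g = 0\<close>: the functional itself forces \<open>g\<close> into
  \<open>ker_perp a\<close>. Then \<open>g\<close> is the lift of its own image, and the inner
  product of the range becomes \<open>cip\<close>. The lemma serves points of the disk and
  \<open>\<zeta>\<^sub>0\<close> alike.\<close>

lemma representer:
  assumes D: "\<And>x. deriv_value l (hfun (adjop a x)) w = cip x g"
  shows "g \<in> ker_perp a" and "represents_deriv a w l (hfun (adjop a g))"
    and "M_kernel a w l = hfun (adjop a g)"
proof -
  \<comment> \<open>The derivative value of the zero function is read off from the hypothesis at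
    \<open>x = 0\<close>, so \<open>w\<close> may be a boundary point.\<close>
  have "cip y g = 0" if "adjop a y = 0" for y
    using D[of y] D[of 0] by (simp add: that adjop_zero)
  then show g: "g \<in> ker_perp a" by (auto simp: ker_perp_def cip_commute[of g])
  show rep: "represents_deriv a w l (hfun (adjop a g))"
    unfolding represents_deriv_def
  proof (intro conjI ballI)
    show "hfun (adjop a g) \<in> M_space a" by (simp add: M_space_eq)
    fix f assume "f \<in> M_space a"
    then obtain x where x: "f = hfun (adjop a x)" by (auto simp: M_space_eq)
    obtain p where p: "p \<in> ker_perp a" "adjop a p = adjop a x" by (rule ker_perp_decomposition)
    then show "deriv_value l f w = M_inner a f (hfun (adjop a g))"
      using D[of p] M_inner_adjop[OF p(1) g] by (simp add: x)
  qed
  show "M_kernel a w l = hfun (adjop a g)"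
    unfolding M_kernel_def
  proof (rule the_equality[of "represents_deriv a w l", OF rep])
    fix k assume k: "represents_deriv a w l k"
    then obtain x where x: "k = hfun (adjop a x)" by (auto simp: represents_deriv_def M_space_eq)
    obtain q where q: "q \<in> ker_perp a" "adjop a q = adjop a x" by (rule ker_perp_decomposition)
    have kq: "k = hfun (adjop a q)" by (simp add: x q)
    have "cip p q = cip p g" if p: "p \<in> ker_perp a" for p
    proof -
      have "hfun (adjop a p) \<in> M_space a" by (simp add: M_space_eq)
      then have "M_inner a (hfun (adjop a p)) k = M_inner a (hfun (adjop a p)) (hfun (adjop a g))"
        using k rep by (simp add: represents_deriv_def)
      then show ?thesis unfolding kq M_inner_adjop[OF p q(1)] M_inner_adjop[OF p g] .
    qed
    from this[OF ker_perp_diff[OF q(1) g]] have "cip (q - g) (q - g) = 0" by (simp add: cip_diff_right)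
    then have "q = g" by (simp add: cip_self)
    then show "k = hfun (adjop a g)" by (simp add: kq)
  qed
qed

lemma a_kernel_disk:
  assumes "norm w < 1" shows "a_kernel a w l = hfun (mulop a (szego_vec w l))"
proof
  fix z
  have "a z = 0" if "\<not> norm z < 1" using a that by (auto simp: Hinf_def disk_analytic_def)
  then show "a_kernel a w l z = hfun (mulop a (szego_vec w l)) z"
    by (cases "norm z < 1") (simp_all add: hfun_mulop[OF a] hfun_szego_vec[OF assms] szego_def a_kernel_def)
qed

lemma a_kernel_disk_H2: "norm w < 1 \<Longrightarrow> a_kernel a w l \<in> H2"
  by (simp add: a_kernel_disk hfun_in_H2)

lemma a_kernel_vec_disk: "norm w < 1 \<Longrightarrow> a_kernel_vec a w l = mulop a (szego_vec w l)"
  using hfun_a_kernel_vec[OF a_kernel_disk_H2] a_kernel_disk by (simp add: hfun_eq_iff)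

lemma deriv_hfun_adjop: "norm w < 1 \<Longrightarrow> (deriv ^^ l) (hfun (adjop a x)) w = cip x (a_kernel_vec a w l)"
  by (simp add: deriv_hfun cip_adjop[OF a] a_kernel_vec_disk)

lemma AE_bdry_a_kernel_vec:
  assumes H: "a_kernel a w l \<in> H2" and w: "norm w \<le> 1"
  shows "AE \<zeta> in circle_measure. bdry (hfun (a_kernel_vec a w l)) \<zeta> = fact l * (\<zeta> ^ l * bdry a \<zeta> / (1 - cnj w * \<zeta>) ^ (l + 1))"
proof -
  obtain \<alpha> where \<alpha>: "a = hfun \<alpha>" using Hinf_imp_H2[OF a] by (auto simp: H2_eq)
  show ?thesis using AE_bdry[of \<alpha>] AE_circle_norm AE_circle_neq[of w]
  proof eventually_elim
    case (elim \<zeta>)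
    have "1 - cnj w * \<zeta> \<noteq> 0" using norm_one_minus_cnj_mult[of \<zeta> w] elim by auto
    then show ?case using elim
      by (intro bdry_mult_kernel[where a=a]) (auto simp: \<alpha>[symmetric] hfun_a_kernel_vec[OF H] a_kernel_def)
  qed
qed

end

section \<open>The boundary kernels\<close>

text \<open>The distance from \<open>w\<close> to any point of the circle is at least
  \<open>1 - norm w\<close>. Equality and \<open>\<alpha> = 1\<close> are allowed in the hypothesis
  so that the radius is covered, with factor 2.\<close>

lemma Stolz_distance:
  assumes "norm \<zeta> = 1" "norm w \<le> 1" "norm (w - \<zeta>\<^sub>0) \<le> \<alpha> * (1 - norm w)" "0 \<le> \<alpha>"
  shows "norm (\<zeta> - \<zeta>\<^sub>0) \<le> (1 + \<alpha>) * norm (\<zeta> - w)"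
proof -
  have "1 - norm w \<le> norm (\<zeta> - w)" using norm_triangle_ineq2[of \<zeta> w] assms by simp
  then have "norm (w - \<zeta>\<^sub>0) \<le> \<alpha> * norm (\<zeta> - w)" using assms mult_left_mono[of "1 - norm w" "norm (\<zeta> - w)" \<alpha>] by linarith
  moreover have "norm (\<zeta> - \<zeta>\<^sub>0) \<le> norm (\<zeta> - w) + norm (w - \<zeta>\<^sub>0)" using norm_triangle_ineq[of "\<zeta> - w" "w - \<zeta>\<^sub>0"] by simp
  ultimately show ?thesis by (simp add: algebra_simps)
qed

text \<open>One weight dominates all orders up to \<open>N\<close>: two points of the circle are at
  distance at most 2, so raising the exponent from \<open>l + 1\<close> to \<open>N + 1\<close>
  costs \<open>2 ^ (N - l)\<close>. The choice \<open>A = 1\<close> covers the boundary kernel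
  \<open>w = \<zeta>\<^sub>0\<close>.\<close>

lemma norm_kernel_le:
  fixes b \<zeta> \<zeta>\<^sub>0 w :: complex
  assumes \<zeta>: "norm \<zeta> = 1" "norm \<zeta>\<^sub>0 = 1" "\<zeta> \<noteq> \<zeta>\<^sub>0" and A: "norm (\<zeta> - \<zeta>\<^sub>0) \<le> A * norm (\<zeta> - w)" and l: "l \<le> N"
  shows "norm (fact l * (\<zeta> ^ l * b / (1 - cnj w * \<zeta>) ^ (l + 1)))
           \<le> fact l * A ^ (l + 1) * 2 ^ (N - l) * (norm b / norm (\<zeta> - \<zeta>\<^sub>0) ^ (N + 1))"
proof -
  have pos: "0 < norm (\<zeta> - \<zeta>\<^sub>0)" using \<zeta> by simp
  then have pw: "0 < norm (\<zeta> - w)" using A by (cases "\<zeta> = w") auto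
  have le2: "norm (\<zeta> - \<zeta>\<^sub>0) \<le> 2" using norm_triangle_ineq4[of \<zeta> \<zeta>\<^sub>0] \<zeta> by simp
  have "norm (\<zeta> - \<zeta>\<^sub>0) ^ (N + 1) = norm (\<zeta> - \<zeta>\<^sub>0) ^ (l + 1) * norm (\<zeta> - \<zeta>\<^sub>0) ^ (N - l)"
    using l by (simp flip: power_add)
  also have "\<dots> \<le> (A * norm (\<zeta> - w)) ^ (l + 1) * 2 ^ (N - l)"
    using order_trans[OF norm_ge_zero A] by (intro mult_mono power_mono A le2 zero_le_power) auto
  finally have key: "norm (\<zeta> - \<zeta>\<^sub>0) ^ (N + 1) \<le> A ^ (l + 1) * 2 ^ (N - l) * norm (\<zeta> - w) ^ (l + 1)"
    by (simp only: power_mult_distrib mult_ac)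
  have "norm b / norm (\<zeta> - w) ^ (l + 1) \<le> A ^ (l + 1) * 2 ^ (N - l) * (norm b / norm (\<zeta> - \<zeta>\<^sub>0) ^ (N + 1))"
  proof -
    have "x / q \<le> c * (x / p)" if "p \<le> c * q" "0 < p" "0 < q" "0 \<le> x" for p q c x :: real
    proof -
      have "x * p \<le> x * (c * q)" by (rule mult_left_mono) (use that in auto)
      then show ?thesis using that by (simp add: field_simps)
    qed
    from this[OF key] show ?thesis using pos pw by simp
  qed
  then have "fact l * (norm b / norm (\<zeta> - w) ^ (l + 1)) \<le> fact l * (A ^ (l + 1) * 2 ^ (N - l) * (norm b / norm (\<zeta> - \<zeta>\<^sub>0) ^ (N + 1)))"
    by (rule mult_left_mono) simp
  moreover have "norm (fact l * (\<zeta> ^ l * b / (1 - cnj w * \<zeta>) ^ (l + 1))) = fact l * (norm b / norm (\<zeta> - w) ^ (l + 1))"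
    unfolding norm_mult norm_divide norm_power norm_one_minus_cnj_mult[OF \<zeta>(1)] using \<zeta> by simp
  ultimately show ?thesis by (simp only: mult.assoc)
qed

context
  fixes a :: "complex \<Rightarrow> complex" and \<zeta>\<^sub>0 :: complex and N :: nat
  assumes a: "a \<in> Hinf" and \<zeta>\<^sub>0: "norm \<zeta>\<^sub>0 = 1"
begin

definition weight :: "complex \<Rightarrow> real" where
  "weight \<zeta> = (norm (bdry a \<zeta>))\<^sup>2 / norm (\<zeta> - \<zeta>\<^sub>0) ^ (2 * N + 2)"

lemma weight_measurable [measurable]: "weight \<in> borel_measurable borel"
  using bdry_symbol_measurable[OF a] unfolding weight_def[abs_def] by measurable

lemma weight_nonneg [simp]: "0 \<le> weight \<zeta>"
  by (simp add: weight_def)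

lemma weight_eq: "weight \<zeta> = (norm (bdry a \<zeta>) / norm (\<zeta> - \<zeta>\<^sub>0) ^ (N + 1))\<^sup>2"
proof -
  have "2 * N + 2 = (N + 1) * 2" by simp
  then show ?thesis by (simp only: weight_def power_divide power_mult)
qed

abbreviation boundary_kernel :: "complex \<Rightarrow> nat \<Rightarrow> complex \<Rightarrow> complex" where
  "boundary_kernel w l \<zeta> \<equiv> fact l * (\<zeta> ^ l * bdry a \<zeta> / (1 - cnj w * \<zeta>) ^ (l + 1))"

lemma norm_a_kernel_vec:
  assumes "a_kernel a w l \<in> H2" "norm w \<le> 1"
  shows "(norm (a_kernel_vec a w l))\<^sup>2 = (\<integral>\<zeta>. (cmod (boundary_kernel w l \<zeta>))\<^sup>2 \<partial>circle_measure)"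
proof -
  note [measurable] = bdry_symbol_measurable[OF a]
  show ?thesis unfolding integral_bdry_square[symmetric]
  proof (rule integral_cong_AE)
    show "AE \<zeta> in circle_measure. (cmod (bdry (hfun (a_kernel_vec a w l)) \<zeta>))\<^sup>2 = (cmod (boundary_kernel w l \<zeta>))\<^sup>2"
      using AE_bdry_a_kernel_vec[OF a assms] by eventually_elim simp
  qed measurable
qed

text \<open>Square integrable boundary values alone do not place an analytic function in H^2.
  Instead the kernels at points of the radius have uniformly bounded norms, and their pointwise
  limit inherits the bound on every smaller circle.\<close>

lemma a_kernel_boundary_H2:
  assumes W: "integrable circle_measure weight" and l: "l \<le> N"
  shows "a_kernel a \<zeta>\<^sub>0 l \<in> H2"
proof -
  note [measurable] = bdry_symbol_measurable[OF a]
  \<comment> \<open>The constant of \<open>norm_kernel_le\<close> for \<open>A = 2\<close>, the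
    factor valid on the radius.\<close>
  define C where "C = fact l * 2 ^ (l + 1) * (2::real) ^ (N - l)"
  define M where "M = C\<^sup>2 * (\<integral>\<zeta>. weight \<zeta> \<partial>circle_measure)"
  let ?w = "\<lambda>k. of_real (radii k) * \<zeta>\<^sub>0"
  have w: "norm (?w k) < 1" "norm (?w k) \<le> 1" for k 
    unfolding norm_radial[OF \<zeta>\<^sub>0] using radii_bounds[of k] by auto
  have nM: "(norm (a_kernel_vec a (?w k) l))\<^sup>2 \<le> M" for k
  proof -
    have "(norm (a_kernel_vec a (?w k) l))\<^sup>2 = (\<integral>\<zeta>. (cmod (boundary_kernel (?w k) l \<zeta>))\<^sup>2 \<partial>circle_measure)"
      by (rule norm_a_kernel_vec[OF a_kernel_disk_H2[OF a w(1)] w(2)])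
    also have "\<dots> \<le> (\<integral>\<zeta>. C\<^sup>2 * weight \<zeta> \<partial>circle_measure)"
    proof (rule integral_mono_AE')
      show "AE \<zeta> in circle_measure. (cmod (boundary_kernel (?w k) l \<zeta>))\<^sup>2 \<le> C\<^sup>2 * weight \<zeta>"
        using AE_circle_norm AE_circle_neq[of \<zeta>\<^sub>0]
      proof eventually_elim
        case (elim \<zeta>)
        have "norm (\<zeta> - \<zeta>\<^sub>0) \<le> (1 + 1) * norm (\<zeta> - ?w k)"
          by (rule Stolz_distance[OF elim(1) w(2)]) (simp_all only: norm_radial[OF \<zeta>\<^sub>0], simp_all)
        then have "norm (\<zeta> - \<zeta>\<^sub>0) \<le> 2 * norm (\<zeta> - ?w k)" by simp
        from norm_kernel_le[OF elim(1) \<zeta>\<^sub>0 elim(2) this l]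
        have "cmod (boundary_kernel (?w k) l \<zeta>) \<le> C * (norm (bdry a \<zeta>) / norm (\<zeta> - \<zeta>\<^sub>0) ^ (N + 1))" unfolding C_def .
        then show ?case unfolding weight_eq power_mult_distrib[symmetric] by (rule power_mono) simp
      qed
    qed (use W in auto)
    also have "\<dots> = M" by (simp add: M_def)
    finally show ?thesis .
  qed
  let ?f = "a_kernel a \<zeta>\<^sub>0 l"
  have nz: "1 - cnj \<zeta>\<^sub>0 * z \<noteq> 0" if "norm z < 1" for z
  proof
    assume "1 - cnj \<zeta>\<^sub>0 * z = 0"
    then have "cmod (cnj \<zeta>\<^sub>0 * z) = 1" by simp
    then show False using that \<zeta>\<^sub>0 by (simp add: norm_mult)
  qed
  have f: "?f \<in> disk_analytic"
    using a nz unfolding disk_analytic_def Hinf_def a_kernel_def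
    by (auto intro!: holomorphic_intros)
  have wlim: "?w \<longlonglongrightarrow> \<zeta>\<^sub>0" using radial_filterlim[OF \<zeta>\<^sub>0, of 2] by (simp add: filterlim_at)
  have flim: "(\<lambda>k. hfun (a_kernel_vec a (?w k) l) z) \<longlonglongrightarrow> ?f z" if "norm z < 1" for z
    unfolding hfun_a_kernel_vec[OF a_kernel_disk_H2[OF a w(1)]] a_kernel_def
    using nz[OF that] by (intro tendsto_intros wlim) simp
  have M0: "0 \<le> M" using nM[of 0] zero_le_power2 order_trans by blast
  have nM': "norm (a_kernel_vec a (?w k) l) \<le> sqrt M" for k using nM by (rule real_le_rsqrt)
  show ?thesis unfolding H2_def
  proof (intro CollectI conjI f exI ballI)
    fix r :: real assume "r \<in> {0..<1}"
    then have r: "0 \<le> r" "r < 1" by auto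
    show "(\<integral>\<zeta>. (norm (?f (of_real r * \<zeta>)))\<^sup>2 \<partial>circle_measure) \<le> M"
    proof (rule LIMSEQ_le_const2)
      show "(\<lambda>k. \<integral>\<zeta>. (norm (hfun (a_kernel_vec a (?w k) l) (of_real r * \<zeta>)))\<^sup>2 \<partial>circle_measure)
         \<longlonglongrightarrow> (\<integral>\<zeta>. (norm (?f (of_real r * \<zeta>)))\<^sup>2 \<partial>circle_measure)"
      \<comment> \<open>At a fixed radius below 1 the uniform norm bound dominates pointwise, by
        \<open>norm_hfun_le\<close>.\<close>
      proof (rule integral_dominated_convergence[where w="\<lambda>_. (sqrt M / (1 - r))\<^sup>2"])
        show "AE \<zeta> in circle_measure. (\<lambda>k. (norm (hfun (a_kernel_vec a (?w k) l) (of_real r * \<zeta>)))\<^sup>2) \<longlonglongrightarrow> (norm (?f (of_real r * \<zeta>)))\<^sup>2"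
          using AE_circle_norm
          by eventually_elim (intro tendsto_intros flim, use r in \<open>simp add: norm_mult\<close>)
        show "AE \<zeta> in circle_measure. norm ((norm (hfun (a_kernel_vec a (?w k) l) (of_real r * \<zeta>)))\<^sup>2) \<le> (sqrt M / (1 - r))\<^sup>2" for k
          using AE_circle_norm
        proof eventually_elim
          case (elim \<zeta>)
          then have n: "norm (of_real r * \<zeta>) = r" using r by (simp add: norm_mult)
          have "norm (hfun (a_kernel_vec a (?w k) l) (of_real r * \<zeta>)) \<le> norm (a_kernel_vec a (?w k) l) / (1 - r)"
            using norm_hfun_le[of "of_real r * \<zeta>" "a_kernel_vec a (?w k) l"] r unfolding n by simp
          also have "\<dots> \<le> sqrt M / (1 - r)" using r by (intro divide_right_mono nM') auto
          finally show ?case unfolding real_norm_def abs_power2 norm_power by (intro power_mono) auto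
        qed
        show "(\<lambda>\<zeta>. (norm (hfun (a_kernel_vec a (?w k) l) (of_real r * \<zeta>)))\<^sup>2) \<in> borel_measurable circle_measure" for k
          using disk_analytic_measurable[OF hfun_disk_analytic] by measurable
        show "(\<lambda>\<zeta>. (norm (?f (of_real r * \<zeta>)))\<^sup>2) \<in> borel_measurable circle_measure"
          using disk_analytic_measurable[OF f] by measurable
      qed simp
      show "\<exists>K. \<forall>k\<ge>K. (\<integral>\<zeta>. (norm (hfun (a_kernel_vec a (?w k) l) (of_real r * \<zeta>)))\<^sup>2 \<partial>circle_measure) \<le> M"
        using hfun_mean_square_le[OF r] nM order_trans by blast
    qed
  qed
qed

lemma a_kernel_vec_tendsto:
  assumes W: "integrable circle_measure weight" and l: "l \<le> N" and \<alpha>: "1 < \<alpha>"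
  shows "((\<lambda>w. a_kernel_vec a w l) \<longlongrightarrow> a_kernel_vec a \<zeta>\<^sub>0 l) (at \<zeta>\<^sub>0 within Stolz \<alpha> \<zeta>\<^sub>0)"
  unfolding tendsto_at_iff_sequentially o_def
proof (intro allI impI)
  fix X assume XS: "\<forall>i. X i \<in> Stolz \<alpha> \<zeta>\<^sub>0 - {\<zeta>\<^sub>0}" and X: "X \<longlonglongrightarrow> \<zeta>\<^sub>0"
  note [measurable] = bdry_symbol_measurable[OF a]
  have Xn: "norm (X i) < 1" "norm (X i) \<le> 1" "norm (X i - \<zeta>\<^sub>0) \<le> \<alpha> * (1 - norm (X i))" for i
    using XS by (auto simp: Stolz_def intro: less_imp_le)
  define C where "C A = fact l * A ^ (l + 1) * (2::real) ^ (N - l)" for A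
  have H: "a_kernel a (X i) l \<in> H2" "a_kernel a \<zeta>\<^sub>0 l \<in> H2" for i
    using a_kernel_disk_H2[OF a Xn(1)] a_kernel_boundary_H2[OF W l] by auto
  have eq: "(norm (a_kernel_vec a (X i) l - a_kernel_vec a \<zeta>\<^sub>0 l))\<^sup>2 = (\<integral>\<zeta>. (cmod (boundary_kernel (X i) l \<zeta> - boundary_kernel \<zeta>\<^sub>0 l \<zeta>))\<^sup>2 \<partial>circle_measure)" for i
    unfolding integral_bdry_square[symmetric]
  proof (rule integral_cong_AE)
    have "norm \<zeta>\<^sub>0 \<le> 1" using \<zeta>\<^sub>0 by simp
    show "AE \<zeta> in circle_measure. (cmod (bdry (hfun (a_kernel_vec a (X i) l - a_kernel_vec a \<zeta>\<^sub>0 l)) \<zeta>))\<^sup>2 = (cmod (boundary_kernel (X i) l \<zeta> - boundary_kernel \<zeta>\<^sub>0 l \<zeta>))\<^sup>2"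
      using AE_bdry_a_kernel_vec[OF a H(1)[of i] Xn(2)] AE_bdry_a_kernel_vec[OF a H(2) \<open>norm \<zeta>\<^sub>0 \<le> 1\<close>] AE_bdry_diff[of "a_kernel_vec a (X i) l" "a_kernel_vec a \<zeta>\<^sub>0 l"]
      by eventually_elim (simp only:)
  qed measurable
  have "(\<lambda>i. \<integral>\<zeta>. (cmod (boundary_kernel (X i) l \<zeta> - boundary_kernel \<zeta>\<^sub>0 l \<zeta>))\<^sup>2 \<partial>circle_measure) \<longlonglongrightarrow> (\<integral>\<zeta>. 0 \<partial>circle_measure)"
  \<comment> \<open>The two constants belong to the kernels at \<open>X i\<close>, where the Stolz
    angle gives the factor \<open>1 + \<alpha>\<close>, and to the limit kernel, where the factor is
    1.\<close>
  proof (rule integral_dominated_convergence[where w="\<lambda>\<zeta>. (C (1 + \<alpha>) + C 1)\<^sup>2 * weight \<zeta>"])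
    show "AE \<zeta> in circle_measure. (\<lambda>i. (cmod (boundary_kernel (X i) l \<zeta> - boundary_kernel \<zeta>\<^sub>0 l \<zeta>))\<^sup>2) \<longlonglongrightarrow> 0"
      using AE_circle_norm AE_circle_neq[of \<zeta>\<^sub>0]
    proof eventually_elim
      case (elim \<zeta>)
      have "1 - cnj \<zeta>\<^sub>0 * \<zeta> \<noteq> 0" using norm_one_minus_cnj_mult[of \<zeta> \<zeta>\<^sub>0] elim by auto
      then have "(\<lambda>i. (cmod (boundary_kernel (X i) l \<zeta> - boundary_kernel \<zeta>\<^sub>0 l \<zeta>))\<^sup>2) \<longlonglongrightarrow> (cmod (boundary_kernel \<zeta>\<^sub>0 l \<zeta> - boundary_kernel \<zeta>\<^sub>0 l \<zeta>))\<^sup>2"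
        by (intro tendsto_intros X) simp
      then show ?case by simp
    qed
    show "AE \<zeta> in circle_measure. norm ((cmod (boundary_kernel (X i) l \<zeta> - boundary_kernel \<zeta>\<^sub>0 l \<zeta>))\<^sup>2) \<le> (C (1 + \<alpha>) + C 1)\<^sup>2 * weight \<zeta>" for i
      using AE_circle_norm AE_circle_neq[of \<zeta>\<^sub>0]
    proof eventually_elim
      case (elim \<zeta>)
      let ?s = "norm (bdry a \<zeta>) / norm (\<zeta> - \<zeta>\<^sub>0) ^ (N + 1)"
      have "norm (\<zeta> - \<zeta>\<^sub>0) \<le> (1 + \<alpha>) * norm (\<zeta> - X i)"
        using \<alpha> by (intro Stolz_distance[OF elim(1) Xn(2,3)]) simp
      from norm_kernel_le[OF elim(1) \<zeta>\<^sub>0 elim(2) this l]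
      have 1: "cmod (boundary_kernel (X i) l \<zeta>) \<le> C (1 + \<alpha>) * ?s" unfolding C_def .
      have "norm (\<zeta> - \<zeta>\<^sub>0) \<le> 1 * norm (\<zeta> - \<zeta>\<^sub>0)" by simp
      from norm_kernel_le[OF elim(1) \<zeta>\<^sub>0 elim(2) this l]
      have 2: "cmod (boundary_kernel \<zeta>\<^sub>0 l \<zeta>) \<le> C 1 * ?s" unfolding C_def .
      have "cmod (boundary_kernel (X i) l \<zeta> - boundary_kernel \<zeta>\<^sub>0 l \<zeta>) \<le> cmod (boundary_kernel (X i) l \<zeta>) + cmod (boundary_kernel \<zeta>\<^sub>0 l \<zeta>)" by (rule norm_triangle_ineq4)
      also have "\<dots> \<le> (C (1 + \<alpha>) + C 1) * ?s" using 1 2 unfolding distrib_right by linarith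
      finally have "(cmod (boundary_kernel (X i) l \<zeta> - boundary_kernel \<zeta>\<^sub>0 l \<zeta>))\<^sup>2 \<le> ((C (1 + \<alpha>) + C 1) * ?s)\<^sup>2" by (rule power_mono) simp
      then show ?case unfolding weight_eq power_mult_distrib real_norm_def abs_power2 .
    qed
  qed (use W in auto)
  then have "(\<lambda>i. (norm (a_kernel_vec a (X i) l - a_kernel_vec a \<zeta>\<^sub>0 l))\<^sup>2) \<longlonglongrightarrow> 0" unfolding eq by simp
  from tendsto_real_sqrt[OF this] have "(\<lambda>i. a_kernel_vec a (X i) l - a_kernel_vec a \<zeta>\<^sub>0 l) \<longlonglongrightarrow> 0"
    by (simp add: tendsto_norm_zero_iff)
  then show "(\<lambda>i. a_kernel_vec a (X i) l) \<longlonglongrightarrow> a_kernel_vec a \<zeta>\<^sub>0 l" by (simp add: LIM_zero_iff)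
qed

lemma nt_limit_deriv:
  assumes W: "integrable circle_measure weight" and l: "l \<le> N"
  shows "has_nt_limit ((deriv ^^ l) (hfun (adjop a x))) \<zeta>\<^sub>0 (cip x (a_kernel_vec a \<zeta>\<^sub>0 l))"
  unfolding has_nt_limit_def
proof (intro allI impI)
  fix \<alpha> :: real assume \<alpha>: "1 < \<alpha>"
  have "((\<lambda>w. cip x (a_kernel_vec a w l)) \<longlongrightarrow> cip x (a_kernel_vec a \<zeta>\<^sub>0 l)) (at \<zeta>\<^sub>0 within Stolz \<alpha> \<zeta>\<^sub>0)"
    by (intro tendsto_cip_right a_kernel_vec_tendsto W l \<alpha>)
  moreover have "\<forall>\<^sub>F w in at \<zeta>\<^sub>0 within Stolz \<alpha> \<zeta>\<^sub>0. cip x (a_kernel_vec a w l) = (deriv ^^ l) (hfun (adjop a x)) w"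
    unfolding eventually_at_filter by (auto simp: Stolz_def deriv_hfun_adjop[OF a])
  ultimately show "((deriv ^^ l) (hfun (adjop a x)) \<longlongrightarrow> cip x (a_kernel_vec a \<zeta>\<^sub>0 l)) (at \<zeta>\<^sub>0 within Stolz \<alpha> \<zeta>\<^sub>0)"
    by (rule Lim_transform_eventually)
qed

lemma nt_limit_imp_integrable:
  assumes nt: "\<And>x. \<exists>L. has_nt_limit ((deriv ^^ N) (hfun (adjop a x))) \<zeta>\<^sub>0 L"
  shows "integrable circle_measure weight"
proof -
  note [measurable] = bdry_symbol_measurable[OF a]
  let ?w = "\<lambda>k. of_real (radii k) * \<zeta>\<^sub>0"
  have w: "norm (?w k) < 1" "norm (?w k) \<le> 1" for k 
    unfolding norm_radial[OF \<zeta>\<^sub>0] using radii_bounds[of k] by auto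
  have "bounded (range (\<lambda>k. a_kernel_vec a (?w k) N))"
  proof (rule uniform_boundedness_inner)
    fix x
    obtain L where "has_nt_limit ((deriv ^^ N) (hfun (adjop a x))) \<zeta>\<^sub>0 L" using nt by blast
    then have "((deriv ^^ N) (hfun (adjop a x)) \<longlongrightarrow> L) (at \<zeta>\<^sub>0 within Stolz 2 \<zeta>\<^sub>0)" by (simp add: has_nt_limit_def)
    from filterlim_compose[OF this radial_filterlim[OF \<zeta>\<^sub>0]]
    have "(\<lambda>k. (deriv ^^ N) (hfun (adjop a x)) (?w k)) \<longlonglongrightarrow> L" by simp
    then have "(\<lambda>k. cip x (a_kernel_vec a (?w k) N)) \<longlonglongrightarrow> L" unfolding deriv_hfun_adjop[OF a w(1)] .
    \<comment> \<open>Convergent sequences are bounded, so limits along one radius supply the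
      pointwise bounds for the uniform boundedness principle.\<close>
    from tendsto_Re[OF this] show "bounded (range (\<lambda>k. inner x (a_kernel_vec a (?w k) N)))"
      unfolding Re_cip by (rule convergent_imp_bounded)
  qed
  then obtain C where C: "\<And>k. norm (a_kernel_vec a (?w k) N) \<le> C" by (auto simp: bounded_iff)
  have bkm: "(\<lambda>\<zeta>. (cmod (boundary_kernel (?w k) N \<zeta>))\<^sup>2) \<in> borel_measurable circle_measure" for k by measurable
  have le: "(\<integral>\<^sup>+\<zeta>. ennreal ((cmod (boundary_kernel (?w k) N \<zeta>))\<^sup>2) \<partial>circle_measure) \<le> ennreal (C\<^sup>2)" for k
  proof -
    have H: "a_kernel a (?w k) N \<in> H2" by (rule a_kernel_disk_H2[OF a w(1)])
    have "(\<integral>\<^sup>+\<zeta>. ennreal ((cmod (boundary_kernel (?w k) N \<zeta>))\<^sup>2) \<partial>circle_measure)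
        = (\<integral>\<^sup>+\<zeta>. ennreal ((cmod (bdry (hfun (a_kernel_vec a (?w k) N)) \<zeta>))\<^sup>2) \<partial>circle_measure)"
      by (rule nn_integral_cong_AE) (use AE_bdry_a_kernel_vec[OF a H w(2)] in eventually_elim, simp only:)
    also have "\<dots> \<le> ennreal ((norm (a_kernel_vec a (?w k) N))\<^sup>2)" by (rule nn_integral_bdry_le)
    also have "\<dots> \<le> ennreal (C\<^sup>2)" by (intro ennreal_leI power_mono C) simp
    finally show ?thesis .
  qed
  have wlim: "?w \<longlonglongrightarrow> \<zeta>\<^sub>0" using radial_filterlim[OF \<zeta>\<^sub>0, of 2] by (simp add: filterlim_at)
  have "(\<integral>\<^sup>+\<zeta>. ennreal (weight \<zeta>) \<partial>circle_measure) \<le> (\<integral>\<^sup>+\<zeta>. liminf (\<lambda>k. ennreal ((cmod (boundary_kernel (?w k) N \<zeta>))\<^sup>2)) \<partial>circle_measure)"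
  proof (rule nn_integral_mono_AE)
    show "AE \<zeta> in circle_measure. ennreal (weight \<zeta>) \<le> liminf (\<lambda>k. ennreal ((cmod (boundary_kernel (?w k) N \<zeta>))\<^sup>2))"
      using AE_circle_norm AE_circle_neq[of \<zeta>\<^sub>0]
    proof eventually_elim
      case (elim \<zeta>)
      have "1 - cnj \<zeta>\<^sub>0 * \<zeta> \<noteq> 0" using norm_one_minus_cnj_mult[of \<zeta> \<zeta>\<^sub>0] elim by auto
      then have "(\<lambda>k. ennreal ((cmod (boundary_kernel (?w k) N \<zeta>))\<^sup>2)) \<longlonglongrightarrow> ennreal ((cmod (boundary_kernel \<zeta>\<^sub>0 N \<zeta>))\<^sup>2)"
        by (intro tendsto_ennrealI tendsto_intros wlim) simp
      from lim_imp_Liminf[OF _ this]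
      have "liminf (\<lambda>k. ennreal ((cmod (boundary_kernel (?w k) N \<zeta>))\<^sup>2)) = ennreal ((cmod (boundary_kernel \<zeta>\<^sub>0 N \<zeta>))\<^sup>2)" by simp
      \<comment> \<open>For order \<open>N\<close> the modulus of the boundary kernel is the square
        root of the weight times \<open>fact N\<close>, which is at least 1.\<close>
      moreover have "weight \<zeta> \<le> (cmod (boundary_kernel \<zeta>\<^sub>0 N \<zeta>))\<^sup>2"
      proof -
        let ?s = "norm (bdry a \<zeta>) / norm (\<zeta> - \<zeta>\<^sub>0) ^ (N + 1)"
        have "cmod (boundary_kernel \<zeta>\<^sub>0 N \<zeta>) = fact N * ?s"
          unfolding norm_mult norm_divide norm_power norm_one_minus_cnj_mult[OF elim(1)] by (simp add: elim(1))
        moreover have "1 * ?s \<le> fact N * ?s" by (rule mult_right_mono) auto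
        ultimately have "?s \<le> cmod (boundary_kernel \<zeta>\<^sub>0 N \<zeta>)" by linarith
        then show ?thesis unfolding weight_eq by (rule power_mono) simp
      qed
      ultimately show ?case by (simp add: ennreal_leI)
    qed
  qed
  also have "\<dots> \<le> liminf (\<lambda>k. \<integral>\<^sup>+\<zeta>. ennreal ((cmod (boundary_kernel (?w k) N \<zeta>))\<^sup>2) \<partial>circle_measure)"
    by (rule nn_integral_liminf) measurable
  also have "\<dots> \<le> liminf (\<lambda>k. ennreal (C\<^sup>2))" by (intro Liminf_mono always_eventually allI le)
  also have "\<dots> = ennreal (C\<^sup>2)" by (simp add: Liminf_const)
  finally have "(\<integral>\<^sup>+\<zeta>. ennreal (weight \<zeta>) \<partial>circle_measure) \<le> ennreal (C\<^sup>2)" .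
  from le_less_trans[OF this ennreal_less_top] show ?thesis by (intro integrableI_bounded) auto
qed

lemma integrable_weight_iff:
  "integrable circle_measure weight \<longleftrightarrow>
    (\<integral>\<^sup>+t\<in>{0..2*pi}. ennreal ((norm (bdry a (cis t)))\<^sup>2 / norm (cis t - \<zeta>\<^sub>0) ^ (2 * N + 2)) \<partial>lborel) < \<infinity>"
proof -
  have "integrable circle_measure weight \<longleftrightarrow> (\<integral>\<^sup>+\<zeta>. ennreal (weight \<zeta>) \<partial>circle_measure) < \<infinity>"
    by (simp add: integrable_iff_bounded)
  also have "\<dots> \<longleftrightarrow> (\<integral>\<^sup>+t\<in>{0..2*pi}. ennreal (weight (cis t)) \<partial>lborel) < \<infinity>"
    by (subst nn_integral_circle) (auto simp: less_top[symmetric] ennreal_divide_eq_top_iff)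
  finally show ?thesis unfolding weight_def .
qed

lemma deriv_value_disk: "norm w < 1 \<Longrightarrow> deriv_value l (hfun (adjop a x)) w = cip x (a_kernel_vec a w l)"
  by (simp add: deriv_value_def deriv_hfun_adjop[OF a])

lemma deriv_value_boundary:
  assumes "integrable circle_measure weight" "l \<le> N"
  shows "deriv_value l (hfun (adjop a x)) \<zeta>\<^sub>0 = cip x (a_kernel_vec a \<zeta>\<^sub>0 l)"
proof -
  have "(THE L. has_nt_limit ((deriv ^^ l) (hfun (adjop a x))) \<zeta>\<^sub>0 L) = cip x (a_kernel_vec a \<zeta>\<^sub>0 l)"
    by (rule the_equality) (use nt_limit_deriv[OF assms, of x] has_nt_limit_unique[OF \<zeta>\<^sub>0] in auto)
  then show ?thesis using \<zeta>\<^sub>0 by (simp add: deriv_value_def)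
qed

end

theorem corollary4p11:
  fixes a :: "complex \<Rightarrow> complex" and \<zeta>\<^sub>0 :: complex and N :: nat
  assumes "a \<in> Hinf" and "norm \<zeta>\<^sub>0 = 1"
  shows "((\<forall>f\<in>M_space a. \<forall>j\<le>N. \<exists>L. has_nt_limit ((deriv ^^ j) f) \<zeta>\<^sub>0 L) \<longleftrightarrow>
           (\<integral>\<^sup>+t\<in>{0..2*pi}. ennreal ((norm (bdry a (cis t)))\<^sup>2
              / norm (cis t - \<zeta>\<^sub>0) ^ (2 * N + 2)) \<partial>lborel) < \<infinity>) \<and>
         ((\<integral>\<^sup>+t\<in>{0..2*pi}. ennreal ((norm (bdry a (cis t)))\<^sup>2
              / norm (cis t - \<zeta>\<^sub>0) ^ (2 * N + 2)) \<partial>lborel) < \<infinity> \<longrightarrow>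
           (\<forall>l\<le>N.
              a_kernel a \<zeta>\<^sub>0 l \<in> H2 \<and>
              represents_deriv a \<zeta>\<^sub>0 l (M_kernel a \<zeta>\<^sub>0 l) \<and>
              M_kernel a \<zeta>\<^sub>0 l = co_toeplitz a (a_kernel a \<zeta>\<^sub>0 l) \<and>
              (\<forall>\<alpha>>1. ((\<lambda>w. M_norm a (\<lambda>z. M_kernel a w l z - M_kernel a \<zeta>\<^sub>0 l z)) \<longlongrightarrow> 0)
                       (at \<zeta>\<^sub>0 within Stolz \<alpha> \<zeta>\<^sub>0))))"
  unfolding integrable_weight_iff[OF assms, symmetric]
proof (intro conjI iffI impI allI)
  let ?W = "weight a \<zeta>\<^sub>0 N"
  show "integrable circle_measure ?W" if "\<forall>f\<in>M_space a. \<forall>j\<le>N. \<exists>L. has_nt_limit ((deriv ^^ j) f) \<zeta>\<^sub>0 L"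
    using that by (intro nt_limit_imp_integrable[OF assms]) (auto simp: M_space_eq[OF assms(1)])
  show "\<forall>f\<in>M_space a. \<forall>j\<le>N. \<exists>L. has_nt_limit ((deriv ^^ j) f) \<zeta>\<^sub>0 L" if W: "integrable circle_measure ?W"
    using nt_limit_deriv[OF assms W] by (auto simp: M_space_eq[OF assms(1)])
  fix l assume W: "integrable circle_measure ?W" and l: "l \<le> N"
  note H = a_kernel_boundary_H2[OF assms W l]
  show "a_kernel a \<zeta>\<^sub>0 l \<in> H2" by (rule H)
  note rep0 = representer[OF assms(1) deriv_value_boundary[OF assms W l]]
  show "represents_deriv a \<zeta>\<^sub>0 l (M_kernel a \<zeta>\<^sub>0 l)" unfolding rep0(3) by (rule rep0(2))
  show "M_kernel a \<zeta>\<^sub>0 l = co_toeplitz a (a_kernel a \<zeta>\<^sub>0 l)"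
    unfolding rep0(3) co_toeplitz_hfun[OF assms(1), symmetric] hfun_a_kernel_vec[OF H] ..
  fix \<alpha> :: real assume \<alpha>: "1 < \<alpha>"
  have "((\<lambda>w. norm (a_kernel_vec a w l - a_kernel_vec a \<zeta>\<^sub>0 l)) \<longlongrightarrow> 0) (at \<zeta>\<^sub>0 within Stolz \<alpha> \<zeta>\<^sub>0)"
    using a_kernel_vec_tendsto[OF assms W l \<alpha>] by (intro tendsto_norm_zero LIM_zero)
  \<comment> \<open>Both kernels are images of vectors in \<open>ker_perp a\<close>, and so is their
    difference; its norm in the range space is the norm of the difference of these vectors.\<close>
  moreover have "\<forall>\<^sub>F w in at \<zeta>\<^sub>0 within Stolz \<alpha> \<zeta>\<^sub>0.
      norm (a_kernel_vec a w l - a_kernel_vec a \<zeta>\<^sub>0 l) = M_norm a (\<lambda>z. M_kernel a w l z - M_kernel a \<zeta>\<^sub>0 l z)"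
    unfolding eventually_at_filter
  proof (intro always_eventually allI impI)
    fix w assume "w \<in> Stolz \<alpha> \<zeta>\<^sub>0"
    then have "norm w < 1" by (simp add: Stolz_def)
    note rep = representer[OF assms(1) deriv_value_disk[OF assms this]]
    have "(\<lambda>z. M_kernel a w l z - M_kernel a \<zeta>\<^sub>0 l z) = hfun (adjop a (a_kernel_vec a w l - a_kernel_vec a \<zeta>\<^sub>0 l))"
      by (simp add: fun_eq_iff rep(3) rep0(3) adjop_diff[OF assms(1)] hfun_diff)
    then show "norm (a_kernel_vec a w l - a_kernel_vec a \<zeta>\<^sub>0 l) = M_norm a (\<lambda>z. M_kernel a w l z - M_kernel a \<zeta>\<^sub>0 l z)"
      using M_norm_adjop[OF assms(1) ker_perp_diff[OF assms(1) rep(1) rep0(1)]] by simp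
  qed
  ultimately show "((\<lambda>w. M_norm a (\<lambda>z. M_kernel a w l z - M_kernel a \<zeta>\<^sub>0 l z)) \<longlongrightarrow> 0) (at \<zeta>\<^sub>0 within Stolz \<alpha> \<zeta>\<^sub>0)"
    by (rule Lim_transform_eventually)
qed

end
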